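(* Let $(M,g)$ be a two-dimensional oriented Riemannian manifold with curvature $K$ such that $\Sigma=\{x\in M:K(x)=0\}$ is a (possibly empty) closed one-dimensional submanifold of $M$, and let $\hat\Sigma=\pi^{-1}(\Sigma)\subset SO(M,g)$. Let $C$ be a real constant and let $\gamma:I=(a,b)\to M$ be a solution of $$\nabla_{\frac{d\gamma}{dt}}\frac{d\gamma}{dt}=C\,K\,J(\dot\gamma)-C^2K\,\mathrm{grad}\,K .$$ Let $I_1=\gamma^{-1}(M\setminus\Sigma)$. Then, for each $t_0\in I$ and each $p\in\pi^{-1}(\gamma(t_0))$, there exists a curve $\hat\gamma:I\to SO(M,g)$ such that $\hat\gamma(t_0)=p$, $\pi(\hat\gamma(t))=\gamma(t)$, and $\hat\gamma$ restricted to the open set $I_1$ is a geodesic of the Wagner lift metric $\hat g$ on $SO(M,g)\setminus\hat\Sigma$.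
   Context: $\nabla$ is the Levi-Civita connection of $g$, and $J$ is the complex structure associated with $g$ and the orientation (for a positively oriented orthonormal frame, $Je_1=e_2$, $Je_2=-e_1$). Let $\pi:SO(M,g)\to M$ be the principal $SO(2)$-bundle of positively oriented orthonormal frames, with right action $\{e_1,e_2\}\cdot r(\varphi)=\{\cos\varphi\, e_1+\sin\varphi\, e_2,\,-\sin\varphi\, e_1+\cos\varphi\, e_2\}$. The Levi-Civita connection of $g$ determines the $SO(2)$-invariant horizontal distribution $\mathcal{H}$ on $SO(M,g)$, complementary to the vertical distribution $V$ (tangent to the fibers). Let $\partial_\varphi|_p=\frac{d}{d\varphi}|_{\varphi=0}\, p\cdot r(\varphi)$; it spans $V$. The Wagner lift $\hat g$ of $g$ is the Riemannian metric on $SO(M,g)\setminus\hat\Sigma$ defined by: $\hat g(X,Y)_p=g(d\pi X,d\pi Y)$ for $X,Y\in\mathcal{H}_p$; $\hat g(X,Y)_p=0$ for $X\in\mathcal{H}_p$, $Y\in V_p$; and $\hat g(\partial_\varphi,\partial_\varphi)_p=1/K^2(\pi(p))$. *)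

theory Defs
  imports "HOL-Analysis.Analysis"
begin

section \<open>Smooth maps between open sets of normed spaces\<close>

text \<open>These notions are meant for open \<open>S\<close> only.\<close>

primrec C_k_on :: "nat \<Rightarrow> ('a::real_normed_vector \<Rightarrow> 'b::real_normed_vector) \<Rightarrow> 'a set \<Rightarrow> bool" where
  "C_k_on 0 = (\<lambda>f S. continuous_on S f)"
| "C_k_on (Suc k) = (\<lambda>f S. (\<forall>x\<in>S. f differentiable (at x)) \<and>
      (\<forall>v. C_k_on k (\<lambda>x. frechet_derivative f (at x) v) S))"

definition smooth_on :: "'a::real_normed_vector set \<Rightarrow> ('a \<Rightarrow> 'b::real_normed_vector) \<Rightarrow> bool" where
  "smooth_on S f \<longleftrightarrow> (\<forall>k. C_k_on k f S)"


section \<open>Smooth manifolds\<close>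

text \<open>A manifold is given by an atlas \<open>A\<close>: a set of pairs (domain, coordinate map). The underlying
  set is the union of the chart domains, and its topology is the one induced by the atlas. The
  atlas need not be maximal; all notions below are invariant under smooth changes of chart.\<close>

type_synonym ('a, 'e) chart = "'a set \<times> ('a \<Rightarrow> 'e)"

definition points :: "('a, 'e) chart set \<Rightarrow> 'a set" where
  "points A = (\<Union>c\<in>A. fst c)"

definition charts_at :: "('a, 'e) chart set \<Rightarrow> 'a \<Rightarrow> ('a, 'e) chart set" where
  "charts_at A p = {c \<in> A. p \<in> fst c}"

definition chart_inv :: "('a, 'e) chart \<Rightarrow> 'e \<Rightarrow> 'a" where
  "chart_inv c = inv_into (fst c) (snd c)"

definition transition :: "('a, 'e) chart \<Rightarrow> ('a, 'e) chart \<Rightarrow> 'e \<Rightarrow> 'e" where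
  "transition c d = snd d \<circ> chart_inv c"

definition smooth_atlas :: "('a, 'e::euclidean_space) chart set \<Rightarrow> bool" where
  "smooth_atlas A \<longleftrightarrow> (\<forall>c\<in>A. inj_on (snd c) (fst c)) \<and>
    (\<forall>c\<in>A. \<forall>d\<in>A. open (snd c ` (fst c \<inter> fst d)) \<and>
       smooth_on (snd c ` (fst c \<inter> fst d)) (transition c d))"

definition atlas_topology :: "('a, 'e::euclidean_space) chart set \<Rightarrow> 'a topology" where
  "atlas_topology A =
     topology (\<lambda>W. W \<subseteq> points A \<and> (\<forall>c\<in>A. open (snd c ` (fst c \<inter> W))))"

definition smooth_manifold :: "('a, 'e::euclidean_space) chart set \<Rightarrow> bool" where
  "smooth_manifold A \<longleftrightarrow> smooth_atlas A \<and>
     Hausdorff_space (atlas_topology A) \<and> second_countable (atlas_topology A)"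

text \<open>An orientation is specified by an atlas whose transition maps preserve the orientation
  of the Euclidean plane.\<close>

definition oriented_atlas :: "('a, real^2) chart set \<Rightarrow> bool" where
  "oriented_atlas A \<longleftrightarrow> (\<forall>c\<in>A. \<forall>d\<in>A. \<forall>x \<in> snd c ` (fst c \<inter> fst d).
     det (matrix (frechet_derivative (transition c d) (at x))) > 0)"

text \<open>Embedded submanifolds of dimension \<open>k\<close>, by slice charts: near each of its points, \<open>S\<close> is
  carried to a coordinate subspace by a local diffeomorphism \<open>\<psi>\<close> of the model space, defined on a
  neighbourhood \<open>W\<close> in the image of some chart.\<close>

definition embedded_submanifold ::
    "('a, 'e::euclidean_space) chart set \<Rightarrow> nat \<Rightarrow> 'a set \<Rightarrow> bool" where
  "embedded_submanifold A k S \<longleftrightarrow> S \<subseteq> points A \<and>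
    (\<forall>p\<in>S. \<exists>c \<in> charts_at A p. \<exists>W (\<psi> :: 'e \<Rightarrow> 'e) B.
       open W \<and> snd c p \<in> W \<and> W \<subseteq> snd c ` fst c \<and>
       inj_on \<psi> W \<and> open (\<psi> ` W) \<and> smooth_on W \<psi> \<and> smooth_on (\<psi> ` W) (inv_into W \<psi>) \<and>
       B \<subseteq> Basis \<and> card B = k \<and>
       \<psi> ` (W \<inter> snd c ` (S \<inter> fst c)) = \<psi> ` W \<inter> span B)"


section \<open>Tangent vectors\<close>

text \<open>A tangent vector at \<open>p\<close> is the family of its components in all charts around \<open>p\<close>, which
  transform by the derivatives of the transition maps. Families are normalised to be \<open>0\<close> at
  the charts not containing \<open>p\<close>.\<close>

type_synonym ('a, 'e) tvec = "('a, 'e) chart \<Rightarrow> 'e"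

definition tangent_space ::
    "('a, 'e::euclidean_space) chart set \<Rightarrow> 'a \<Rightarrow> ('a, 'e) tvec set" where
  "tangent_space A p = {X.
     (\<forall>c \<in> charts_at A p. \<forall>d \<in> charts_at A p.
        X d = frechet_derivative (transition c d) (at (snd c p)) (X c)) \<and>
     (\<forall>c. c \<notin> charts_at A p \<longrightarrow> X c = 0)}"

definition lincomb ::
    "real \<Rightarrow> ('a, 'e::real_vector) tvec \<Rightarrow> real \<Rightarrow> ('a, 'e) tvec \<Rightarrow> ('a, 'e) tvec" where
  "lincomb a X b Y = (\<lambda>c. a *\<^sub>R X c + b *\<^sub>R Y c)"

text \<open>The tangent vector at \<open>p\<close> whose components in the chart \<open>c\<close> are \<open>u\<close>.\<close>

definition coord_vec ::
    "('a, 'e::euclidean_space) chart set \<Rightarrow> ('a, 'e) chart \<Rightarrow> 'a \<Rightarrow> 'e \<Rightarrow> ('a, 'e) tvec" where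
  "coord_vec A c p u = (\<lambda>d. if d \<in> charts_at A p
     then frechet_derivative (transition c d) (at (snd c p)) u else 0)"

text \<open>The differentials of maps \<open>F\<close> into a manifold and of real functions \<open>f\<close>. By the chain rule
  they do not depend on the chart chosen around \<open>p\<close>.\<close>

definition tangent_map ::
    "('a, 'e::euclidean_space) chart set \<Rightarrow> ('b, 'f::euclidean_space) chart set \<Rightarrow>
     ('a \<Rightarrow> 'b) \<Rightarrow> 'a \<Rightarrow> ('a, 'e) tvec \<Rightarrow> ('b, 'f) tvec" where
  "tangent_map A B F p X = (\<lambda>d. if d \<in> charts_at B (F p)
     then let c = (SOME c. c \<in> charts_at A p)
          in frechet_derivative (snd d \<circ> F \<circ> chart_inv c) (at (snd c p)) (X c)
     else 0)"

definition differential ::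
    "('a, 'e::euclidean_space) chart set \<Rightarrow> ('a \<Rightarrow> real) \<Rightarrow> 'a \<Rightarrow> ('a, 'e) tvec \<Rightarrow> real" where
  "differential A f p X = (let c = (SOME c. c \<in> charts_at A p)
     in frechet_derivative (f \<circ> chart_inv c) (at (snd c p)) (X c))"

definition smooth_curve ::
    "('a, 'e::euclidean_space) chart set \<Rightarrow> real set \<Rightarrow> (real \<Rightarrow> 'a) \<Rightarrow> bool" where
  "smooth_curve A I \<sigma> \<longleftrightarrow> open I \<and> \<sigma> ` I \<subseteq> points A \<and>
     (\<forall>c\<in>A. open {t\<in>I. \<sigma> t \<in> fst c} \<and>
        smooth_on {t\<in>I. \<sigma> t \<in> fst c} (\<lambda>t. snd c (\<sigma> t)))"

definition velocity ::
    "('a, 'e::euclidean_space) chart set \<Rightarrow> (real \<Rightarrow> 'a) \<Rightarrow> real \<Rightarrow> ('a, 'e) tvec" where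
  "velocity A \<sigma> t = (\<lambda>c. if c \<in> charts_at A (\<sigma> t)
     then vector_derivative (\<lambda>s. snd c (\<sigma> s)) (at t) else 0)"


section \<open>Riemannian metrics, Levi-Civita connection, geodesics\<close>

type_synonym ('a, 'e) metric_field = "'a \<Rightarrow> ('a, 'e) tvec \<Rightarrow> ('a, 'e) tvec \<Rightarrow> real"

definition metric_coeff ::
    "('a, 'e::euclidean_space) chart set \<Rightarrow> ('a, 'e) metric_field \<Rightarrow> ('a, 'e) chart \<Rightarrow>
     'e \<Rightarrow> 'e \<Rightarrow> 'e \<Rightarrow> real" where
  "metric_coeff A g c x u v =
     g (chart_inv c x) (coord_vec A c (chart_inv c x) u) (coord_vec A c (chart_inv c x) v)"

text \<open>A Riemannian metric on the open subset \<open>W\<close> of the manifold; the tangent spaces of the open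
  submanifold \<open>W\<close> are those of the ambient manifold.\<close>

definition riemannian_metric_on ::
    "('a, 'e::euclidean_space) chart set \<Rightarrow> 'a set \<Rightarrow> ('a, 'e) metric_field \<Rightarrow> bool" where
  "riemannian_metric_on A W g \<longleftrightarrow> W \<subseteq> points A \<and> (\<forall>c\<in>A. open (snd c ` (fst c \<inter> W))) \<and>
     (\<forall>p\<in>W.
        (\<forall>X \<in> tangent_space A p. \<forall>Y \<in> tangent_space A p. g p X Y = g p Y X) \<and>
        (\<forall>a b. \<forall>X \<in> tangent_space A p. \<forall>Y \<in> tangent_space A p. \<forall>Z \<in> tangent_space A p.
           g p (lincomb a X b Y) Z = a * g p X Z + b * g p Y Z) \<and>
        (\<forall>X \<in> tangent_space A p. X \<noteq> (\<lambda>c. 0) \<longrightarrow> g p X X > 0)) \<and>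
     (\<forall>c\<in>A. \<forall>u v. smooth_on (snd c ` (fst c \<inter> W)) (\<lambda>x. metric_coeff A g c x u v))"

text \<open>The Levi-Civita connection in the chart \<open>c\<close>: \<open>levi_civita A g c x u v\<close> is the covariant
  derivative at \<open>x\<close>, in direction \<open>u\<close>, of the vector field with constant components \<open>v\<close>
  (in Christoffel symbols: \<open>\<Gamma>\<^sup>k\<^sub>i\<^sub>j u\<^sup>i v\<^sup>j\<close>). It is the unique bilinear map that is torsion-free, i.e.
  symmetric since fields with constant components commute, and compatible with the metric.\<close>

definition levi_civita ::
    "('a, 'e::euclidean_space) chart set \<Rightarrow> ('a, 'e) metric_field \<Rightarrow> ('a, 'e) chart \<Rightarrow>
     'e \<Rightarrow> 'e \<Rightarrow> 'e \<Rightarrow> 'e" where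
  "levi_civita A g c x = (THE \<Gamma>. bilinear \<Gamma> \<and> (\<forall>u v. \<Gamma> u v = \<Gamma> v u) \<and>
     (\<forall>u v w. frechet_derivative (\<lambda>y. metric_coeff A g c y v w) (at x) u =
        metric_coeff A g c x (\<Gamma> u v) w + metric_coeff A g c x v (\<Gamma> u w)))"

definition cov_deriv_along ::
    "('a, 'e::euclidean_space) chart set \<Rightarrow> ('a, 'e) metric_field \<Rightarrow> (real \<Rightarrow> 'a) \<Rightarrow>
     (real \<Rightarrow> ('a, 'e) tvec) \<Rightarrow> real \<Rightarrow> ('a, 'e) tvec" where
  "cov_deriv_along A g \<sigma> E t = (\<lambda>c. if c \<in> charts_at A (\<sigma> t)
     then vector_derivative (\<lambda>s. E s c) (at t) +
          levi_civita A g c (snd c (\<sigma> t)) (velocity A \<sigma> t c) (E t c)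
     else 0)"

text \<open>Geodesics, defined on the open set \<open>S\<close> of reals, of the metric \<open>g\<close> on the open subset \<open>W\<close>.\<close>

definition geodesic_on ::
    "('a, 'e::euclidean_space) chart set \<Rightarrow> 'a set \<Rightarrow> ('a, 'e) metric_field \<Rightarrow> real set \<Rightarrow>
     (real \<Rightarrow> 'a) \<Rightarrow> bool" where
  "geodesic_on A W g S \<sigma> \<longleftrightarrow> smooth_curve A S \<sigma> \<and> \<sigma> ` S \<subseteq> W \<and>
     (\<forall>t\<in>S. cov_deriv_along A g \<sigma> (velocity A \<sigma>) t = (\<lambda>c. 0))"

definition gradient ::
    "('a, 'e::euclidean_space) chart set \<Rightarrow> ('a, 'e) metric_field \<Rightarrow> ('a \<Rightarrow> real) \<Rightarrow> 'a \<Rightarrow>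
     ('a, 'e) tvec" where
  "gradient A g f p = (THE X. X \<in> tangent_space A p \<and>
     (\<forall>Y \<in> tangent_space A p. g p X Y = differential A f p Y))"

text \<open>The curvature tensor \<open>R(u,v)w = \<nabla>\<^sub>u\<nabla>\<^sub>v w - \<nabla>\<^sub>v\<nabla>\<^sub>u w\<close> for fields with constant components in
  the chart \<open>c\<close>.\<close>

definition curvature_tensor ::
    "('a, 'e::euclidean_space) chart set \<Rightarrow> ('a, 'e) metric_field \<Rightarrow> ('a, 'e) chart \<Rightarrow>
     'e \<Rightarrow> 'e \<Rightarrow> 'e \<Rightarrow> 'e \<Rightarrow> 'e" where
  "curvature_tensor A g c x u v w =
     (let \<Gamma> = levi_civita A g c in
       frechet_derivative (\<lambda>y. \<Gamma> y v w) (at x) u + \<Gamma> x u (\<Gamma> x v w)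
       - frechet_derivative (\<lambda>y. \<Gamma> y u w) (at x) v - \<Gamma> x v (\<Gamma> x u w))"


section \<open>Oriented Riemannian surfaces\<close>

definition oriented_riemannian_surface ::
    "('a, real^2) chart set \<Rightarrow> ('a, real^2) metric_field \<Rightarrow> bool" where
  "oriented_riemannian_surface A g \<longleftrightarrow>
     smooth_manifold A \<and> oriented_atlas A \<and> riemannian_metric_on A (points A) g"

text \<open>The curvature \<open>K\<close>, with the sign for which the round sphere has \<open>K > 0\<close>.\<close>

definition has_curvature ::
    "('a, real^2) chart set \<Rightarrow> ('a, real^2) metric_field \<Rightarrow> ('a \<Rightarrow> real) \<Rightarrow> bool" where
  "has_curvature A g K \<longleftrightarrow> (\<forall>p \<in> points A. \<forall>c \<in> charts_at A p. \<forall>u v.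
     let x = snd c p; G = metric_coeff A g c x in
       G (curvature_tensor A g c x u v v) u = K p * (G u u * G v v - (G u v)\<^sup>2))"

definition zero_curvature_set :: "('a, real^2) chart set \<Rightarrow> ('a \<Rightarrow> real) \<Rightarrow> 'a set" where
  "zero_curvature_set A K = {x \<in> points A. K x = 0}"

type_synonym 'a frame = "'a \<times> ('a, real^2) tvec \<times> ('a, real^2) tvec"

definition SO_bundle ::
    "('a, real^2) chart set \<Rightarrow> ('a, real^2) metric_field \<Rightarrow> 'a frame set" where
  "SO_bundle A g = {(x, e1, e2). x \<in> points A \<and>
     e1 \<in> tangent_space A x \<and> e2 \<in> tangent_space A x \<and>
     g x e1 e1 = 1 \<and> g x e2 e2 = 1 \<and> g x e1 e2 = 0 \<and>
     (\<forall>c \<in> charts_at A x. det (vector [e1 c, e2 c] :: real^2^2) > 0)}"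

definition complex_structure ::
    "('a, real^2) chart set \<Rightarrow> ('a, real^2) metric_field \<Rightarrow>
     ('a \<Rightarrow> ('a, real^2) tvec \<Rightarrow> ('a, real^2) tvec) \<Rightarrow> bool" where
  "complex_structure A g J \<longleftrightarrow>
     (\<forall>p \<in> points A. \<forall>X \<in> tangent_space A p. \<forall>Y \<in> tangent_space A p. \<forall>a b.
        J p (lincomb a X b Y) = lincomb a (J p X) b (J p Y)) \<and>
     (\<forall>(p, e1, e2) \<in> SO_bundle A g. J p e1 = e2 \<and> J p e2 = (\<lambda>c. - e1 c))"


section \<open>The bundle of oriented orthonormal frames\<close>

abbreviation bundle_proj :: "'a frame \<Rightarrow> 'a" where
  "bundle_proj \<equiv> fst"

definition frame_rot :: "real \<Rightarrow> 'a frame \<Rightarrow> 'a frame" where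
  "frame_rot \<phi> = (\<lambda>(x, e1, e2).
     (x, lincomb (cos \<phi>) e1 (sin \<phi>) e2, lincomb (- sin \<phi>) e1 (cos \<phi>) e2))"

definition smooth_frame ::
    "('a, real^2) chart set \<Rightarrow> ('a, real^2) metric_field \<Rightarrow> 'a set \<Rightarrow>
     ('a \<Rightarrow> ('a, real^2) tvec \<times> ('a, real^2) tvec) \<Rightarrow> bool" where
  "smooth_frame A g U s \<longleftrightarrow> (\<forall>x\<in>U. (x, s x) \<in> SO_bundle A g) \<and>
     (\<forall>d\<in>A. smooth_on (snd d ` (fst d \<inter> U)) (\<lambda>y. fst (s (chart_inv d y)) d) \<and>
            smooth_on (snd d ` (fst d \<inter> U)) (\<lambda>y. snd (s (chart_inv d y)) d))"

text \<open>The smooth structure of the principal bundle comes from the local trivialisations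
  \<open>(x, \<theta>) \<mapsto> s(x) \<cdot> r(\<theta>)\<close> defined by smooth sections \<open>s\<close> over chart domains of the surface,
  with the angle restricted to an interval of length \<open>2\<pi>\<close>.\<close>

definition frame_chart ::
    "('a, real^2) chart \<Rightarrow> ('a \<Rightarrow> ('a, real^2) tvec \<times> ('a, real^2) tvec) \<Rightarrow> real \<Rightarrow>
     ('a frame, (real^2) \<times> real) chart" where
  "frame_chart c s \<theta>0 =
     ({frame_rot \<theta> (x, s x) | x \<theta>. x \<in> fst c \<and> \<theta> \<in> {\<theta>0 - pi <..< \<theta>0 + pi}},
      \<lambda>q. (snd c (bundle_proj q),
           THE \<theta>. \<theta> \<in> {\<theta>0 - pi <..< \<theta>0 + pi} \<and>
                  q = frame_rot \<theta> (bundle_proj q, s (bundle_proj q))))"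

definition SO_atlas ::
    "('a, real^2) chart set \<Rightarrow> ('a, real^2) metric_field \<Rightarrow>
     ('a frame, (real^2) \<times> real) chart set" where
  "SO_atlas A g = {frame_chart c s \<theta>0 | c s \<theta>0. c \<in> A \<and> smooth_frame A g (fst c) s}"

text \<open>The horizontal space at \<open>p\<close> consists of the velocities of the curves of frames through \<open>p\<close>
  that are parallel for the Levi-Civita connection of \<open>g\<close>.\<close>

definition horizontal ::
    "('a, real^2) chart set \<Rightarrow> ('a, real^2) metric_field \<Rightarrow> 'a frame \<Rightarrow>
     ('a frame, (real^2) \<times> real) tvec set" where
  "horizontal A g p = {velocity (SO_atlas A g) \<sigma> 0 | \<sigma>. \<sigma> 0 = p \<and>
     (\<exists>\<epsilon>>0. smooth_curve (SO_atlas A g) {-\<epsilon><..<\<epsilon>} \<sigma> \<and>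
        (\<forall>t \<in> {-\<epsilon><..<\<epsilon>}.
           cov_deriv_along A g (bundle_proj \<circ> \<sigma>) (\<lambda>s. fst (snd (\<sigma> s))) t = (\<lambda>c. 0) \<and>
           cov_deriv_along A g (bundle_proj \<circ> \<sigma>) (\<lambda>s. snd (snd (\<sigma> s))) t = (\<lambda>c. 0)))}"

definition vertical ::
    "('a, real^2) chart set \<Rightarrow> ('a, real^2) metric_field \<Rightarrow> 'a frame \<Rightarrow>
     ('a frame, (real^2) \<times> real) tvec set" where
  "vertical A g p = {Y \<in> tangent_space (SO_atlas A g) p.
     tangent_map (SO_atlas A g) A bundle_proj p Y = (\<lambda>c. 0)}"

definition d_phi ::
    "('a, real^2) chart set \<Rightarrow> ('a, real^2) metric_field \<Rightarrow> 'a frame \<Rightarrow>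
     ('a frame, (real^2) \<times> real) tvec" where
  "d_phi A g p = velocity (SO_atlas A g) (\<lambda>\<phi>. frame_rot \<phi> p) 0"

definition SO_singular ::
    "('a, real^2) chart set \<Rightarrow> ('a, real^2) metric_field \<Rightarrow> ('a \<Rightarrow> real) \<Rightarrow> 'a frame set" where
  "SO_singular A g K = {p \<in> SO_bundle A g. bundle_proj p \<in> zero_curvature_set A K}"

definition wagner_lift ::
    "('a, real^2) chart set \<Rightarrow> ('a, real^2) metric_field \<Rightarrow> ('a \<Rightarrow> real) \<Rightarrow>
     ('a frame, (real^2) \<times> real) metric_field \<Rightarrow> bool" where
  "wagner_lift A g K h \<longleftrightarrow>
     riemannian_metric_on (SO_atlas A g) (SO_bundle A g - SO_singular A g K) h \<and>
     (\<forall>p \<in> SO_bundle A g - SO_singular A g K.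
        (\<forall>X \<in> horizontal A g p. \<forall>Y \<in> horizontal A g p.
           h p X Y = g (bundle_proj p) (tangent_map (SO_atlas A g) A bundle_proj p X)
                                       (tangent_map (SO_atlas A g) A bundle_proj p Y)) \<and>
        (\<forall>X \<in> horizontal A g p. \<forall>Y \<in> vertical A g p. h p X Y = 0) \<and>
        h p (d_phi A g p) (d_phi A g p) = 1 / (K (bundle_proj p))\<^sup>2)"

end

(* In a chart of the frame bundle given by an orthonormal frame s with connection form omega and an
   angle theta, the Wagner lift reads g(u,v) + (tau + omega u)(rho + omega v) / K^2. Along a geodesic
   (theta' + omega(x')) / K^2 is a constant C, and since d omega = - K vol the remaining equations are
   nabla x' = C K J x' - C^2 K grad K. So gamma is lifted by frames (E1, E2) along gamma with
   nabla E1 = C K^2 E2 and nabla E2 = - C K^2 E1, i.e. theta' = C K^2 - omega(x'). This linear equation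
   stays regular where K = 0; it is solved by a quadrature in each chart, and the local solutions,
   being unique, glue along the interval. *)
theory Submission
  imports Defs
begin

section \<open>Smooth calculus\<close>

text \<open>The number C is a momentum: in bundle coordinates the coefficients of the lift do not
  involve the angle, so rotation in the fibres is an isometry and the inner product of a geodesic
  velocity with the fibre direction is conserved. Prescribing it eliminates the angle from the
  geodesic equation and leaves an equation for \<gamma> alone. Two obstacles shape the argument. An
  angle exists only relative to an orthonormal section over one chart, whereas the lifted curve has
  to cross charts; a condition on covariant derivatives is the same in every chart and for every
  section, and so can be glued. Moreover the lift metric is known only through its values on
  horizontal and vertical vectors, and horizontal vectors only as velocities of parallel frames; its
  coefficients are recovered by producing enough such curves. Smoothness of K, on which the rate of
  rotation depends, is extracted from the structure equation.\<close>

abbreviation "FD f x \<equiv> frechet_derivative f (at x)"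

section \<open>Maps of class C^k\<close>

lemma C_k_cong:
  assumes "open S" "\<And>x. x \<in> S \<Longrightarrow> f x = g x" "C_k_on k f S"
  shows "C_k_on k g S"
  using assms(2,3)
proof (induction k arbitrary: f g)
  case 0
  then show ?case using continuous_on_cong[of S S f g] by simp
next
  case (Suc k)
  have d: "(g has_derivative FD f x) (at x)" if "x \<in> S" for x
    using Suc.prems that frechet_derivative_works[of f "at x"]
      has_derivative_transform_within_open[of f _ x UNIV S g] assms(1) by auto
  have e: "FD g x = FD f x" if "x \<in> S" for x
    using d[OF that] frechet_derivative_at by metis
  have "C_k_on k (\<lambda>x. FD g x v) S" for v
    by (rule Suc.IH[of "\<lambda>x. FD f x v"]) (use e Suc.prems in auto)
  then show ?case using d by (auto simp: differentiable_def)
qed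

text \<open>Derivatives are unique, so any explicit derivative formula may stand in for the chosen
  \<open>frechet_derivative\<close>; the inductions on the order of differentiability use
  \<open>C_k_on\<close> in this form.\<close>

lemma C_k_SucI:
  assumes "open S" "\<And>x. x \<in> S \<Longrightarrow> (f has_derivative f' x) (at x)"
    "\<And>v. C_k_on k (\<lambda>x. f' x v) S"
  shows "C_k_on (Suc k) f S"
proof -
  have "FD f x = f' x" if "x \<in> S" for x
    using assms(2)[OF that] frechet_derivative_at by metis
  then have "C_k_on k (\<lambda>x. FD f x v) S" for v
    by (intro C_k_cong[OF assms(1) _ assms(3)[of v]]) auto
  then show ?thesis using assms(2) by (auto simp: differentiable_def)
qed

lemma C_k_SucD:
  assumes "C_k_on (Suc k) f S"
  shows "x \<in> S \<Longrightarrow> (f has_derivative FD f x) (at x)"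
    and "C_k_on k (\<lambda>x. FD f x v) S"
  using assms frechet_derivative_works by auto

lemma C_k_lower: "C_k_on (Suc k) f S \<Longrightarrow> C_k_on k f S"
proof (induction k arbitrary: f)
  case 0
  then have "f differentiable_on S"
    using differentiable_at_withinI unfolding C_k_on.simps differentiable_on_def by blast
  then show ?case unfolding C_k_on.simps by (rule differentiable_imp_continuous_on)
next
  case (Suc k)
  then show ?case by auto
qed

lemma C_k_subset: "C_k_on k f S \<Longrightarrow> T \<subseteq> S \<Longrightarrow> C_k_on k f T"
  by (induction k arbitrary: f) (auto intro: continuous_on_subset)

text \<open>Derivatives in \<open>C_k_on\<close> are taken at points of the full space, so the
  property depends only on germs; this is what allows local solutions to be glued.\<close>

lemma C_k_local:
  assumes "\<And>x. x \<in> S \<Longrightarrow> \<exists>T. open T \<and> x \<in> T \<and> C_k_on k f T"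
  shows "C_k_on k f S"
  using assms
proof (induction k arbitrary: f)
  case 0
  show ?case unfolding C_k_on.simps continuous_on_eq_continuous_within
  proof
    fix x assume "x \<in> S"
    then obtain T where "open T" "x \<in> T" "C_k_on 0 f T" using 0 by blast
    then show "continuous (at x within S) f"
      by (metis C_k_on.simps(1) continuous_at_imp_continuous_within continuous_on_eq_continuous_at)
  qed
next
  case (Suc k)
  have "\<forall>x\<in>S. f differentiable (at x)" using Suc.prems by fastforce
  moreover have "C_k_on k (\<lambda>x. FD f x v) S" for v
    by (rule Suc.IH) (use Suc.prems in fastforce)
  ultimately show ?case by simp
qed

lemma C_k_const: "open S \<Longrightarrow> C_k_on k (\<lambda>x. c) S"
proof (induction k arbitrary: c)
  case (Suc k)
  then show ?case by (intro C_k_SucI[where f' = "\<lambda>_ _. 0"]) auto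
qed simp

lemma C_k_linear:
  assumes "bounded_linear L" "open S" "C_k_on k f S"
  shows "C_k_on k (\<lambda>x. L (f x)) S"
  using assms(3)
proof (induction k arbitrary: f)
  case 0
  then show ?case using bounded_linear.continuous_on[OF assms(1)] by auto
next
  case (Suc k)
  show ?case
    by (rule C_k_SucI[where f' = "\<lambda>x v. L (FD f x v)", OF assms(2)])
      (use Suc.prems in \<open>auto intro!: Suc.IH bounded_linear.has_derivative[OF assms(1)]
         simp: frechet_derivative_works[symmetric]\<close>)
qed

lemma C_k_ident: "open S \<Longrightarrow> C_k_on k (\<lambda>x. x) S"
proof (induction k)
  case (Suc k)
  then show ?case by (intro C_k_SucI[where f' = "\<lambda>_ v. v"]) (auto intro: C_k_const)
qed simp

lemma C_k_add:
  assumes "open S" "C_k_on k f S" "C_k_on k g S"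
  shows "C_k_on k (\<lambda>x. f x + g x) S"
  using assms(2,3)
proof (induction k arbitrary: f g)
  case 0
  then show ?case by (auto intro: continuous_intros)
next
  case (Suc k)
  show ?case
    by (rule C_k_SucI[where f' = "\<lambda>x v. FD f x v + FD g x v", OF assms(1)])
      (use Suc.prems in \<open>auto intro!: Suc.IH has_derivative_add
         simp: frechet_derivative_works[symmetric]\<close>)
qed

text \<open>The product rule gives two terms of the same bilinear kind, so the induction over all
  pairs \<open>f\<close>, \<open>g\<close> closes once each undifferentiated factor is lowered to
  class k.\<close>

lemma C_k_bilinear:
  assumes "bounded_bilinear B" "open S" "C_k_on k f S" "C_k_on k g S"
  shows "C_k_on k (\<lambda>x. B (f x) (g x)) S"
  using assms(3,4)
proof (induction k arbitrary: f g)
  case 0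
  then show ?case using bounded_bilinear.continuous_on[OF assms(1)] by auto
next
  case (Suc k)
  note l = Suc.prems[THEN C_k_lower]
  show ?case
    by (rule C_k_SucI[where f' = "\<lambda>x v. B (f x) (FD g x v)
          + B (FD f x v) (g x)", OF assms(2)])
      (use Suc.prems l in \<open>auto intro!: Suc.IH C_k_add assms(2) bounded_bilinear.FDERIV[OF assms(1)]
         simp: frechet_derivative_works[symmetric]\<close>)
qed

lemma C_k_sum:
  assumes "open S" "\<And>i. i \<in> I \<Longrightarrow> C_k_on k (f i) S"
  shows "C_k_on k (\<lambda>x. \<Sum>i\<in>I. f i x) S"
  using assms(2)
  by (induction I rule: infinite_finite_induct) (auto intro: C_k_const C_k_add assms(1))

text \<open>\<open>C_k_on\<close> sees a derivative only in fixed directions. Expanding over the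
  basis turns an operator applied to a varying vector into finitely many products of a scalar with a
  value at a fixed vector; the chain rule and the lemmas on linear families rest on this.\<close>

lemma linear_basis_expansion:
  fixes w :: "'a::euclidean_space"
  assumes "linear L"
  shows "L w = (\<Sum>b\<in>Basis. (w \<bullet> b) *\<^sub>R L b)"
proof -
  have "L w = L (\<Sum>b\<in>Basis. (w \<bullet> b) *\<^sub>R b)" by (simp only: euclidean_representation)
  also have "\<dots> = (\<Sum>b\<in>Basis. (w \<bullet> b) *\<^sub>R L b)"
    by (simp only: linear_sum[OF assms] linear_cmul[OF assms])
  finally show ?thesis .
qed

lemma C_k_compose:
  fixes f :: "'a::real_normed_vector \<Rightarrow> 'b::euclidean_space"
    and g :: "'b \<Rightarrow> 'c::real_normed_vector"
  assumes "open S" "open T" "C_k_on k f S" "C_k_on k g T" "f ` S \<subseteq> T"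
  shows "C_k_on k (\<lambda>x. g (f x)) S"
  using assms(3,4)
proof (induction k arbitrary: g)
  case 0
  then show ?case using assms(5) continuous_on_compose2 by auto
next
  case (Suc k)
  let ?f = "\<lambda>x. FD f x" and ?g = "\<lambda>x. FD g x"
  show ?case
  proof (rule C_k_SucI[where f' = "\<lambda>x v. \<Sum>b\<in>Basis. (?f x v \<bullet> b) *\<^sub>R ?g (f x) b", OF assms(1)])
    fix x assume x: "x \<in> S"
    have gd: "(g has_derivative ?g (f x)) (at (f x))" and fd: "(f has_derivative ?f x) (at x)"
      using Suc.prems x assms(5) C_k_SucD(1) by blast+
    have e: "(\<lambda>v. \<Sum>b\<in>Basis. (?f x v \<bullet> b) *\<^sub>R ?g (f x) b) = (\<lambda>v. ?g (f x) (?f x v))"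
      by (rule ext, rule linear_basis_expansion[OF has_derivative_linear[OF gd], symmetric])
    show "((\<lambda>x. g (f x)) has_derivative (\<lambda>v. \<Sum>b\<in>Basis. (?f x v \<bullet> b) *\<^sub>R ?g (f x) b)) (at x)"
      unfolding e using has_derivative_compose[OF fd gd] .
  next
    fix v
    have 1: "C_k_on k (\<lambda>x. ?g (f x) b) S" for b
      by (rule Suc.IH[OF C_k_lower[OF Suc.prems(1)] C_k_SucD(2)[OF Suc.prems(2)]])
    have 2: "C_k_on k (\<lambda>x. ?f x v \<bullet> b) S" for b
      by (rule C_k_linear[OF bounded_linear_inner_left assms(1) C_k_SucD(2)[OF Suc.prems(1)]])
    show "C_k_on k (\<lambda>x. \<Sum>b\<in>Basis. (?f x v \<bullet> b) *\<^sub>R ?g (f x) b) S"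
      by (intro C_k_sum assms(1) C_k_bilinear[OF bounded_bilinear_scaleR] 1 2)
  qed
qed

section \<open>Smooth maps: closure properties and elementary functions\<close>

lemma smooth_cong:
  "open S \<Longrightarrow> (\<And>x. x \<in> S \<Longrightarrow> f x = g x) \<Longrightarrow> smooth_on S f \<Longrightarrow> smooth_on S g"
  unfolding smooth_on_def using C_k_cong by metis

lemma smooth_subset: "smooth_on S f \<Longrightarrow> T \<subseteq> S \<Longrightarrow> smooth_on T f"
  unfolding smooth_on_def using C_k_subset by blast

lemma smooth_local: "(\<And>x. x \<in> S \<Longrightarrow> \<exists>T. open T \<and> x \<in> T \<and> smooth_on T f) \<Longrightarrow> smooth_on S f"
  unfolding smooth_on_def using C_k_local by metis

lemma smooth_const: "open S \<Longrightarrow> smooth_on S (\<lambda>x. c)"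
  unfolding smooth_on_def using C_k_const by blast

lemma smooth_ident: "open S \<Longrightarrow> smooth_on S (\<lambda>x. x)"
  unfolding smooth_on_def using C_k_ident by blast

lemma smooth_linear: "bounded_linear L \<Longrightarrow> open S \<Longrightarrow> smooth_on S f \<Longrightarrow> smooth_on S (\<lambda>x. L (f x))"
  unfolding smooth_on_def using C_k_linear by blast

lemma smooth_bilinear:
  "bounded_bilinear B \<Longrightarrow> open S \<Longrightarrow> smooth_on S f \<Longrightarrow> smooth_on S g \<Longrightarrow> smooth_on S (\<lambda>x. B (f x) (g x))"
  unfolding smooth_on_def using C_k_bilinear by blast

lemmas smooth_scaleR = smooth_bilinear[OF bounded_bilinear_scaleR]
lemmas smooth_mult = smooth_bilinear[OF bounded_bilinear_mult]

lemmas smooth_minus = smooth_linear[OF bounded_linear_minus[OF bounded_linear_ident]]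
lemmas smooth_fst = smooth_linear[OF bounded_linear_fst]
lemmas smooth_snd = smooth_linear[OF bounded_linear_snd]
lemmas smooth_inner = smooth_linear[OF bounded_linear_inner_left]

lemma smooth_add:
  "open S \<Longrightarrow> smooth_on S f \<Longrightarrow> smooth_on S g \<Longrightarrow> smooth_on S (\<lambda>x. f x + g x)"
  unfolding smooth_on_def using C_k_add by blast

lemma smooth_diff:
  "open S \<Longrightarrow> smooth_on S f \<Longrightarrow> smooth_on S g \<Longrightarrow> smooth_on S (\<lambda>x. f x - g x)"
  using smooth_add[of S f "\<lambda>x. - g x"] smooth_minus[of S g] by simp

lemma smooth_sum:
  "open S \<Longrightarrow> (\<And>i. i \<in> I \<Longrightarrow> smooth_on S (f i)) \<Longrightarrow> smooth_on S (\<lambda>x. \<Sum>i\<in>I. f i x)"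
  by (simp add: smooth_on_def C_k_sum)

lemma smooth_compose:
  fixes f :: "'a::real_normed_vector \<Rightarrow> 'b::euclidean_space"
  shows "open S \<Longrightarrow> open T \<Longrightarrow> smooth_on S f \<Longrightarrow> smooth_on T g \<Longrightarrow> f ` S \<subseteq> T
    \<Longrightarrow> smooth_on S (\<lambda>x. g (f x))"
  unfolding smooth_on_def using C_k_compose by blast

text \<open>The derivative of \<open>inverse\<close> is again a product of copies of
  \<open>inverse\<close>, so its class is raised one step at a time; general \<open>f\<close>
  follows by composition on the complement of 0.\<close>

lemma smooth_inverse:
  fixes f :: "'a::real_normed_vector \<Rightarrow> real"
  assumes "open S" "smooth_on S f" "\<And>x. x \<in> S \<Longrightarrow> f x \<noteq> 0"
  shows "smooth_on S (\<lambda>x. inverse (f x))"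
proof -
  have "C_k_on k (inverse :: real \<Rightarrow> real) (- {0})" for k
  proof (induction k)
    case (Suc k)
    then show ?case
      by (intro C_k_SucI[where f' = "\<lambda>x v. - (inverse x * v * inverse x)"] Deriv.has_derivative_inverse
          C_k_bilinear[OF bounded_bilinear_mult] C_k_linear[OF bounded_linear_minus[OF bounded_linear_ident]]
          C_k_const) auto
  qed (auto intro: continuous_intros)
  then have "smooth_on (- {0}) (inverse :: real \<Rightarrow> real)" by (simp add: smooth_on_def)
  moreover have "open (- {0::real})" "f ` S \<subseteq> - {0}" using assms(3) by auto
  ultimately show ?thesis using smooth_compose[OF assms(1) _ assms(2)] by blast
qed

lemma smooth_divide:
  fixes f :: "'a::real_normed_vector \<Rightarrow> real"
  shows "open S \<Longrightarrow> smooth_on S f \<Longrightarrow> smooth_on S g \<Longrightarrow> (\<And>x. x \<in> S \<Longrightarrow> g x \<noteq> 0) \<Longrightarrow> smooth_on S (\<lambda>x. f x / g x)"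
  unfolding divide_inverse by (intro smooth_mult smooth_inverse)

lemma smooth_sqrt:
  fixes f :: "'a::real_normed_vector \<Rightarrow> real"
  assumes "open S" "smooth_on S f" "\<And>x. x \<in> S \<Longrightarrow> f x > 0"
  shows "smooth_on S (\<lambda>x. sqrt (f x))"
proof -
  have i: "smooth_on {0<..} (\<lambda>x::real. inverse x)" by (intro smooth_inverse smooth_ident) auto
  have "C_k_on k sqrt {0<..}" for k
  proof (induction k)
    case (Suc k)
    show ?case
    proof (rule C_k_SucI[where f' = "\<lambda>x v. inverse (sqrt x) / 2 * v"])
      show "(sqrt has_derivative (\<lambda>v. inverse (sqrt x) / 2 * v)) (at x)" if "x \<in> {0<..}" for x
        by (rule DERIV_real_sqrt[unfolded has_field_derivative_def]) (use that in simp)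
      have "C_k_on k (\<lambda>x. inverse (sqrt x)) {0<..}"
        using C_k_compose[OF _ _ Suc.IH, of "{0<..}" inverse] i by (simp add: smooth_on_def image_subset_iff)
      then show "C_k_on k (\<lambda>x. inverse (sqrt x) / 2 * v) {0<..}" for v
        unfolding divide_inverse by (intro C_k_bilinear[OF bounded_bilinear_mult] C_k_const) auto
    qed simp
  qed (auto intro: continuous_intros)
  then have "smooth_on {0<..} sqrt" by (simp add: smooth_on_def)
  from smooth_compose[OF assms(1) _ assms(2) this] show ?thesis using assms(3) by fastforce
qed

lemma smooth_sin_cos:
  fixes f :: "'a::real_normed_vector \<Rightarrow> real"
  assumes "open S" "smooth_on S f"
  shows "smooth_on S (\<lambda>x. sin (f x))" "smooth_on S (\<lambda>x. cos (f x))"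
proof -
  have "C_k_on k (sin :: real \<Rightarrow> real) UNIV \<and> C_k_on k (cos :: real \<Rightarrow> real) UNIV" for k
  proof (induction k)
    case (Suc k)
    then have "C_k_on k (\<lambda>x::real. cos x * v) UNIV" "C_k_on k (\<lambda>x::real. - sin x * v) UNIV" for v
      by (auto intro!: C_k_bilinear[OF bounded_bilinear_mult] C_k_const
          C_k_linear[OF bounded_linear_minus[OF bounded_linear_ident]])
    then show ?case
      by (intro conjI C_k_SucI[OF open_UNIV DERIV_sin[unfolded has_field_derivative_def]]
          C_k_SucI[OF open_UNIV DERIV_cos[unfolded has_field_derivative_def]])
  qed (auto intro: continuous_intros)
  then have "smooth_on UNIV (sin :: real \<Rightarrow> real)" "smooth_on UNIV (cos :: real \<Rightarrow> real)"
    by (simp_all add: smooth_on_def)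
  then show "smooth_on S (\<lambda>x. sin (f x))" "smooth_on S (\<lambda>x. cos (f x))"
    using smooth_compose[OF assms(1) open_UNIV assms(2)] by blast+
qed

lemma smooth_Pair:
  fixes f :: "'a::real_normed_vector \<Rightarrow> 'b::real_normed_vector" and g :: "'a \<Rightarrow> 'c::real_normed_vector"
  assumes "open S" "smooth_on S f" "smooth_on S g"
  shows "smooth_on S (\<lambda>x. (f x, g x))"
proof -
  have "bounded_linear (\<lambda>u::'b. (u, 0::'c))" "bounded_linear (\<lambda>v::'c. (0::'b, v))"
    by (intro bounded_linear_Pair bounded_linear_ident bounded_linear_zero)+
  from smooth_add[OF assms(1) smooth_linear[OF this(1) assms(1,2)] smooth_linear[OF this(2) assms(1,3)]]
  show ?thesis by simp
qed

lemma smooth_has_derivative: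
  assumes "smooth_on S f" "x \<in> S"
  shows "(f has_derivative FD f x) (at x)"
proof -
  have "C_k_on (Suc 0) f S" using assms(1) unfolding smooth_on_def by blast
  then show ?thesis using assms(2) C_k_SucD(1) by blast
qed

lemma smooth_differentiable: "smooth_on S f \<Longrightarrow> x \<in> S \<Longrightarrow> f differentiable at x"
  using smooth_has_derivative differentiable_def by blast

lemma smooth_frechet_derivative:
  assumes "smooth_on S f" shows "smooth_on S (\<lambda>x. FD f x v)"
  using assms C_k_SucD(2) unfolding smooth_on_def by blast

lemma smooth_continuous_on: "smooth_on S f \<Longrightarrow> continuous_on S f"
  unfolding smooth_on_def by (metis C_k_on.simps(1))

lemma smooth_onI:
  assumes "open S" "\<And>x. x \<in> S \<Longrightarrow> (f has_derivative f' x) (at x)"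
    "\<And>v. smooth_on S (\<lambda>x. f' x v)"
  shows "smooth_on S f"
proof -
  have "C_k_on (Suc k) f S" for k
    using C_k_SucI[OF assms(1,2)] assms(3) unfolding smooth_on_def by blast
  then show ?thesis unfolding smooth_on_def using C_k_lower by blast
qed

lemma smooth_arctan:
  fixes f :: "'a::real_normed_vector \<Rightarrow> real"
  assumes S: "open S" and f: "smooth_on S f"
  shows "smooth_on S (\<lambda>x. arctan (f x))"
proof (rule smooth_onI[OF S])
  show "((\<lambda>x. arctan (f x)) has_derivative (\<lambda>v. FD f x v * inverse (1 + f x * f x))) (at x)" if "x \<in> S" for x
    using DERIV_compose_FDERIV[OF DERIV_arctan smooth_has_derivative[OF f that]] by (simp add: power2_eq_square)
  show "smooth_on S (\<lambda>x. FD f x v * inverse (1 + f x * f x))" for v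
    by (intro smooth_mult smooth_inverse smooth_add smooth_const smooth_frechet_derivative S f)
      (smt (verit) zero_le_square)
qed

lemma smooth_vector_derivative:
  fixes f :: "real \<Rightarrow> 'b::real_normed_vector"
  assumes "open S" "smooth_on S f"
  shows "smooth_on S (\<lambda>t. vector_derivative f (at t))"
    and "t \<in> S \<Longrightarrow> (f has_vector_derivative vector_derivative f (at t)) (at t)"
proof -
  show d: "t \<in> S \<Longrightarrow> (f has_vector_derivative vector_derivative f (at t)) (at t)" for t
    using smooth_differentiable[OF assms(2)] vector_derivative_works by blast
  show "smooth_on S (\<lambda>t. vector_derivative f (at t))"
    by (rule smooth_cong[OF assms(1) _ smooth_frechet_derivative[OF assms(2), of 1]])
      (use d in \<open>metis frechet_derivative_at has_vector_derivative_def scaleR_one\<close>)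
qed

lemma smooth_on_realI:
  fixes f :: "real \<Rightarrow> 'b::real_normed_vector"
  assumes "open S" "\<And>t. t \<in> S \<Longrightarrow> (f has_vector_derivative f' t) (at t)" "smooth_on S f'"
  shows "smooth_on S f"
  by (rule smooth_onI[OF assms(1), where f' = "\<lambda>t v. v *\<^sub>R f' t"])
    (use assms in \<open>auto simp: has_vector_derivative_def intro!: smooth_scaleR smooth_const\<close>)

text \<open>Joint smoothness in operator and argument reduces to fixed arguments because the space
  on which \<open>L z\<close> acts is finite-dimensional.\<close>

lemma smooth_linear_family:
  fixes E :: "'z::real_normed_vector \<Rightarrow> 'a::euclidean_space"
  assumes "open S" "\<And>z. z \<in> S \<Longrightarrow> linear (L z)" "\<And>a. smooth_on S (\<lambda>z. L z a)" "smooth_on S E"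
  shows "smooth_on S (\<lambda>z. L z (E z))"
proof (rule smooth_cong[OF assms(1)])
  show "(\<Sum>b\<in>Basis. (E z \<bullet> b) *\<^sub>R L z b) = L z (E z)" if "z \<in> S" for z
    by (rule linear_basis_expansion[OF assms(2)[OF that], symmetric])
  show "smooth_on S (\<lambda>z. \<Sum>b\<in>Basis. (E z \<bullet> b) *\<^sub>R L z b)"
    by (intro smooth_sum smooth_scaleR smooth_inner assms)
qed

lemma has_derivative_linear_family:
  fixes E :: "'z::real_normed_vector \<Rightarrow> 'a::euclidean_space"
  assumes "open S" "z0 \<in> S" "\<And>z. z \<in> S \<Longrightarrow> linear (L z)"
    "\<And>a. ((\<lambda>z. L z a) has_derivative L' a) (at z0)" "(E has_derivative E') (at z0)"
  shows "((\<lambda>z. L z (E z)) has_derivative (\<lambda>h. L' (E z0) h + L z0 (E' h))) (at z0)"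
proof -
  have rep: "L z a = (\<Sum>b\<in>Basis. (a \<bullet> b) *\<^sub>R L z b)" if "z \<in> S" for z a
    by (rule linear_basis_expansion[OF assms(3)[OF that]])
  have "((\<lambda>z. \<Sum>b\<in>Basis. (a \<bullet> b) *\<^sub>R L z b) has_derivative
      (\<lambda>h. \<Sum>b\<in>Basis. (a \<bullet> b) *\<^sub>R L' b h)) (at z0)" for a
    by (auto intro!: derivative_eq_intros assms(4))
  then have "((\<lambda>z. L z a) has_derivative (\<lambda>h. \<Sum>b\<in>Basis. (a \<bullet> b) *\<^sub>R L' b h)) (at z0)" for a
    by (rule has_derivative_transform_within_open[OF _ assms(1,2)]) (simp add: rep)
  \<comment> \<open>Linearity of \<open>L'\<close> in its vector argument is forced by uniqueness of
    the derivative of the basis expansion.\<close>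
  then have L': "L' a = (\<lambda>h. \<Sum>b\<in>Basis. (a \<bullet> b) *\<^sub>R L' b h)" for a
    using has_derivative_unique assms(4) by blast
  have "((\<lambda>z. \<Sum>b\<in>Basis. (E z \<bullet> b) *\<^sub>R L z b) has_derivative
      (\<lambda>h. \<Sum>b\<in>Basis. (E z0 \<bullet> b) *\<^sub>R L' b h + (E' h \<bullet> b) *\<^sub>R L z0 b)) (at z0)"
    by (intro has_derivative_sum has_derivative_scaleR has_derivative_inner_left assms(4,5))
  then have "((\<lambda>z. L z (E z)) has_derivative
      (\<lambda>h. \<Sum>b\<in>Basis. (E z0 \<bullet> b) *\<^sub>R L' b h + (E' h \<bullet> b) *\<^sub>R L z0 b)) (at z0)"
    by (rule has_derivative_transform_within_open[OF _ assms(1,2)]) (metis rep)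
  moreover have "(\<lambda>h. \<Sum>b\<in>Basis. (E z0 \<bullet> b) *\<^sub>R L' b h + (E' h \<bullet> b) *\<^sub>R L z0 b)
    = (\<lambda>h. L' (E z0) h + L z0 (E' h))"
    by (subst L'[of "E z0"], subst rep[OF assms(2)]) (simp add: sum.distrib)
  ultimately show ?thesis by simp
qed

text \<open>The second difference over the parallelogram spanned by h u and h v is evaluated by two
  mean value steps, once in each order; continuity of both mixed derivatives at x then excludes a
  gap between them.\<close>

lemma second_derivative_symmetric_real:
  fixes f :: "'a::real_normed_vector \<Rightarrow> real"
  assumes "open S" "smooth_on S f" "x \<in> S"
  shows "FD (\<lambda>y. FD f y v) x u
       = FD (\<lambda>y. FD f y u) x v"
proof (rule ccontr)
  define D where "D u y = FD f y u" for u y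
  define H where "H u v y = FD (D v) y u" for u v y
  assume "\<not> ?thesis"
  then have ne: "H u v x \<noteq> H v u x" by (simp add: H_def D_def[abs_def])
  \<comment> \<open>Half of the supposed gap: numbers within less than \<open>e\<close> of the two
    different values cannot coincide.\<close>
  define e where "e = \<bar>H u v x - H v u x\<bar> / 2"
  have e: "e > 0" using ne by (simp add: e_def)
  have sD: "smooth_on S (D u)" for u unfolding D_def using smooth_frechet_derivative[OF assms(2)] .
  have sH: "smooth_on S (H u v)" for u v unfolding H_def using smooth_frechet_derivative[OF sD] .
  have "isCont (H u v) x" for u v
    using smooth_continuous_on[OF sH] assms(1,3) continuous_on_eq_continuous_at by blast
  then have c: "\<forall>\<^sub>F y in nhds x. \<bar>H u v y - H u v x\<bar> < e" for u v
    using e by (simp add: isCont_def tendsto_iff dist_real_def eventually_nhds_conv_at)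
  have "\<forall>\<^sub>F y in nhds x. y \<in> S \<and> \<bar>H u v y - H u v x\<bar> < e \<and> \<bar>H v u y - H v u x\<bar> < e"
    using c[of u v] c[of v u] eventually_nhds_in_open[OF assms(1,3)] by (intro eventually_conj) auto
  then obtain d where d: "d > 0"
    "\<And>y. dist y x < d \<Longrightarrow> y \<in> S \<and> \<bar>H u v y - H u v x\<bar> < e \<and> \<bar>H v u y - H v u x\<bar> < e"
    unfolding eventually_nhds_metric by blast
  \<comment> \<open>Small enough to keep the whole parallelogram within d of x; the added 1 keeps
    the denominator positive when both vectors vanish.\<close>
  define h where "h = d / (2 * (norm u + norm v + 1))"
  have h: "h > 0" using d(1) by (simp add: h_def add_nonneg_pos)
  have near: "dist (x + s *\<^sub>R u + t *\<^sub>R v) x < d" if "0 \<le> s" "s \<le> h" "0 \<le> t" "t \<le> h" for s t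
  proof -
    have "dist (x + s *\<^sub>R u + t *\<^sub>R v) x = norm (s *\<^sub>R u + t *\<^sub>R v)" by (simp add: dist_norm add.assoc)
    also have "\<dots> \<le> s * norm u + t * norm v" using norm_triangle_ineq[of "s *\<^sub>R u" "t *\<^sub>R v"] that by simp
    also have "\<dots> \<le> h * norm u + h * norm v" using that by (intro add_mono mult_right_mono) auto
    also have "\<dots> \<le> h * (norm u + norm v + 1)" using h by (simp add: algebra_simps)
    also have "\<dots> = d / 2"
    proof -
      have "norm u + norm v + 1 > 0" by (simp add: add_nonneg_pos)
      then show ?thesis unfolding h_def by (simp add: field_simps)
    qed
    also have "\<dots> < d" using d(1) by simp
    finally show ?thesis .
  qed
  \<comment> \<open>The mean value theorem in direction \<open>a\<close>, applied to the increment
    of \<open>f\<close> by \<open>h *\<^sub>R b\<close>, and then in direction \<open>b\<close>.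
    Exchanging \<open>a\<close> and \<open>b\<close> gives the other order of differentiation for
    the same second difference.\<close>
  have mvt: "\<exists>s t. 0 \<le> s \<and> s \<le> h \<and> 0 \<le> t \<and> t \<le> h \<and>
      f (x + h *\<^sub>R a + h *\<^sub>R b) - f (x + h *\<^sub>R a) - f (x + h *\<^sub>R b) + f x = h * (h * H b a (x + s *\<^sub>R a + t *\<^sub>R b))"
    if near: "\<And>s t. 0 \<le> s \<Longrightarrow> s \<le> h \<Longrightarrow> 0 \<le> t \<Longrightarrow> t \<le> h \<Longrightarrow> x + s *\<^sub>R a + t *\<^sub>R b \<in> S" for a b
  proof -
    have line: "((\<lambda>s. F (q + s *\<^sub>R w)) has_real_derivative FD F (q + s *\<^sub>R w) w) (at s)"
      if "smooth_on S F" "q + s *\<^sub>R w \<in> S" for F :: "'a \<Rightarrow> real" and q w s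
    proof -
      note F = smooth_has_derivative[OF that]
      have 1: "((\<lambda>s. q + s *\<^sub>R w) has_derivative (\<lambda>r. r *\<^sub>R w)) (at s)"
        by (auto intro!: derivative_eq_intros)
      show ?thesis using has_derivative_compose[OF 1 F]
        by (simp add: has_field_derivative_def linear_cmul[OF has_derivative_linear[OF F]] mult.commute[of _ "frechet_derivative F _ _"] mult_commute_abs)
    qed
    have d1: "((\<lambda>s. f (x + h *\<^sub>R b + s *\<^sub>R a) - f (x + s *\<^sub>R a)) has_real_derivative
         D a (x + h *\<^sub>R b + s *\<^sub>R a) - D a (x + s *\<^sub>R a)) (at s)" if "0 \<le> s" "s \<le> h" for s
      unfolding D_def using near[OF that, of h] near[OF that, of 0] h
      by (intro DERIV_diff line assms(2)) (auto simp: algebra_simps)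
    obtain s where s: "0 < s" "s < h" "f (x + h *\<^sub>R b + h *\<^sub>R a) - f (x + h *\<^sub>R a) - (f (x + h *\<^sub>R b + 0 *\<^sub>R a) - f (x + 0 *\<^sub>R a))
        = (h - 0) * (D a (x + h *\<^sub>R b + s *\<^sub>R a) - D a (x + s *\<^sub>R a))"
      using MVT2[OF h d1] by blast
    have d2: "((\<lambda>t. D a (x + s *\<^sub>R a + t *\<^sub>R b)) has_real_derivative H b a (x + s *\<^sub>R a + t *\<^sub>R b)) (at t)"
      if "0 \<le> t" "t \<le> h" for t
      unfolding H_def using near[OF _ _ that, of s] s by (intro line sD) auto
    obtain t where "0 < t" "t < h" and "D a (x + s *\<^sub>R a + h *\<^sub>R b) - D a (x + s *\<^sub>R a + 0 *\<^sub>R b)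
        = (h - 0) * H b a (x + s *\<^sub>R a + t *\<^sub>R b)"
      using MVT2[OF h d2] by blast
    note t = this
    have sw: "x + h *\<^sub>R b + h *\<^sub>R a = x + h *\<^sub>R a + h *\<^sub>R b"
      "x + h *\<^sub>R b + s *\<^sub>R a = x + s *\<^sub>R a + h *\<^sub>R b" by (simp_all add: add_ac)
    have "f (x + h *\<^sub>R a + h *\<^sub>R b) - f (x + h *\<^sub>R a) - f (x + h *\<^sub>R b) + f x
        = h * (h * H b a (x + s *\<^sub>R a + t *\<^sub>R b))" using s(3)[unfolded sw] t(3) by simp
    with s t show ?thesis by (intro exI[of _ s] exI[of _ t]) auto
  qed
  obtain s t where 1: "0 \<le> s" "s \<le> h" "0 \<le> t" "t \<le> h"
     "f (x + h *\<^sub>R u + h *\<^sub>R v) - f (x + h *\<^sub>R u) - f (x + h *\<^sub>R v) + f x = h * (h * H v u (x + s *\<^sub>R u + t *\<^sub>R v))"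
    using mvt[of u v] near d(2) by blast
  have "x + s *\<^sub>R v + t *\<^sub>R u \<in> S" if "0 \<le> s" "s \<le> h" "0 \<le> t" "t \<le> h" for s t
    using d(2)[OF near[OF that(3,4,1,2)]] by (simp only: add_ac)
  then obtain s' t' where 2: "0 \<le> s'" "s' \<le> h" "0 \<le> t'" "t' \<le> h"
     "f (x + h *\<^sub>R v + h *\<^sub>R u) - f (x + h *\<^sub>R v) - f (x + h *\<^sub>R u) + f x = h * (h * H u v (x + s' *\<^sub>R v + t' *\<^sub>R u))"
    using mvt[of v u] by blast
  have "H v u (x + s *\<^sub>R u + t *\<^sub>R v) = H u v (x + s' *\<^sub>R v + t' *\<^sub>R u)"
  proof -
    have sw: "x + h *\<^sub>R v + h *\<^sub>R u = x + h *\<^sub>R u + h *\<^sub>R v" by (simp add: add_ac)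
    have "h * (h * H v u (x + s *\<^sub>R u + t *\<^sub>R v)) = h * (h * H u v (x + s' *\<^sub>R v + t' *\<^sub>R u))"
      using 1(5) 2(5)[unfolded sw] by linarith
    then show ?thesis using h by simp
  qed
  moreover have "\<bar>H v u (x + s *\<^sub>R u + t *\<^sub>R v) - H v u x\<bar> < e"
    using d(2)[OF near[OF 1(1-4)]] by blast
  moreover have "\<bar>H u v (x + s' *\<^sub>R v + t' *\<^sub>R u) - H u v x\<bar> < e"
    using d(2)[OF near[OF 2(3,4,1,2)]] by (simp add: algebra_simps)
  ultimately show False using e_def by (simp add: abs_if split: if_splits)
qed

lemma second_derivative_symmetric:
  fixes f :: "'a::real_normed_vector \<Rightarrow> 'b::euclidean_space"
  assumes "open S" "smooth_on S f" "x \<in> S"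
  shows "FD (\<lambda>y. FD f y v) x u
       = FD (\<lambda>y. FD f y u) x v"
proof (rule euclidean_eqI)
  fix b :: 'b assume "b \<in> Basis"
  have D: "FD (\<lambda>y. F y \<bullet> b) y w = FD F y w \<bullet> b"
    if "smooth_on S F" "y \<in> S" for F :: "'a \<Rightarrow> 'b" and y w
    using has_derivative_inner_left[OF smooth_has_derivative[OF that], of b] frechet_derivative_at by metis
  have "FD (\<lambda>y. FD (\<lambda>y. f y \<bullet> b) y v) x u
     = FD (\<lambda>y. FD f y v) x u \<bullet> b" for u v
  proof -
    have "((\<lambda>y. FD f y v \<bullet> b) has_derivative
        (\<lambda>u. FD (\<lambda>y. FD f y v) x u \<bullet> b)) (at x)"
      using has_derivative_inner_left[OF smooth_has_derivative[OF smooth_frechet_derivative[OF assms(2)] assms(3)]] .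
    then have "((\<lambda>y. FD (\<lambda>y. f y \<bullet> b) y v) has_derivative
        (\<lambda>u. FD (\<lambda>y. FD f y v) x u \<bullet> b)) (at x)"
      by (rule has_derivative_transform_within_open[OF _ assms(1,3)]) (simp add: D[OF assms(2)])
    then show ?thesis using frechet_derivative_at by metis
  qed
  from this[of v u] this[of u v] second_derivative_symmetric_real[OF assms(1) smooth_inner[OF assms(1,2), of b] assms(3), of v u]
  show "FD (\<lambda>y. FD f y v) x u \<bullet> b
       = FD (\<lambda>y. FD f y u) x v \<bullet> b"
    by (simp only:)
qed

section \<open>The Levi-Civita connection in coordinates\<close>

lemma frechet_derivative_eqI:
  "(f has_derivative D) (at x) \<Longrightarrow> FD f x u = D u"
  by (rule fun_cong[OF frechet_derivative_at[symmetric]])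

text \<open>The bilinear map of \<open>levi_civita\<close> as a function of the metric coefficients
  alone, so that it can be studied on an open set of a Euclidean space without an atlas.\<close>

definition christoffel :: "('e::euclidean_space \<Rightarrow> 'e \<Rightarrow> 'e \<Rightarrow> real) \<Rightarrow> 'e \<Rightarrow> 'e \<Rightarrow> 'e \<Rightarrow> 'e" where
  "christoffel G x = (THE \<Gamma>. bilinear \<Gamma> \<and> (\<forall>u v. \<Gamma> u v = \<Gamma> v u) \<and>
     (\<forall>u v w. FD (\<lambda>y. G y v w) x u = G x (\<Gamma> u v) w + G x v (\<Gamma> u w)))"

lemma levi_civita_eq_christoffel: "levi_civita A g c = christoffel (metric_coeff A g c)"
  by (simp add: fun_eq_iff levi_civita_def christoffel_def)

text \<open>A metric seen through one chart. The dimension stays arbitrary because the locale serves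
  the surface as well as its three-dimensional frame bundle.\<close>

locale metric_patch =
  fixes U :: "'e::euclidean_space set" and G :: "'e \<Rightarrow> 'e \<Rightarrow> 'e \<Rightarrow> real"
  assumes open_U: "open U"
    and bilin: "x \<in> U \<Longrightarrow> bilinear (G x)"
    and sym: "x \<in> U \<Longrightarrow> G x u v = G x v u"
    and pos: "x \<in> U \<Longrightarrow> u \<noteq> 0 \<Longrightarrow> G x u u > 0"
    and smooth: "smooth_on U (\<lambda>x. G x u v)"
begin

abbreviation dG :: "'e \<Rightarrow> 'e \<Rightarrow> 'e \<Rightarrow> 'e \<Rightarrow> real" where
  "dG x u v w \<equiv> FD (\<lambda>y. G y v w) x u"

lemmas lin = bilin[THEN bilinear_ladd] bilin[THEN bilinear_radd] bilin[THEN bilinear_lmul]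
  bilin[THEN bilinear_rmul] bilin[THEN bilinear_lneg] bilin[THEN bilinear_rneg]
  bilin[THEN bilinear_lsub] bilin[THEN bilinear_rsub] bilin[THEN bilinear_lzero] bilin[THEN bilinear_rzero]

lemma linear_G: "x \<in> U \<Longrightarrow> linear (G x u)" "x \<in> U \<Longrightarrow> linear (\<lambda>v. G x v u)"
  using bilin bilinear_def by blast+

lemma nondegenerate:
  assumes "x \<in> U" "\<And>w. G x a w = G x b w" shows "a = b"
proof (rule ccontr)
  assume "a \<noteq> b"
  then have "G x (a - b) (a - b) > 0" using pos assms(1) by simp
  then show False using assms by (simp add: lin)
qed

text \<open>Sending a to the functional G(a, .), recorded by its values on the basis, is an
  endomorphism; definiteness makes it injective, hence onto.\<close>

lemma riesz:
  assumes x: "x \<in> U" and "linear \<phi>"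
  shows "\<exists>a. \<forall>w. G x a w = \<phi> w"
proof -
  define L where "L a = (\<Sum>b\<in>Basis. G x a b *\<^sub>R b)" for a
  have L: "L a \<bullet> b = G x a b" if "b \<in> Basis" for a b using that by (simp add: L_def)
  have lL: "linear L"
    by (rule linearI) (auto simp: L_def lin[OF x] scaleR_add_left sum.distrib scaleR_sum_right)
  have "inj L"
  proof (subst linear_injective_0[OF lL], intro allI impI, rule nondegenerate[OF x])
    fix a w assume "L a = 0"
    then have "G x a b = 0" if "b \<in> Basis" for b using L[OF that] by (metis inner_zero_left)
    then show "G x a w = G x 0 w" by (subst linear_basis_expansion[OF linear_G(1)[OF x]]) (simp add: lin[OF x])
  qed
  then have "surj L" using linear_injective_imp_surjective lL by blast
  then obtain a where a: "L a = (\<Sum>b\<in>Basis. \<phi> b *\<^sub>R b)" by (metis surjD)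
  have "G x a b = \<phi> b" if "b \<in> Basis" for b using L[OF that, of a] that by (simp add: a)
  then have "G x a w = \<phi> w" for w
    using linear_basis_expansion[OF linear_G(1)[OF x], of a w] linear_basis_expansion[OF assms(2), of w] by simp
  then show ?thesis by blast
qed

lemma has_dG: "x \<in> U \<Longrightarrow> ((\<lambda>y. G y v w) has_derivative (\<lambda>u. dG x u v w)) (at x)"
  using smooth_has_derivative[OF smooth] .

lemma dG_sym: "x \<in> U \<Longrightarrow> dG x u v w = dG x u w v"
  by (rule frechet_derivative_eqI, rule has_derivative_transform_within_open[OF has_dG open_U, of x w v])
    (auto simp: sym)

lemma linear_dG:
  assumes "x \<in> U"
  shows "linear (\<lambda>u. dG x u v w)" "linear (\<lambda>v. dG x u v w)" "linear (\<lambda>w. dG x u v w)"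
proof -
  show "linear (\<lambda>u. dG x u v w)" using has_derivative_linear[OF has_dG[OF assms]] .
  have *: "dG x u (a *\<^sub>R v + b *\<^sub>R v') w = a * dG x u v w + b * dG x u v' w" for a b v v' w
  proof -
    have "((\<lambda>y. a * G y v w + b * G y v' w) has_derivative (\<lambda>u. a * dG x u v w + b * dG x u v' w)) (at x)"
      by (intro derivative_intros has_dG assms)
    then have "((\<lambda>y. G y (a *\<^sub>R v + b *\<^sub>R v') w) has_derivative (\<lambda>u. a * dG x u v w + b * dG x u v' w)) (at x)"
      by (rule has_derivative_transform_within_open[OF _ open_U assms]) (simp add: lin)
    then show ?thesis by (rule frechet_derivative_eqI)
  qed
  show l: "linear (\<lambda>v. dG x u v w)" for w
    using *[of 1 _ 1] *[of _ _ 0 0] by (intro linearI) auto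
  have "(\<lambda>w. dG x u v w) = (\<lambda>w. dG x u w v)" by (rule ext, rule dG_sym[OF assms])
  then show "linear (\<lambda>w. dG x u v w)" using l[of v] by simp
qed

text \<open>The Koszul formula for coordinate fields, whose brackets vanish.\<close>

definition koszul :: "'e \<Rightarrow> 'e \<Rightarrow> 'e \<Rightarrow> 'e \<Rightarrow> real" where
  "koszul x u v w = (dG x u v w + dG x v u w - dG x w u v) / 2"

text \<open>Symmetry and compatibility force the Koszul formula, which gives uniqueness by
  nondegeneracy; conversely the formula is linear in \<open>w\<close> and defines a vector by Riesz
  representation.\<close>

lemma christoffel_exists:
  assumes x: "x \<in> U"
  shows "\<exists>!\<Gamma>. bilinear \<Gamma> \<and> (\<forall>u v. \<Gamma> u v = \<Gamma> v u) \<and> (\<forall>u v w. dG x u v w = G x (\<Gamma> u v) w + G x v (\<Gamma> u w))"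
proof -
  note l = linear_add[OF linear_dG(1)[OF x]] linear_add[OF linear_dG(2)[OF x]] linear_add[OF linear_dG(3)[OF x]]
    linear_cmul[OF linear_dG(1)[OF x]] linear_cmul[OF linear_dG(2)[OF x]] linear_cmul[OF linear_dG(3)[OF x]]
  have "linear (koszul x u v)" for u v
    by (rule linearI) (auto simp: koszul_def l add_divide_distrib diff_divide_distrib algebra_simps)
  then have "\<forall>u v. \<exists>a. \<forall>w. G x a w = koszul x u v w" using riesz[OF x] by blast
  then obtain \<Gamma> where \<Gamma>: "\<And>u v w. G x (\<Gamma> u v) w = koszul x u v w" by metis
  have "bilinear \<Gamma>" unfolding bilinear_def
    by (intro conjI allI linearI; rule nondegenerate[OF x])
      (auto simp: lin[OF x] \<Gamma> koszul_def l add_divide_distrib diff_divide_distrib algebra_simps)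
  moreover have "\<Gamma> u v = \<Gamma> v u" for u v
  proof (rule nondegenerate[OF x])
    show "G x (\<Gamma> u v) w = G x (\<Gamma> v u) w" for w using dG_sym[OF x, of u v w] by (simp add: \<Gamma> koszul_def)
  qed
  moreover have "dG x u v w = G x (\<Gamma> u v) w + G x v (\<Gamma> u w)" for u v w
    using dG_sym[OF x, of v w u] dG_sym[OF x, of u w v] dG_sym[OF x, of u v w]
    by (simp add: \<Gamma> sym[OF x, of v] koszul_def field_simps)
  moreover have "\<Gamma>' = \<Gamma>" if "bilinear \<Gamma>' \<and> (\<forall>u v. \<Gamma>' u v = \<Gamma>' v u) \<and>
      (\<forall>u v w. dG x u v w = G x (\<Gamma>' u v) w + G x v (\<Gamma>' u w))" for \<Gamma>'
  proof (intro ext, rule nondegenerate[OF x])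
    fix u v w
    have s: "\<Gamma>' a b = \<Gamma>' b a" for a b using that by blast
    have "koszul x u v w = G x (\<Gamma>' u v) w"
      unfolding koszul_def using that sym[OF x] s[of v u] s[of w u] s[of w v] by (simp add: field_simps)
    then show "G x (\<Gamma>' u v) w = G x (\<Gamma> u v) w" by (simp add: \<Gamma>)
  qed
  ultimately show ?thesis by (intro ex1I[of _ \<Gamma>]) blast+
qed

lemma christoffel:
  assumes "x \<in> U"
  shows bilinear_christoffel: "bilinear (christoffel G x)"
    and christoffel_sym: "christoffel G x u v = christoffel G x v u"
    and christoffel_compat: "dG x u v w = G x (christoffel G x u v) w + G x v (christoffel G x u w)"
  using theI'[OF christoffel_exists[OF assms], folded christoffel_def] by blast+

lemmas clin = bilinear_christoffel[THEN bilinear_ladd] bilinear_christoffel[THEN bilinear_radd]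
  bilinear_christoffel[THEN bilinear_lmul] bilinear_christoffel[THEN bilinear_rmul]
  bilinear_christoffel[THEN bilinear_lneg] bilinear_christoffel[THEN bilinear_rneg]

lemma linear_christoffel:
  "x \<in> U \<Longrightarrow> linear (christoffel G x u)" "x \<in> U \<Longrightarrow> linear (\<lambda>v. christoffel G x v u)"
  using bilinear_christoffel bilinear_def by blast+

lemma christoffel_koszul:
  assumes x: "x \<in> U"
  shows "G x (christoffel G x u v) w = koszul x u v w"
  unfolding koszul_def
  using christoffel_compat[OF x] sym[OF x] christoffel_sym[OF x, of v u] christoffel_sym[OF x, of w u]
    christoffel_sym[OF x, of w v] by (simp add: field_simps)

lemma metric_has_derivative:
  fixes p :: "'z::real_normed_vector \<Rightarrow> 'e"
  assumes N: "open N" "z \<in> N" "p ` N \<subseteq> U"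
    and "(p has_derivative p') (at z)" "(E has_derivative E') (at z)" "(F has_derivative F') (at z)"
  shows "((\<lambda>z. G (p z) (E z) (F z)) has_derivative
     (\<lambda>h. dG (p z) (p' h) (E z) (F z) + G (p z) (E' h) (F z) + G (p z) (E z) (F' h))) (at z)"
proof -
  have U: "p z \<in> U" if "z \<in> N" for z using that N by blast
  have 1: "((\<lambda>z. G (p z) a b) has_derivative (\<lambda>h. dG (p z) (p' h) a b)) (at z)" for a b
    using has_derivative_compose[OF assms(4) has_dG[OF U[OF N(2)]]] .
  have 2: "((\<lambda>z. G (p z) a (F z)) has_derivative (\<lambda>h. dG (p z) (p' h) a (F z) + G (p z) a (F' h))) (at z)" for a
    by (rule has_derivative_linear_family[OF N(1,2) _ _ assms(6)]) (auto intro: 1 linear_G U)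
  show ?thesis
    using has_derivative_linear_family[OF N(1,2), of "\<lambda>z a. G (p z) a (F z)", OF linear_G(2)[OF U] 2 assms(5)]
    by (simp add: add_ac)
qed

text \<open>Metric compatibility along an arbitrary map \<open>p\<close>. The parameter space is
  left general: with the identity this differentiates frame fields over a chart, with a real
  parameter it differentiates vector fields along a curve.\<close>

lemma metric_product_rule:
  fixes p :: "'z::real_normed_vector \<Rightarrow> 'e"
  assumes N: "open N" "z \<in> N" "p ` N \<subseteq> U"
    and "(p has_derivative p') (at z)" "(E has_derivative E') (at z)" "(F has_derivative F') (at z)"
  shows "((\<lambda>z. G (p z) (E z) (F z)) has_derivative
     (\<lambda>h. G (p z) (E' h + christoffel G (p z) (p' h) (E z)) (F z)
        + G (p z) (E z) (F' h + christoffel G (p z) (p' h) (F z)))) (at z)"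
proof -
  have U: "p z \<in> U" using N by blast
  show ?thesis
    using metric_has_derivative[OF assms] by (simp add: christoffel_compat[OF U] lin[OF U] algebra_simps)
qed

lemma smooth_metric:
  fixes p :: "'z::real_normed_vector \<Rightarrow> 'e"
  assumes "open N" "p ` N \<subseteq> U" "smooth_on N p" "smooth_on N E" "smooth_on N F"
  shows "smooth_on N (\<lambda>z. G (p z) (E z) (F z))"
proof (rule smooth_linear_family[OF assms(1) _ _ assms(4)])
  show "linear (\<lambda>a. G (p z) a (F z))" if "z \<in> N" for z using linear_G assms(2) that by blast
  show "smooth_on N (\<lambda>z. G (p z) a (F z))" for a
  proof (rule smooth_linear_family[OF assms(1) _ _ assms(5)])
    show "linear (G (p z) a)" if "z \<in> N" for z using linear_G assms(2) that by blast
    show "smooth_on N (\<lambda>z. G (p z) a b)" for b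
      by (rule smooth_compose[OF assms(1) open_U assms(3) smooth assms(2)])
  qed
qed

lemma metric_patch_subset: "open V \<Longrightarrow> V \<subseteq> U \<Longrightarrow> metric_patch V G"
  using bilin sym pos smooth_subset[OF smooth] by unfold_locales auto

end

section \<open>Behaviour of the connection under isometries\<close>

locale metric_isometry = dom: metric_patch U G + cod: metric_patch V H
  for U :: "'e::euclidean_space set" and G and V :: "'e set" and H +
  fixes F :: "'e \<Rightarrow> 'e"
  assumes smooth_F: "smooth_on U F" and maps: "x \<in> U \<Longrightarrow> F x \<in> V"
    and surj_F: "x \<in> U \<Longrightarrow> surj (FD F x)"
    and isometry: "x \<in> U \<Longrightarrow> G x u v = H (F x) (FD F x u) (FD F x v)"
begin

abbreviation dF where "dF x \<equiv> FD F x"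
abbreviation ddF where "ddF x u v \<equiv> FD (\<lambda>y. dF y v) x u"

lemma ddF_sym: "x \<in> U \<Longrightarrow> ddF x u v = ddF x v u"
  using second_derivative_symmetric[OF dom.open_U smooth_F] by blast

lemma linear_dF: "x \<in> U \<Longrightarrow> linear (dF x)"
  using has_derivative_linear[OF smooth_has_derivative[OF smooth_F]] .

lemma dG_pullback:
  assumes x: "x \<in> U"
  shows "dom.dG x u v w = cod.dG (F x) (dF x u) (dF x v) (dF x w)
     + H (F x) (ddF x u v) (dF x w) + H (F x) (dF x v) (ddF x u w)"
proof -
  have "((\<lambda>y. H (F y) (dF y v) (dF y w)) has_derivative
     (\<lambda>u. cod.dG (F x) (dF x u) (dF x v) (dF x w)
     + H (F x) (ddF x u v) (dF x w) + H (F x) (dF x v) (ddF x u w))) (at x)"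
    by (rule cod.metric_has_derivative[OF dom.open_U x])
      (auto intro: maps smooth_has_derivative[OF smooth_F x]
          smooth_has_derivative[OF smooth_frechet_derivative[OF smooth_F] x])
  then have "((\<lambda>y. G y v w) has_derivative (\<lambda>u. cod.dG (F x) (dF x u) (dF x v) (dF x w)
     + H (F x) (ddF x u v) (dF x w) + H (F x) (dF x v) (ddF x u w))) (at x)"
    by (rule has_derivative_transform_within_open[OF _ dom.open_U x]) (simp add: isometry)
  then show ?thesis by (rule frechet_derivative_eqI)
qed

text \<open>Differentiating the isometry condition brings in second derivatives of \<open>F\<close>;
  by their symmetry all but one kind of term cancels in the Koszul combination. Surjectivity of
  \<open>dF x\<close> makes it enough to test against vectors \<open>dF x w\<close>.\<close>

lemma christoffel_transform:
  assumes x: "x \<in> U"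
  shows "dF x (christoffel G x u v) = ddF x u v + christoffel H (F x) (dF x u) (dF x v)"
proof (rule cod.nondegenerate[OF maps[OF x]])
  fix w'
  obtain w where w: "w' = dF x w" using surj_F[OF x] by (metis surjD)
  note Fx = maps[OF x]
  have "H (F x) (dF x (christoffel G x u v)) w' = dom.koszul x u v w"
    unfolding w using isometry[OF x, symmetric] dom.christoffel_koszul[OF x] by simp
  also have "\<dots> = cod.koszul (F x) (dF x u) (dF x v) (dF x w) + H (F x) (ddF x u v) (dF x w)"
    unfolding dom.koszul_def cod.koszul_def dG_pullback[OF x]
    by (simp add: ddF_sym[OF x, of v u] ddF_sym[OF x, of w u] ddF_sym[OF x, of w v]
        cod.sym[OF Fx, of "dF x u"] cod.sym[OF Fx, of "dF x v"] field_simps)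
  also have "\<dots> = H (F x) (ddF x u v + christoffel H (F x) (dF x u) (dF x v)) w'"
    unfolding w by (simp add: cod.lin[OF Fx] cod.christoffel_koszul[OF Fx])
  finally show "H (F x) (dF x (christoffel G x u v)) w' = H (F x) (ddF x u v + christoffel H (F x) (dF x u) (dF x v)) w'" .
qed

text \<open>The inhomogeneous term in the law for Christoffel symbols is exactly the derivative of
  \<open>dF\<close> along the curve, so covariant derivatives transform as vectors. The result is
  solved for the ordinary derivative, the form in which the frame equations are written.\<close>

lemma cov_deriv_transform:
  fixes p :: "real \<Rightarrow> 'e"
  assumes N: "open N" "t \<in> N" "p ` N \<subseteq> U"
    and p: "(p has_vector_derivative p') (at t)" and E: "(E has_vector_derivative E') (at t)"
  shows "((\<lambda>s. dF (p s) (E s)) has_vector_derivative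
     dF (p t) (E' + christoffel G (p t) p' (E t)) - christoffel H (F (p t)) (dF (p t) p') (dF (p t) (E t))) (at t)"
proof -
  have U: "p s \<in> U" if "s \<in> N" for s using that N by blast
  have 1: "((\<lambda>s. dF (p s) a) has_derivative (\<lambda>h. ddF (p t) (h *\<^sub>R p') a)) (at t)" for a
    using has_derivative_compose[OF p[unfolded has_vector_derivative_def]
        smooth_has_derivative[OF smooth_frechet_derivative[OF smooth_F] U[OF N(2)]]] .
  have "((\<lambda>s. dF (p s) (E s)) has_derivative (\<lambda>h. ddF (p t) (h *\<^sub>R p') (E t) + dF (p t) (h *\<^sub>R E'))) (at t)"
    by (rule has_derivative_linear_family[OF N(1,2) linear_dF[OF U] 1 E[unfolded has_vector_derivative_def]])
  moreover have "ddF (p t) (h *\<^sub>R p') (E t) = h *\<^sub>R ddF (p t) p' (E t)" for h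
    using linear_cmul[OF has_derivative_linear[OF smooth_has_derivative[OF smooth_frechet_derivative[OF smooth_F] U[OF N(2)]]]] .
  ultimately show ?thesis
    unfolding has_vector_derivative_def
    by (simp add: linear_cmul[OF linear_dF[OF U[OF N(2)]]] linear_add[OF linear_dF[OF U[OF N(2)]]]
        christoffel_transform[OF U[OF N(2)]] scaleR_add_right add.commute)
qed

end

section \<open>Moving frames on a surface patch\<close>

text \<open>Stands to \<open>curvature_tensor\<close> as \<open>christoffel\<close> stands to
  \<open>levi_civita\<close>.\<close>

definition riemann :: "('e::euclidean_space \<Rightarrow> 'e \<Rightarrow> 'e \<Rightarrow> real) \<Rightarrow> 'e \<Rightarrow> 'e \<Rightarrow> 'e \<Rightarrow> 'e \<Rightarrow> 'e" where
  "riemann G x u v w =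
     FD (\<lambda>y. christoffel G y v w) x u + christoffel G x u (christoffel G x v w)
     - FD (\<lambda>y. christoffel G y u w) x v - christoffel G x v (christoffel G x u w)"

lemma curvature_tensor_eq_riemann: "curvature_tensor A g c = riemann (metric_coeff A g c)"
  by (simp add: fun_eq_iff curvature_tensor_def riemann_def levi_civita_eq_christoffel Let_def)

abbreviation "det2 a b \<equiv> det (vector [a, b] :: real^2^2)"

lemma det_vector_2: "det2 a b = a $ 1 * b $ 2 - a $ 2 * b $ 1"
  by (simp add: det_2 mult.commute)

text \<open>Cramer's rule.\<close>

lemma vec2_combination:
  fixes a b v :: "real^2"
  assumes "det2 a b \<noteq> 0"
  shows "\<exists>r s. v = r *\<^sub>R a + s *\<^sub>R b"
proof -
  let ?d = "a $ 1 * b $ 2 - a $ 2 * b $ 1"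
  have d: "?d \<noteq> 0" using assms by (simp add: det_vector_2)
  have "v = ((v $ 1 * b $ 2 - v $ 2 * b $ 1) / ?d) *\<^sub>R a + ((a $ 1 * v $ 2 - a $ 2 * v $ 1) / ?d) *\<^sub>R b"
    by (simp add: vec_eq_iff forall_2 add_divide_distrib[symmetric] nonzero_eq_divide_eq[OF d]) (simp add: algebra_simps)
  then show ?thesis by blast
qed

section \<open>Orthonormal frames, connection form and structure equation\<close>

locale frame_patch = metric_patch U G for U :: "(real^2) set" and G +
  fixes S1 S2 :: "real^2 \<Rightarrow> real^2"
  assumes smooth_S1: "smooth_on U S1" and smooth_S2: "smooth_on U S2"
    and unit1: "x \<in> U \<Longrightarrow> G x (S1 x) (S1 x) = 1"
    and unit2: "x \<in> U \<Longrightarrow> G x (S2 x) (S2 x) = 1"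
    and ortho: "x \<in> U \<Longrightarrow> G x (S1 x) (S2 x) = 0"
    and det_pos: "x \<in> U \<Longrightarrow> det2 (S1 x) (S2 x) > 0"
begin

lemma ortho': "x \<in> U \<Longrightarrow> G x (S2 x) (S1 x) = 0"
  using ortho sym by metis

lemma frame_expansion:
  assumes x: "x \<in> U"
  shows "v = G x v (S1 x) *\<^sub>R S1 x + G x v (S2 x) *\<^sub>R S2 x"
proof -
  obtain r s where v: "v = r *\<^sub>R S1 x + s *\<^sub>R S2 x" using vec2_combination det_pos[OF x] by (metis less_irrefl)
  have "G x v (S1 x) = r" "G x v (S2 x) = s"
    unfolding v by (simp_all add: lin[OF x] unit1[OF x] unit2[OF x] ortho[OF x] ortho'[OF x])
  then show ?thesis using v by simp
qed

lemma smooth_dG: "smooth_on U (\<lambda>x. dG x u v w)"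
  using smooth_frechet_derivative[OF smooth] .

text \<open>The orthonormal frame takes the place of the inverse matrix of the metric: the
  components of the Christoffel vector in the frame are Koszul expressions, which are smooth by
  inspection.\<close>

lemma smooth_christoffel: "smooth_on U (\<lambda>x. christoffel G x u v)"
proof (rule smooth_cong[OF open_U])
  show "koszul x u v (S1 x) *\<^sub>R S1 x + koszul x u v (S2 x) *\<^sub>R S2 x = christoffel G x u v" if "x \<in> U" for x
    using frame_expansion[OF that, of "christoffel G x u v"] christoffel_koszul[OF that] by simp
  have k: "smooth_on U (\<lambda>x. koszul x u v (S x))" if "smooth_on U S" for S
  proof (rule smooth_linear_family[OF open_U _ _ that])
    show "linear (koszul x u v)" if "x \<in> U" for x
      using linear_G(1)[OF that, of "christoffel G x u v"] unfolding christoffel_koszul[OF that] by simp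
    show "smooth_on U (\<lambda>x. koszul x u v w)" for w
      unfolding koszul_def divide_inverse
      by (intro smooth_mult smooth_add smooth_diff smooth_dG smooth_const open_U)
  qed
  show "smooth_on U (\<lambda>x. koszul x u v (S1 x) *\<^sub>R S1 x + koszul x u v (S2 x) *\<^sub>R S2 x)"
    by (intro smooth_add smooth_scaleR k smooth_S1 smooth_S2 open_U)
qed

definition nabla_S1 :: "real^2 \<Rightarrow> real^2 \<Rightarrow> real^2" where
  "nabla_S1 x u = FD S1 x u + christoffel G x u (S1 x)"

definition nabla_S2 :: "real^2 \<Rightarrow> real^2 \<Rightarrow> real^2" where
  "nabla_S2 x u = FD S2 x u + christoffel G x u (S2 x)"

text \<open>The connection form: \<open>\<nabla> S1 = om S2\<close>.\<close>

definition om :: "real^2 \<Rightarrow> real^2 \<Rightarrow> real" where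
  "om x u = G x (nabla_S1 x u) (S2 x)"

lemma linear_nabla_S1: "x \<in> U \<Longrightarrow> linear (nabla_S1 x)"
  unfolding nabla_S1_def
  by (intro linear_compose_add has_derivative_linear[OF smooth_has_derivative[OF smooth_S1]] linear_christoffel)

lemma linear_om: "x \<in> U \<Longrightarrow> linear (om x)"
  unfolding om_def using linear_compose[OF linear_nabla_S1 linear_G(2)] by (simp add: o_def)

lemma smooth_nabla_S1: "smooth_on U (\<lambda>x. nabla_S1 x u)"
  unfolding nabla_S1_def
  by (rule smooth_add[OF open_U smooth_frechet_derivative[OF smooth_S1]
        smooth_linear_family[where L = "\<lambda>x. christoffel G x u", OF open_U linear_christoffel(1)
          smooth_christoffel smooth_S1]])

lemma smooth_om: "smooth_on U (\<lambda>x. om x u)"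
  unfolding om_def
  by (intro smooth_metric[OF open_U, where p = "\<lambda>x. x"] smooth_ident open_U smooth_nabla_S1 smooth_S2) auto

text \<open>The three inner products of the frame are constant. Differentiating them leaves a single
  one-form, as the rotation algebra of the plane has dimension one.\<close>

lemma nabla_frame:
  assumes x: "x \<in> U"
  shows "nabla_S1 x u = om x u *\<^sub>R S2 x" "nabla_S2 x u = - om x u *\<^sub>R S1 x"
proof -
  have pr: "((\<lambda>y. G y (A y) (B y)) has_derivative (\<lambda>h. G x (FD A x h + christoffel G x h (A x)) (B x)
        + G x (A x) (FD B x h + christoffel G x h (B x)))) (at x)"
    if "smooth_on U A" "smooth_on U B" for A B :: "real^2 \<Rightarrow> real^2"
    by (rule metric_product_rule[OF open_U x, where p = "\<lambda>y. y"])
      (auto intro: smooth_has_derivative[OF that(1) x] smooth_has_derivative[OF that(2) x] derivative_intros)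
  have c: "D h = 0" if "((\<lambda>y. G y (A y) (B y)) has_derivative D) (at x)" "\<And>y. y \<in> U \<Longrightarrow> G y (A y) (B y) = k"
    for A B :: "real^2 \<Rightarrow> real^2" and D k h
  proof -
    have "((\<lambda>y. k) has_derivative D) (at x)"
      by (rule has_derivative_transform_within_open[OF that(1) open_U x]) (use that(2) in auto)
    then show ?thesis using has_derivative_unique[OF _ has_derivative_const[of k]] by metis
  qed
  have 11: "G x (nabla_S1 x u) (S1 x) = 0"
    using c[OF pr[OF smooth_S1 smooth_S1] unit1, of u] sym[OF x] by (simp add: nabla_S1_def)
  have 22: "G x (nabla_S2 x u) (S2 x) = 0"
    using c[OF pr[OF smooth_S2 smooth_S2] unit2, of u] sym[OF x] by (simp add: nabla_S2_def)
  have 12: "G x (nabla_S2 x u) (S1 x) = - om x u"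
    using c[OF pr[OF smooth_S1 smooth_S2] ortho, of u] sym[OF x] by (simp add: nabla_S1_def nabla_S2_def om_def)
  show "nabla_S1 x u = om x u *\<^sub>R S2 x"
    using frame_expansion[OF x, of "nabla_S1 x u"] 11 by (simp add: om_def)
  show "nabla_S2 x u = - om x u *\<^sub>R S1 x"
    using frame_expansion[OF x, of "nabla_S2 x u"] 22 12 by simp
qed

abbreviation Dom :: "real^2 \<Rightarrow> real^2 \<Rightarrow> real^2 \<Rightarrow> real" where
  "Dom x u v \<equiv> FD (\<lambda>y. om y v) x u"

lemma has_Dom: "x \<in> U \<Longrightarrow> ((\<lambda>y. om y v) has_derivative (\<lambda>u. Dom x u v)) (at x)"
  using smooth_has_derivative[OF smooth_om] .

lemma linear_Dom:
  assumes x: "x \<in> U"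
  shows "linear (\<lambda>u. Dom x u v)" "linear (\<lambda>v. Dom x u v)"
proof -
  show "linear (\<lambda>u. Dom x u v)" using has_derivative_linear[OF has_Dom[OF x]] .
  have *: "Dom x u (a *\<^sub>R v + b *\<^sub>R v') = a * Dom x u v + b * Dom x u v'" for a b v v'
  proof -
    have "((\<lambda>y. a * om y v + b * om y v') has_derivative (\<lambda>u. a * Dom x u v + b * Dom x u v')) (at x)"
      by (intro derivative_intros has_Dom x)
    then have "((\<lambda>y. om y (a *\<^sub>R v + b *\<^sub>R v')) has_derivative (\<lambda>u. a * Dom x u v + b * Dom x u v')) (at x)"
      by (rule has_derivative_transform_within_open[OF _ open_U x])
        (simp add: linear_add[OF linear_om] linear_cmul[OF linear_om])
    then show ?thesis by (rule frechet_derivative_eqI)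
  qed
  then show "linear (\<lambda>v. Dom x u v)"
    using *[of 1 _ 1] *[of _ _ 0 0] by (intro linearI) auto
qed

text \<open>The product of \<open>nabla_S1\<close> with \<open>nabla_S2\<close> vanishes, since in
  dimension two these are multiples of \<open>S2\<close> and \<open>S1\<close>. What remains is the
  second covariant derivative of \<open>S1\<close>; its terms symmetric in the two directions drop
  out, and the antisymmetric part is the curvature.\<close>

lemma structure_equation:
  assumes x: "x \<in> U"
  shows "Dom x u v - Dom x v u = G x (riemann G x u v (S1 x)) (S2 x)"
proof -
  \<comment> \<open>The covariant derivative in direction \<open>u\<close> of the field
    \<open>nabla_S1\<close> with constant argument \<open>v\<close>, written out.\<close>
  define Q where "Q u v = FD (\<lambda>y. FD S1 y v) x u
     + FD (\<lambda>y. christoffel G y v (S1 x)) x u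
     + christoffel G x v (FD S1 x u)
     + christoffel G x u (FD S1 x v)
     + christoffel G x u (christoffel G x v (S1 x))" for u v
  have D: "Dom x u v = G x (Q u v) (S2 x)" for u v
  proof -
    have d1: "((\<lambda>y. christoffel G y v (S1 y)) has_derivative
       (\<lambda>h. FD (\<lambda>y. christoffel G y v (S1 x)) x h
          + christoffel G x v (FD S1 x h))) (at x)"
      by (rule has_derivative_linear_family[OF open_U x])
        (auto intro: linear_christoffel smooth_has_derivative[OF smooth_christoffel x] smooth_has_derivative[OF smooth_S1 x])
    have d2: "((\<lambda>y. nabla_S1 y v) has_derivative
       (\<lambda>h. FD (\<lambda>y. FD S1 y v) x h
          + (FD (\<lambda>y. christoffel G y v (S1 x)) x h
          + christoffel G x v (FD S1 x h)))) (at x)"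
      unfolding nabla_S1_def
      by (intro has_derivative_add d1 smooth_has_derivative[OF smooth_frechet_derivative[OF smooth_S1] x])
    have "((\<lambda>y. om y v) has_derivative (\<lambda>h.
          G x (FD (\<lambda>y. FD S1 y v) x h
          + (FD (\<lambda>y. christoffel G y v (S1 x)) x h
          + christoffel G x v (FD S1 x h))
          + christoffel G x h (nabla_S1 x v)) (S2 x)
          + G x (nabla_S1 x v) (FD S2 x h + christoffel G x h (S2 x)))) (at x)"
      unfolding om_def
      by (rule metric_product_rule[OF open_U x, where p = "\<lambda>y. y"])
        (auto intro: d2 smooth_has_derivative[OF smooth_S2 x] derivative_intros)
    then have "Dom x u v =
          G x (FD (\<lambda>y. FD S1 y v) x u
          + (FD (\<lambda>y. christoffel G y v (S1 x)) x u
          + christoffel G x v (FD S1 x u))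
          + christoffel G x u (nabla_S1 x v)) (S2 x)
          + G x (nabla_S1 x v) (nabla_S2 x u)"
      unfolding nabla_S2_def by (rule frechet_derivative_eqI)
    moreover have "G x (nabla_S1 x v) (nabla_S2 x u) = 0"
      unfolding nabla_frame[OF x] by (simp add: lin[OF x] ortho'[OF x])
    ultimately show ?thesis by (simp add: Q_def nabla_S1_def clin[OF x] add_ac)
  qed
  have "Q u v - Q v u = riemann G x u v (S1 x)"
    using second_derivative_symmetric[OF open_U smooth_S1 x, of v u]
    by (simp add: Q_def riemann_def algebra_simps)
  then show ?thesis unfolding D by (simp add: lin[OF x, symmetric])
qed

text \<open>The area form in terms of the orthonormal frame; it is also the inner product of J u
  with v.\<close>

definition vol :: "real^2 \<Rightarrow> real^2 \<Rightarrow> real^2 \<Rightarrow> real" where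
  "vol x u v = G x u (S1 x) * G x v (S2 x) - G x u (S2 x) * G x v (S1 x)"

text \<open>The pair turns at the speed of the angle plus the rate \<open>om\<close> at which the
  section itself turns along the curve. This links the angle coordinate to the covariant description
  of a moving frame.\<close>

lemma rotating_frame:
  assumes U: "p t \<in> U" and p: "(p has_vector_derivative p') (at t)"
    and \<theta>: "(\<theta> has_vector_derivative \<theta>') (at t)"
  defines "E1 \<equiv> \<lambda>s. cos (\<theta> s) *\<^sub>R S1 (p s) + sin (\<theta> s) *\<^sub>R S2 (p s)"
    and "E2 \<equiv> \<lambda>s. - sin (\<theta> s) *\<^sub>R S1 (p s) + cos (\<theta> s) *\<^sub>R S2 (p s)"
  shows "(E1 has_vector_derivative (\<theta>' + om (p t) p') *\<^sub>R E2 t - christoffel G (p t) p' (E1 t)) (at t)"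
    and "(E2 has_vector_derivative - (\<theta>' + om (p t) p') *\<^sub>R E1 t - christoffel G (p t) p' (E2 t)) (at t)"
proof -
  have S: "((\<lambda>s. S (p s)) has_vector_derivative FD S (p t) p') (at t)"
    if "smooth_on U S" for S :: "real^2 \<Rightarrow> real^2"
  proof -
    note d = smooth_has_derivative[OF that U]
    show ?thesis using has_derivative_compose[OF p[unfolded has_vector_derivative_def] d]
      by (simp add: has_vector_derivative_def linear_cmul[OF has_derivative_linear[OF d]])
  qed
  have n1: "FD S1 (p t) p' = om (p t) p' *\<^sub>R S2 (p t) - christoffel G (p t) p' (S1 (p t))"
    using nabla_frame(1)[OF U, of p'] unfolding nabla_S1_def by (simp add: algebra_simps)
  have n2: "FD S2 (p t) p' = - om (p t) p' *\<^sub>R S1 (p t) - christoffel G (p t) p' (S2 (p t))"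
    using nabla_frame(2)[OF U, of p'] unfolding nabla_S2_def by (simp add: algebra_simps)
  note S1 = S[OF smooth_S1, unfolded n1] and S2 = S[OF smooth_S2, unfolded n2]
  have th: "(\<theta> has_real_derivative \<theta>') (at t)"
    using \<theta> by (simp add: has_real_derivative_iff_has_vector_derivative)
  have c: "((\<lambda>s. cos (\<theta> s)) has_real_derivative - sin (\<theta> t) * \<theta>') (at t)"
    and s: "((\<lambda>s. sin (\<theta> s)) has_real_derivative cos (\<theta> t) * \<theta>') (at t)"
    using th by (auto intro!: derivative_eq_intros)
  note l = clin[OF U]
  show "(E1 has_vector_derivative (\<theta>' + om (p t) p') *\<^sub>R E2 t - christoffel G (p t) p' (E1 t)) (at t)"
    unfolding E1_def
    by (rule has_vector_derivative_eq_rhs[OF has_vector_derivative_add[OF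
            has_vector_derivative_scaleR[OF c S1] has_vector_derivative_scaleR[OF s S2]]]) (simp add: E2_def l algebra_simps)
  show "(E2 has_vector_derivative - (\<theta>' + om (p t) p') *\<^sub>R E1 t - christoffel G (p t) p' (E2 t)) (at t)"
    unfolding E2_def
    by (rule has_vector_derivative_eq_rhs[OF has_vector_derivative_add[OF
            has_vector_derivative_scaleR[OF DERIV_minus[OF s] S1] has_vector_derivative_scaleR[OF c S2]]]) (simp add: E1_def l bilinear_rsub[OF bilinear_christoffel[OF U]] algebra_simps)
qed

end

section \<open>Curvature, and the geodesic equation of the lift in coordinates\<close>

locale curved_frame_patch = frame_patch +
  fixes K :: "real^2 \<Rightarrow> real"
  assumes K: "x \<in> U \<Longrightarrow> G x (riemann G x u v v) u = K x * (G x u u * G x v v - (G x u v)\<^sup>2)"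
begin

lemma curvature_eq: "x \<in> U \<Longrightarrow> K x = Dom x (S2 x) (S1 x) - Dom x (S1 x) (S2 x)"
  using structure_equation[of x "S1 x" "S2 x"] K[of x "S2 x" "S1 x"]
  by (simp add: unit1 unit2 ortho')

text \<open>The identity defining K is pointwise; smoothness comes from expressing K through
  derivatives of the connection form evaluated on the frame.\<close>

lemma smooth_K: "smooth_on U K"
proof (rule smooth_cong[OF open_U curvature_eq[symmetric]])
  have D: "smooth_on U (\<lambda>x. Dom x (A x) (B x))" if "smooth_on U A" "smooth_on U B" for A B :: "real^2 \<Rightarrow> real^2"
  proof (rule smooth_linear_family[OF open_U _ _ that(2)])
    show "smooth_on U (\<lambda>x. Dom x (A x) b)" for b
      by (rule smooth_linear_family[OF open_U _ _ that(1)])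
        (auto intro: linear_Dom smooth_frechet_derivative smooth_om)
  qed (rule linear_Dom)
  show "smooth_on U (\<lambda>x. Dom x (S2 x) (S1 x) - Dom x (S1 x) (S2 x))"
    by (intro smooth_diff D smooth_S1 smooth_S2 open_U)
qed

text \<open>An alternating form on a plane is determined by its value on the frame, and that value
  is minus the curvature.\<close>

lemma d_om:
  assumes x: "x \<in> U"
  shows "Dom x u v - Dom x v u = - K x * vol x u v"
proof -
  note l = linear_add[OF linear_Dom(1)[OF x]] linear_add[OF linear_Dom(2)[OF x]]
    linear_cmul[OF linear_Dom(1)[OF x]] linear_cmul[OF linear_Dom(2)[OF x]]
  define a b c d where "a = G x u (S1 x)" "b = G x u (S2 x)" "c = G x v (S1 x)" "d = G x v (S2 x)"
  have u: "u = a *\<^sub>R S1 x + b *\<^sub>R S2 x" and v: "v = c *\<^sub>R S1 x + d *\<^sub>R S2 x"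
    unfolding a_b_c_d_def by (rule frame_expansion[OF x])+
  have "Dom x u v - Dom x v u = (b * c - a * d) * (Dom x (S2 x) (S1 x) - Dom x (S1 x) (S2 x))"
    unfolding u v by (simp add: l algebra_simps)
  then show ?thesis by (simp add: curvature_eq[OF x] vol_def a_b_c_d_def algebra_simps)
qed

abbreviation DK :: "real^2 \<Rightarrow> real^2 \<Rightarrow> real" where
  "DK x u \<equiv> FD K x u"

text \<open>The angle does not occur in the coefficients of \<open>H\<close>; the assumption on \<open>\<theta>'\<close> says that the conserved
  momentum \<open>(\<theta>' + om p') / K\<^sup>2\<close> equals \<open>C\<close>.\<close>

lemma wagner_geodesic:
  fixes T :: "((real^2) \<times> real) set" and p p' :: "real \<Rightarrow> real^2" and \<theta> :: "real \<Rightarrow> real"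
  assumes H: "metric_patch T H"
    and T: "\<And>x \<phi>. (x, \<phi>) \<in> T \<Longrightarrow> x \<in> U \<and> K x \<noteq> 0"
    and Heq: "\<And>x \<phi> u v \<tau> \<rho>. (x, \<phi>) \<in> T \<Longrightarrow>
      H (x, \<phi>) (u, \<tau>) (v, \<rho>) = G x u v + (\<tau> + om x u) * (\<rho> + om x v) / (K x)\<^sup>2"
    and N: "open N" "t \<in> N" and pT: "(p t, \<theta> t) \<in> T" and pU: "\<And>s. s \<in> N \<Longrightarrow> p s \<in> U"
    and p: "\<And>s. s \<in> N \<Longrightarrow> (p has_vector_derivative p' s) (at s)"
    and p': "(p' has_vector_derivative p'') (at t)"
    and \<theta>': "\<And>s. s \<in> N \<Longrightarrow> \<theta>' s = C * (K (p s))\<^sup>2 - om (p s) (p' s)"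
    and eq: "\<And>w. G (p t) (p'' + christoffel G (p t) (p' t) (p' t)) w
      = C * K (p t) * vol (p t) (p' t) w - C\<^sup>2 * K (p t) * DK (p t) w"
  shows "((\<lambda>s. (p' s, \<theta>' s)) has_vector_derivative
     - christoffel H (p t, \<theta> t) (p' t, \<theta>' t) (p' t, \<theta>' t)) (at t)"
proof -
  interpret H: metric_patch T H by fact
  define x where "x = p t"
  define k where "k = K x"
  have x: "x \<in> U" and k: "k \<noteq> 0" using T[OF pT] by (auto simp: x_def k_def)
  have DK: "(K has_derivative DK x) (at x)" using smooth_has_derivative[OF smooth_K x] .
  \<comment> \<open>The coefficients depend on the base point only, so the angular part \<alpha> of
    the direction does not appear on the right; the last term comes from differentiating
    1/K^2.\<close>
  have dH: "H.dG (x, \<phi>) (a, \<alpha>) (u, \<tau>) (v, \<rho>) = dG x a u v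
      + (Dom x a u * (\<rho> + om x v) + (\<tau> + om x u) * Dom x a v) / k\<^sup>2
      - 2 * (\<tau> + om x u) * (\<rho> + om x v) * DK x a / k ^ 3" if "(x, \<phi>) \<in> T" for \<phi> a \<alpha> u \<tau> v \<rho>
  proof -
    have f: "((\<lambda>q. F (fst q)) has_derivative (\<lambda>h. F' (fst h))) (at (x, \<phi>))"
      if "(F has_derivative F') (at x)" for F :: "real^2 \<Rightarrow> real" and F'
      using has_derivative_compose[OF has_derivative_fst[OF has_derivative_ident], of F F' "(x, \<phi>)" UNIV] that by simp
    have "((\<lambda>q. G (fst q) u v + (\<tau> + om (fst q) u) * (\<rho> + om (fst q) v) / (K (fst q))\<^sup>2) has_derivative
      (\<lambda>h. dG x (fst h) u v
      + (Dom x (fst h) u * (\<rho> + om x v) + (\<tau> + om x u) * Dom x (fst h) v) / k\<^sup>2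
      - 2 * (\<tau> + om x u) * (\<rho> + om x v) * DK x (fst h) / k ^ 3)) (at (x, \<phi>))"
      using k
      by (auto intro!: derivative_eq_intros f[OF has_dG[OF x]] f[OF has_Dom[OF x]] f[OF DK]
          simp: k_def[symmetric] field_simps power2_eq_square power3_eq_cube power4_eq_xxxx)
    then have "((\<lambda>q. H q (u, \<tau>) (v, \<rho>)) has_derivative
      (\<lambda>h. dG x (fst h) u v
      + (Dom x (fst h) u * (\<rho> + om x v) + (\<tau> + om x u) * Dom x (fst h) v) / k\<^sup>2
      - 2 * (\<tau> + om x u) * (\<rho> + om x v) * DK x (fst h) / k ^ 3)) (at (x, \<phi>))"
      by (rule has_derivative_transform_within_open[OF _ H.open_U that]) (auto simp: Heq)
    from frechet_derivative_eqI[OF this] show ?thesis by simp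
  qed
  define y where "y = p' t"
  \<comment> \<open>The derivative of C K^2 - om(p') along the curve.\<close>
  define \<theta>'' where "\<theta>'' = 2 * C * k * DK x y - (Dom x y y + om x p'')"
  have \<beta>: "\<theta>' t + om x y = C * k\<^sup>2" using \<theta>'[OF N(2)] by (simp add: x_def y_def k_def)
  have "((\<lambda>s. om (p s) (p' s)) has_derivative (\<lambda>h. Dom x (h *\<^sub>R y) (p' t) + om x (h *\<^sub>R p''))) (at t)"
  proof (rule has_derivative_linear_family[OF N, where L = "\<lambda>s. om (p s)"
        and L' = "\<lambda>a h. Dom x (h *\<^sub>R y) a" and E = p' and E' = "\<lambda>h. h *\<^sub>R p''", folded x_def])
    show "linear (om (p z))" if "z \<in> N" for z using linear_om pU that by blast
    show "((\<lambda>z. om (p z) a) has_derivative (\<lambda>h. Dom x (h *\<^sub>R y) a)) (at t)" for a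
      using has_derivative_compose[OF p[OF N(2), unfolded has_vector_derivative_def] has_Dom[OF x[unfolded x_def]], of a]
      by (simp add: x_def y_def)
    show "(p' has_derivative (\<lambda>h. h *\<^sub>R p'')) (at t)" using p' by (simp add: has_vector_derivative_def)
  qed
  then have o: "((\<lambda>s. om (p s) (p' s)) has_real_derivative Dom x y y + om x p'') (at t)"
    using linear_cmul[OF linear_Dom(1)[OF x]] linear_cmul[OF linear_om[OF x]]
    by (simp add: has_real_derivative_iff_has_vector_derivative has_vector_derivative_def
        y_def[symmetric] distrib_left)
  have "((\<lambda>s. K (p s)) has_real_derivative DK x y) (at t)"
    using has_derivative_compose[OF p[OF N(2), unfolded has_vector_derivative_def], of K "DK x"] DK
      linear_cmul[OF has_derivative_linear[OF DK]]
    by (simp add: has_real_derivative_iff_has_vector_derivative has_vector_derivative_def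
        x_def[symmetric] y_def[symmetric])
  then have "((\<lambda>s. C * (K (p s))\<^sup>2 - om (p s) (p' s)) has_real_derivative \<theta>'') (at t)"
    using o by (auto intro!: derivative_eq_intros simp: \<theta>''_def k_def x_def)
  then have \<theta>'': "(\<theta>' has_vector_derivative \<theta>'') (at t)"
    unfolding has_real_derivative_iff_has_vector_derivative
    by (rule has_vector_derivative_transform_within_open[OF _ N]) (simp add: \<theta>')
  define \<xi> where "\<xi> = (y, \<theta>' t)"
  have xT: "(x, \<theta> t) \<in> T" using pT by (simp add: x_def)
  have "(p'', \<theta>'') = - christoffel H (x, \<theta> t) \<xi> \<xi>"
  proof (rule H.nondegenerate[OF xT])
    fix w :: "(real^2) \<times> real"
    obtain a \<alpha> where w: "w = (a, \<alpha>)" by fastforce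
    have 1: "G x p'' a + (dG x y y a - dG x a y y / 2) = C * k * vol x y a - C\<^sup>2 * k * DK x a"
    proof -
      have "koszul x y y a = dG x y y a - dG x a y y / 2" by (simp add: koszul_def field_simps)
      then show ?thesis
        using eq[of a] by (simp add: x_def[symmetric] y_def[symmetric] k_def[symmetric] lin[OF x] christoffel_koszul[OF x])
    qed
    have 2: "Dom x y a - Dom x a y = - k * vol x y a" using d_om[OF x] by (simp add: k_def)
    \<comment> \<open>With equal arguments the Koszul expression is a derivative along \<xi> minus
      half a derivative along \<open>w\<close>: the Euler-Lagrange form of the geodesic
      equation.\<close>
    have "H (x, \<theta> t) (christoffel H (x, \<theta> t) \<xi> \<xi>) w = H.dG (x, \<theta> t) \<xi> \<xi> w - H.dG (x, \<theta> t) w \<xi> \<xi> / 2"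
      unfolding H.christoffel_koszul[OF xT] H.koszul_def by simp
    also have "\<dots> = dG x y y a - dG x a y y / 2
       + (Dom x y y * (\<alpha> + om x a) + C * k\<^sup>2 * Dom x y a) / k\<^sup>2 - 2 * (C * k\<^sup>2) * (\<alpha> + om x a) * DK x y / k ^ 3
       - (C * k\<^sup>2 * Dom x a y) / k\<^sup>2 + C * k\<^sup>2 * (C * k\<^sup>2) * DK x a / k ^ 3"
      unfolding w \<xi>_def dH[OF xT] \<beta> by (simp add: field_simps)
    also have "\<dots> = dG x y y a - dG x a y y / 2
       + Dom x y y * (\<alpha> + om x a) / k\<^sup>2 + C * (Dom x y a - Dom x a y) - 2 * C * (\<alpha> + om x a) * DK x y / k + C\<^sup>2 * k * DK x a"
      using k by (simp add: field_simps power2_eq_square power3_eq_cube)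
    finally have 3: "H (x, \<theta> t) (christoffel H (x, \<theta> t) \<xi> \<xi>) w = \<dots>" .
    have 4: "H (x, \<theta> t) (p'', \<theta>'') w = G x p'' a + (2 * C * k * DK x y - Dom x y y) * (\<alpha> + om x a) / k\<^sup>2"
      unfolding w Heq[OF xT] \<theta>''_def by (simp add: k_def)
    \<comment> \<open>The terms carrying \<open>\<alpha> + om x a\<close> cancel between 3 and 4,
      which is conservation of momentum. The rest is the base equation 1 tested against
      \<open>a\<close>, where the exterior derivative of the connection form, given by 2, produces
      the J-term.\<close>
    have "H (x, \<theta> t) (p'', \<theta>'') w + H (x, \<theta> t) (christoffel H (x, \<theta> t) \<xi> \<xi>) w
      = (G x p'' a + (dG x y y a - dG x a y y / 2)) + C * (Dom x y a - Dom x a y) + C\<^sup>2 * k * DK x a"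
      unfolding 3 4 using k by (simp add: field_simps power2_eq_square)
    also have "\<dots> = 0" unfolding 1 2 by simp
    finally show "H (x, \<theta> t) (p'', \<theta>'') w = H (x, \<theta> t) (- christoffel H (x, \<theta> t) \<xi> \<xi>) w"
      by (simp add: H.lin[OF xT])
  qed
  with has_vector_derivative_Pair[OF p' \<theta>''] show ?thesis by (simp add: x_def \<xi>_def y_def)
qed

end

section \<open>Existence of smooth orthonormal frames\<close>

lemma (in metric_patch) gram_schmidt_smooth:
  assumes A: "smooth_on U A" and ne: "\<And>x. x \<in> U \<Longrightarrow> A x \<noteq> 0"
  shows "smooth_on U (\<lambda>x. inverse (sqrt (G x (A x) (A x))) *\<^sub>R A x)"
    and "x \<in> U \<Longrightarrow> G x (inverse (sqrt (G x (A x) (A x))) *\<^sub>R A x) (inverse (sqrt (G x (A x) (A x))) *\<^sub>R A x) = 1"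
proof -
  have p: "G x (A x) (A x) > 0" if "x \<in> U" for x using pos ne that by blast
  then show "smooth_on U (\<lambda>x. inverse (sqrt (G x (A x) (A x))) *\<^sub>R A x)"
    by (intro smooth_scaleR smooth_inverse smooth_sqrt open_U A smooth_metric[OF open_U, where p = "\<lambda>x. x"] smooth_ident)
      fastforce+
  show "G x (inverse (sqrt (G x (A x) (A x))) *\<^sub>R A x) (inverse (sqrt (G x (A x) (A x))) *\<^sub>R A x) = 1" if "x \<in> U"
    using p[OF that] by (simp add: lin[OF that] mult.assoc[symmetric] field_simps)
qed

text \<open>Gram-Schmidt applied to the two coordinate fields. The second component is 0 for
  \<open>S1\<close> and 1 for \<open>W\<close>, and this triangular shape makes the frame positively
  oriented.\<close>

lemma frame_patch_exists:
  assumes "metric_patch (U :: (real^2) set) G"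
  obtains S1 S2 where "frame_patch U G S1 S2"
proof -
  interpret metric_patch U G by fact
  define e1 e2 :: "real^2" where e: "e1 = axis 1 1" "e2 = axis 2 1"
  have e_comp: "e1 $ 1 = 1" "e1 $ 2 = 0" "e2 $ 1 = 0" "e2 $ 2 = 1" by (simp_all add: e axis_def)
  define S1 where "S1 x = inverse (sqrt (G x e1 e1)) *\<^sub>R e1" for x
  define W where "W x = e2 - G x e2 (S1 x) *\<^sub>R S1 x" for x
  define S2 where "S2 x = inverse (sqrt (G x (W x) (W x))) *\<^sub>R W x" for x
  have e1: "e1 \<noteq> 0" by (simp add: e axis_eq_0_iff)
  have s1: "smooth_on U S1" "x \<in> U \<Longrightarrow> G x (S1 x) (S1 x) = 1" for x
    using gram_schmidt_smooth[OF smooth_const[OF open_U] e1] unfolding S1_def by blast+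
  have W1: "S1 x $ 2 = 0" "W x $ 2 = 1" for x
    by (simp_all add: S1_def W_def e_comp)
  then have Wn: "W x \<noteq> 0" for x by (metis zero_index zero_neq_one)
  have sW: "smooth_on U W" unfolding W_def
    by (intro smooth_diff smooth_scaleR smooth_const s1 open_U smooth_metric[OF open_U, where p = "\<lambda>x. x"] smooth_ident) simp
  have s2: "smooth_on U S2" "x \<in> U \<Longrightarrow> G x (S2 x) (S2 x) = 1" for x
    using gram_schmidt_smooth[OF sW Wn] unfolding S2_def by blast+
  show thesis
  proof (rule that, unfold_locales)
    show "G x (S1 x) (S2 x) = 0" if "x \<in> U" for x
      using s1(2)[OF that] by (simp add: S2_def W_def lin[OF that] sym[OF that, of "S1 x" e2])
    show "det2 (S1 x) (S2 x) > 0" if x: "x \<in> U" for x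
      using pos[OF x e1] pos[OF x Wn] W1 by (simp add: det_vector_2 S2_def) (simp add: S1_def e_comp)
  qed (use s1 s2 in auto)
qed

section \<open>Tangent vectors and metrics on an atlas\<close>

lemma charts_at_iff: "c \<in> charts_at A p \<longleftrightarrow> c \<in> A \<and> p \<in> fst c"
  by (simp add: charts_at_def)

lemma in_points: "c \<in> A \<Longrightarrow> p \<in> fst c \<Longrightarrow> p \<in> points A"
  by (auto simp: points_def)

lemma points_chart:
  assumes "p \<in> points A" obtains c where "c \<in> A" "p \<in> fst c"
  using assms by (auto simp: points_def)

text \<open>Shared by the surface and its frame bundle, hence the arbitrary model space.\<close>

locale atlas =
  fixes B :: "('a, 'e::euclidean_space) chart set"
  assumes smooth_atlas: "smooth_atlas B"
begin

lemma inj: "c \<in> B \<Longrightarrow> inj_on (snd c) (fst c)"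
  and open_overlap: "c \<in> B \<Longrightarrow> d \<in> B \<Longrightarrow> open (snd c ` (fst c \<inter> fst d))"
  and smooth_transition: "c \<in> B \<Longrightarrow> d \<in> B \<Longrightarrow> smooth_on (snd c ` (fst c \<inter> fst d)) (transition c d)"
  using smooth_atlas by (auto simp: smooth_atlas_def)

lemma open_chart: "c \<in> B \<Longrightarrow> open (snd c ` fst c)"
  using open_overlap[of c c] by simp

lemma chart_inv: "c \<in> B \<Longrightarrow> p \<in> fst c \<Longrightarrow> chart_inv c (snd c p) = p"
  using inj by (simp add: chart_inv_def)

lemma transition: "c \<in> B \<Longrightarrow> p \<in> fst c \<Longrightarrow> transition c d (snd c p) = snd d p"
  by (simp add: transition_def chart_inv)

abbreviation dtrans where "dtrans c d p \<equiv> FD (transition c d) (snd c p)"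

lemma has_dtrans:
  assumes "c \<in> B" "d \<in> B" "p \<in> fst c" "p \<in> fst d"
  shows "(transition c d has_derivative dtrans c d p) (at (snd c p))"
  using smooth_has_derivative[OF smooth_transition[OF assms(1,2)]] assms(3,4) by blast

lemma linear_dtrans:
  "c \<in> B \<Longrightarrow> d \<in> B \<Longrightarrow> p \<in> fst c \<Longrightarrow> p \<in> fst d \<Longrightarrow> linear (dtrans c d p)"
  using has_derivative_linear[OF has_dtrans] .

lemma dtrans_self:
  assumes "c \<in> B" "p \<in> fst c" shows "dtrans c c p u = u"
proof (rule frechet_derivative_eqI)
  show "(transition c c has_derivative (\<lambda>u. u)) (at (snd c p))"
    by (rule has_derivative_transform_within_open[OF has_derivative_ident open_chart[OF assms(1)]])
      (use assms transition[OF assms(1), of _ c] in auto)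
qed

lemma dtrans_cocycle:
  assumes "c \<in> B" "d \<in> B" "e \<in> B" "p \<in> fst c" "p \<in> fst d" "p \<in> fst e"
  shows "dtrans d e p (dtrans c d p u) = dtrans c e p u"
proof (rule frechet_derivative_eqI[symmetric])
  note a = assms
  have "((\<lambda>x. transition d e (transition c d x)) has_derivative (\<lambda>u. dtrans d e p (dtrans c d p u))) (at (snd c p))"
    using has_derivative_compose[OF has_dtrans[OF a(1,2,4,5)], of "transition d e"]
      has_dtrans[OF a(2,3,5,6)] a by (simp add: transition)
  then show "(transition c e has_derivative (\<lambda>u. dtrans d e p (dtrans c d p u))) (at (snd c p))"
    by (rule has_derivative_transform_within_open[OF _ open_overlap[OF a(1,2)]])
      (use a in \<open>auto simp: transition\<close>)
qed

lemma coord_vec_chart: "c \<in> B \<Longrightarrow> d \<in> B \<Longrightarrow> p \<in> fst d \<Longrightarrow> coord_vec B c p u d = dtrans c d p u"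
  by (simp add: coord_vec_def charts_at_iff)

lemma coord_vec_self: "c \<in> B \<Longrightarrow> p \<in> fst c \<Longrightarrow> coord_vec B c p u c = u"
  by (simp add: coord_vec_chart dtrans_self)

lemma coord_vec_tangent: "c \<in> B \<Longrightarrow> p \<in> fst c \<Longrightarrow> coord_vec B c p u \<in> tangent_space B p"
  unfolding tangent_space_def charts_at_iff mem_Collect_eq
  by (intro conjI ballI allI impI) (simp_all add: charts_at_iff coord_vec_chart dtrans_cocycle, auto simp add: coord_vec_def charts_at_iff)

lemma tangent_transform:
  assumes "X \<in> tangent_space B p" "c \<in> B" "d \<in> B" "p \<in> fst c" "p \<in> fst d"
  shows "X d = dtrans c d p (X c)"
proof -
  have "\<forall>c\<in>charts_at B p. \<forall>d\<in>charts_at B p. X d = dtrans c d p (X c)"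
    using assms(1) unfolding tangent_space_def mem_Collect_eq by (rule conjunct1)
  then have "\<forall>d\<in>charts_at B p. X d = dtrans c d p (X c)"
    by (rule bspec) (simp add: charts_at_iff assms)
  then show ?thesis by (rule bspec) (simp add: charts_at_iff assms)
qed

text \<open>A family over all charts carries no more data than one of its components; identities
  between tangent vectors are therefore checked in a single chart.\<close>

lemma tangent_eq_coord_vec:
  assumes "X \<in> tangent_space B p" "c \<in> B" "p \<in> fst c"
  shows "X = coord_vec B c p (X c)"
proof
  fix d
  show "X d = coord_vec B c p (X c) d"
  proof (cases "d \<in> charts_at B p")
    case True
    then show ?thesis using tangent_transform[OF assms(1,2) _ assms(3), of d] by (simp add: coord_vec_def charts_at_iff)
  next
    case False
    moreover have "X d = 0" using assms(1) False unfolding tangent_space_def by blast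
    ultimately show ?thesis by (simp add: coord_vec_def)
  qed
qed

lemma tangent_eqI:
  assumes "X \<in> tangent_space B p" "Y \<in> tangent_space B p" "c \<in> B" "p \<in> fst c" "X c = Y c"
  shows "X = Y"
  using tangent_eq_coord_vec assms by metis

lemma lincomb_coord_vec:
  assumes "c \<in> B" "p \<in> fst c"
  shows "lincomb a (coord_vec B c p u) b (coord_vec B c p v) = coord_vec B c p (a *\<^sub>R u + b *\<^sub>R v)"
  by (rule ext)
    (use assms in \<open>auto simp: lincomb_def coord_vec_def charts_at_iff linear_add[OF linear_dtrans] linear_cmul[OF linear_dtrans]\<close>)

lemma coord_vec_change:
  assumes "c \<in> B" "d \<in> B" "p \<in> fst c" "p \<in> fst d"
  shows "coord_vec B c p u = coord_vec B d p (dtrans c d p u)"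
  using tangent_eq_coord_vec[OF coord_vec_tangent[OF assms(1,3)] assms(2,4)] assms by (simp add: coord_vec_chart)

lemma lincomb_tangent:
  assumes "X \<in> tangent_space B p" "Y \<in> tangent_space B p" "p \<in> points B"
  shows "lincomb a X b Y \<in> tangent_space B p"
proof -
  obtain c where c: "c \<in> B" "p \<in> fst c" using points_chart[OF assms(3)] .
  have "lincomb a X b Y = coord_vec B c p (a *\<^sub>R X c + b *\<^sub>R Y c)"
    using tangent_eq_coord_vec[OF assms(1) c] tangent_eq_coord_vec[OF assms(2) c] lincomb_coord_vec[OF c] by metis
  then show ?thesis using coord_vec_tangent[OF c] by simp
qed

lemma has_velocity:
  assumes "smooth_curve B I \<sigma>" "t \<in> I" "c \<in> B" "\<sigma> t \<in> fst c"
  shows "((\<lambda>s. snd c (\<sigma> s)) has_vector_derivative velocity B \<sigma> t c) (at t)"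
proof -
  have "open {t \<in> I. \<sigma> t \<in> fst c}" "smooth_on {t \<in> I. \<sigma> t \<in> fst c} (\<lambda>t. snd c (\<sigma> t))"
    using assms by (auto simp: smooth_curve_def)
  from smooth_vector_derivative(2)[OF this, of t] show ?thesis
    using assms by (simp add: velocity_def charts_at_iff)
qed

lemma velocity_eqI:
  assumes "((\<lambda>s. snd c (\<sigma> s)) has_vector_derivative v) (at t)" "c \<in> B" "\<sigma> t \<in> fst c"
  shows "velocity B \<sigma> t c = v"
  using vector_derivative_at[OF assms(1)] assms by (simp add: velocity_def charts_at_iff)

lemma velocity_tangent:
  assumes s: "smooth_curve B I \<sigma>" "t \<in> I"
  shows "velocity B \<sigma> t \<in> tangent_space B (\<sigma> t)"
proof -
  have "velocity B \<sigma> t d = dtrans c d (\<sigma> t) (velocity B \<sigma> t c)"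
    if "c \<in> B" "\<sigma> t \<in> fst c" "d \<in> B" "\<sigma> t \<in> fst d" for c d
  proof (rule velocity_eqI[where c = d and \<sigma> = \<sigma>, OF _ that(3,4)])
    have o: "open {t \<in> I. \<sigma> t \<in> fst c}" using s that by (simp add: smooth_curve_def)
    have l: "linear (dtrans c d (\<sigma> t))" using linear_dtrans that by blast
    have "((\<lambda>s. transition c d (snd c (\<sigma> s))) has_derivative (\<lambda>h. dtrans c d (\<sigma> t) (h *\<^sub>R velocity B \<sigma> t c))) (at t)"
      using has_derivative_compose[OF has_velocity[OF s that(1,2), unfolded has_vector_derivative_def] has_dtrans[OF that(1,3,2,4)]] .
    then have "((\<lambda>s. transition c d (snd c (\<sigma> s))) has_vector_derivative dtrans c d (\<sigma> t) (velocity B \<sigma> t c)) (at t)"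
      by (simp add: has_vector_derivative_def linear_cmul[OF l])
    then show "((\<lambda>s. snd d (\<sigma> s)) has_vector_derivative dtrans c d (\<sigma> t) (velocity B \<sigma> t c)) (at t)"
      by (rule has_vector_derivative_transform_within_open[OF _ o]) (use s that in \<open>auto simp: transition\<close>)
  qed
  then show ?thesis
    unfolding tangent_space_def mem_Collect_eq by (simp add: charts_at_iff) (simp add: velocity_def charts_at_iff)
qed

lemma smooth_curve_chart:
  assumes "smooth_curve B I \<sigma>" "c \<in> B"
  shows "open {t \<in> I. \<sigma> t \<in> fst c}" "smooth_on {t \<in> I. \<sigma> t \<in> fst c} (\<lambda>t. snd c (\<sigma> t))"
    "smooth_on {t \<in> I. \<sigma> t \<in> fst c} (\<lambda>t. velocity B \<sigma> t c)"
proof -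
  show o: "open {t \<in> I. \<sigma> t \<in> fst c}" and s: "smooth_on {t \<in> I. \<sigma> t \<in> fst c} (\<lambda>t. snd c (\<sigma> t))"
    using assms by (auto simp: smooth_curve_def)
  show "smooth_on {t \<in> I. \<sigma> t \<in> fst c} (\<lambda>t. velocity B \<sigma> t c)"
    by (rule smooth_cong[OF o _ smooth_vector_derivative(1)[OF o s]])
      (use assms in \<open>simp add: velocity_def charts_at_iff\<close>)
qed

lemma smooth_curve_restrict:
  assumes "smooth_curve B I \<sigma>" "open J" "J \<subseteq> I"
  shows "smooth_curve B J \<sigma>"
proof -
  have e: "{t \<in> J. \<sigma> t \<in> fst c} = J \<inter> {t \<in> I. \<sigma> t \<in> fst c}" for c using assms(3) by auto
  have "open {t \<in> J. \<sigma> t \<in> fst c} \<and> smooth_on {t \<in> J. \<sigma> t \<in> fst c} (\<lambda>t. snd c (\<sigma> t))" if "c \<in> B" for c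
    unfolding e
    using open_Int[OF assms(2) smooth_curve_chart(1)[OF assms(1) that]]
      smooth_subset[OF smooth_curve_chart(2)[OF assms(1) that] Int_lower2] by (rule conjI)
  moreover have "\<sigma> ` J \<subseteq> points B" using assms(1,3) unfolding smooth_curve_def by blast
  ultimately show ?thesis using assms(2) unfolding smooth_curve_def by simp
qed

lemma smooth_coord_vec:
  assumes "c \<in> B" "d \<in> B"
  shows "smooth_on (snd c ` (fst c \<inter> fst d)) (\<lambda>y. FD (transition c d) y u)"
  using smooth_frechet_derivative smooth_transition assms by blast

end

section \<open>Metrics read in charts, and changes of chart\<close>

locale riemannian = atlas B for B :: "('a, 'e::euclidean_space) chart set" +
  fixes W :: "'a set" and h :: "('a, 'e) metric_field"
  assumes metric: "riemannian_metric_on B W h"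
begin

abbreviation mc where "mc c \<equiv> metric_coeff B h c"

lemma W_points: "W \<subseteq> points B"
  and open_W: "c \<in> B \<Longrightarrow> open (snd c ` (fst c \<inter> W))"
  and h_sym: "p \<in> W \<Longrightarrow> X \<in> tangent_space B p \<Longrightarrow> Y \<in> tangent_space B p \<Longrightarrow> h p X Y = h p Y X"
  and h_lincomb: "p \<in> W \<Longrightarrow> X \<in> tangent_space B p \<Longrightarrow> Y \<in> tangent_space B p \<Longrightarrow> Z \<in> tangent_space B p \<Longrightarrow>
       h p (lincomb a X b Y) Z = a * h p X Z + b * h p Y Z"
  and h_pos: "p \<in> W \<Longrightarrow> X \<in> tangent_space B p \<Longrightarrow> X \<noteq> (\<lambda>c. 0) \<Longrightarrow> h p X X > 0"
  and h_smooth: "c \<in> B \<Longrightarrow> smooth_on (snd c ` (fst c \<inter> W)) (\<lambda>x. mc c x u v)"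
  using metric unfolding riemannian_metric_on_def by blast+

lemma h_lincomb_right:
  assumes "p \<in> W" "X \<in> tangent_space B p" "Y \<in> tangent_space B p" "Z \<in> tangent_space B p"
  shows "h p Z (lincomb a X b Y) = a * h p Z X + b * h p Z Y"
proof -
  have "p \<in> points B" using W_points assms by blast
  then show ?thesis
    using h_lincomb[OF assms] h_sym[OF assms(1,4)] lincomb_tangent[OF assms(2,3)] assms(2,3) by simp
qed

lemma mc_eq:
  "c \<in> B \<Longrightarrow> p \<in> fst c \<Longrightarrow> mc c (snd c p) u v = h p (coord_vec B c p u) (coord_vec B c p v)"
  by (simp add: metric_coeff_def chart_inv)

lemma h_eq_mc:
  assumes "c \<in> B" "p \<in> fst c" "X \<in> tangent_space B p" "Y \<in> tangent_space B p"
  shows "h p X Y = mc c (snd c p) (X c) (Y c)"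
  using mc_eq tangent_eq_coord_vec assms by metis

lemma mc_patch:
  assumes c: "c \<in> B" shows "metric_patch (snd c ` (fst c \<inter> W)) (mc c)"
proof
  fix x assume "x \<in> snd c ` (fst c \<inter> W)"
  then obtain p where p: "p \<in> fst c" "p \<in> W" and x: "x = snd c p" by blast
  note t = coord_vec_tangent[OF c p(1)]
  have l: "mc c x (a *\<^sub>R u + b *\<^sub>R v) w = a * mc c x u w + b * mc c x v w" for a b u v w
    unfolding x mc_eq[OF c p(1)] using h_lincomb[OF p(2) t t t] lincomb_coord_vec[OF c p(1)] by metis
  show s: "mc c x u v = mc c x v u" for u v
    unfolding x mc_eq[OF c p(1)] using h_sym[OF p(2) t t] .
  have 1: "linear (\<lambda>u. mc c x u w)" for w
    using l[of 1 _ 1] l[of _ _ 0 0] by (intro linearI) auto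
  moreover have "linear (mc c x u)" for u using 1[of u] s[of _ u] by simp
  ultimately show "bilinear (mc c x)" by (simp add: bilinear_def)
  fix u :: 'e assume "u \<noteq> 0"
  then have "coord_vec B c p u \<noteq> (\<lambda>c. 0)" using coord_vec_self[OF c p(1), of u] by metis
  then show "mc c x u u > 0" unfolding x mc_eq[OF c p(1)] using h_pos[OF p(2) t] by blast
qed (use c open_W h_smooth in auto)

lemma transition_isometry:
  assumes c: "c \<in> B" and d: "d \<in> B"
  shows "metric_isometry (snd c ` (fst c \<inter> fst d \<inter> W)) (mc c) (snd d ` (fst d \<inter> W)) (mc d) (transition c d)"
proof -
  let ?U = "snd c ` (fst c \<inter> fst d \<inter> W)"
  have "?U = snd c ` (fst c \<inter> fst d) \<inter> snd c ` (fst c \<inter> W)"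
    using inj_on_image_Int[OF inj[OF c], of "fst c \<inter> fst d" "fst c \<inter> W"] by (simp add: Int_assoc Int_left_commute)
  then have o: "open ?U" using open_overlap[OF c d] open_W[OF c] by auto
  interpret c: metric_patch ?U "mc c"
    by (rule metric_patch.metric_patch_subset[OF mc_patch[OF c] o]) auto
  interpret d: metric_patch "snd d ` (fst d \<inter> W)" "mc d" by (rule mc_patch[OF d])
  show ?thesis
  proof unfold_locales
    show "smooth_on ?U (transition c d)" by (rule smooth_subset[OF smooth_transition[OF c d]]) auto
    fix x assume "x \<in> ?U"
    then obtain p where p: "p \<in> fst c" "p \<in> fst d" "p \<in> W" and x: "x = snd c p" by blast
    show "transition c d x \<in> snd d ` (fst d \<inter> W)" unfolding x using transition[OF c p(1)] p by simp
    \<comment> \<open>By the cocycle rule the derivative of the reverse transition is a right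
      inverse.\<close>
    show "surj (FD (transition c d) x)"
      using dtrans_cocycle[OF d c d p(2,1,2)] dtrans_self[OF d p(2)] unfolding x surj_def by metis
    show "mc c x u v = mc d (transition c d x) (FD (transition c d) x u)
       (FD (transition c d) x v)" for u v
      unfolding x transition[OF c p(1)] mc_eq[OF c p(1)] mc_eq[OF d p(2)]
      using coord_vec_change[OF c d p(1,2)] by simp
  qed
qed

text \<open>Transition maps are isometries of the coefficients, so an equation for a covariant
  derivative verified in one chart holds in all. Here \<open>F\<close> is the prescribed covariant
  derivative as a tangent vector.\<close>

lemma cov_deriv_change_chart:
  assumes s: "smooth_curve B I \<sigma>" "t \<in> I" "\<sigma> ` I \<subseteq> W"
    and E: "\<And>s. s \<in> I \<Longrightarrow> E s \<in> tangent_space B (\<sigma> s)"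
    and c: "c \<in> B" "\<sigma> t \<in> fst c" and d: "d \<in> B" "\<sigma> t \<in> fst d"
    and E': "((\<lambda>s. E s c) has_vector_derivative F c - christoffel (mc c) (snd c (\<sigma> t)) (velocity B \<sigma> t c) (E t c)) (at t)"
    and F: "F \<in> tangent_space B (\<sigma> t)"
  shows "((\<lambda>s. E s d) has_vector_derivative F d - christoffel (mc d) (snd d (\<sigma> t)) (velocity B \<sigma> t d) (E t d)) (at t)"
proof -
  interpret i: metric_isometry "snd c ` (fst c \<inter> fst d \<inter> W)" "mc c" "snd d ` (fst d \<inter> W)" "mc d" "transition c d"
    by (rule transition_isometry[OF c(1) d(1)])
  define N where "N = {t \<in> I. \<sigma> t \<in> fst c} \<inter> {t \<in> I. \<sigma> t \<in> fst d}"
  have N: "open N" "t \<in> N"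
    unfolding N_def using smooth_curve_chart(1)[OF s(1) c(1)] smooth_curve_chart(1)[OF s(1) d(1)] s(2) c(2) d(2) by auto
  have "(\<lambda>s. snd c (\<sigma> s)) ` N \<subseteq> snd c ` (fst c \<inter> fst d \<inter> W)" using s(3) by (auto simp: N_def)
  from i.cov_deriv_transform[OF N this has_velocity[OF s(1,2) c] E']
  have "((\<lambda>s. FD (transition c d) (snd c (\<sigma> s)) (E s c)) has_vector_derivative
      F d - christoffel (mc d) (snd d (\<sigma> t)) (velocity B \<sigma> t d) (E t d)) (at t)"
    using tangent_transform[OF F c(1) d(1) c(2) d(2)] tangent_transform[OF E[OF s(2)] c(1) d(1) c(2) d(2)]
      tangent_transform[OF velocity_tangent[OF s(1,2)] c(1) d(1) c(2) d(2)] transition[OF c] by simp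
  then show ?thesis
    by (rule has_vector_derivative_transform_within_open[OF _ N])
      (use tangent_transform[OF E c(1) d(1)] in \<open>auto simp: N_def\<close>)
qed

end

section \<open>The frame bundle as a manifold\<close>

text \<open>The angle in \<open>(\<theta>\<^sub>0 - \<pi>, \<theta>\<^sub>0 + \<pi>)\<close> of the unit vector \<open>(X, Y)\<close>. The half-angle formula makes it
  smooth on the whole domain of a frame chart.\<close>

definition wrapped_angle :: "real \<Rightarrow> real \<Rightarrow> real \<Rightarrow> real" where
  "wrapped_angle a0 X Y = a0 + 2 * arctan ((cos a0 * Y - sin a0 * X) / (1 + (cos a0 * X + sin a0 * Y)))"

lemma two_arctan_half:
  assumes "- pi < \<phi>" "\<phi> < pi"
  shows "1 + cos \<phi> > 0" "2 * arctan (sin \<phi> / (1 + cos \<phi>)) = \<phi>"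
proof -
  have c: "cos (\<phi> / 2) > 0" using assms by (intro cos_gt_zero_pi) auto
  have e: "1 + cos \<phi> = 2 * (cos (\<phi> / 2))\<^sup>2" using cos_double_cos[of "\<phi> / 2"] by simp
  then show "1 + cos \<phi> > 0" using c by simp
  have "sin \<phi> / (1 + cos \<phi>) = tan (\<phi> / 2)"
    unfolding e tan_def using sin_double[of "\<phi> / 2"] c by (simp add: power2_eq_square)
  then show "2 * arctan (sin \<phi> / (1 + cos \<phi>)) = \<phi>"
    using arctan_tan[of "\<phi> / 2"] assms by simp
qed

lemma wrapped_angle_cos_sin:
  assumes "\<theta> \<in> {a0 - pi <..< a0 + pi}"
  shows "1 + (cos a0 * cos \<theta> + sin a0 * sin \<theta>) \<noteq> 0" "wrapped_angle a0 (cos \<theta>) (sin \<theta>) = \<theta>"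
proof -
  have 1: "cos a0 * cos \<theta> + sin a0 * sin \<theta> = cos (\<theta> - a0)" by (simp add: cos_diff)
  have 2: "cos a0 * sin \<theta> - sin a0 * cos \<theta> = sin (\<theta> - a0)" by (simp add: sin_diff)
  show "1 + (cos a0 * cos \<theta> + sin a0 * sin \<theta>) \<noteq> 0" "wrapped_angle a0 (cos \<theta>) (sin \<theta>) = \<theta>"
    unfolding wrapped_angle_def 1 2 using two_arctan_half[of "\<theta> - a0"] assms by auto
qed

lemma angle_exists_around:
  assumes "X\<^sup>2 + Y\<^sup>2 = 1" "1 + (cos a0 * X + sin a0 * Y) \<noteq> (0::real)"
  obtains \<theta> where "\<theta> \<in> {a0 - pi <..< a0 + pi}" "X = cos \<theta>" "Y = sin \<theta>"
proof -
  define P Q where "P = cos a0 * X + sin a0 * Y" and "Q = cos a0 * Y - sin a0 * X"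
  have sc: "(sin a0)\<^sup>2 = 1 - (cos a0)\<^sup>2" by (simp add: sin_squared_eq)
  have X: "X = cos a0 * P - sin a0 * Q"
    unfolding P_def Q_def using sin_cos_squared_add[of a0] by algebra
  have Y: "Y = sin a0 * P + cos a0 * Q"
    unfolding P_def Q_def using sin_cos_squared_add[of a0] by algebra
  have "P\<^sup>2 + Q\<^sup>2 = 1" using assms(1) sin_cos_squared_add[of a0] unfolding P_def Q_def by algebra
  \<comment> \<open>For the opposite point the angle is found in [0, 2 pi); shifting it back by pi
    gives (-pi, pi), since t = 0 would mean P = -1, which the second assumption excludes.\<close>
  then have "(- P)\<^sup>2 + (- Q)\<^sup>2 = 1" by simp
  then obtain t where t: "0 \<le> t" "t < 2 * pi" "- P = cos t" "- Q = sin t" using sincos_total_2pi by metis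
  have "t \<noteq> 0" using t(3) assms(2) by (auto simp: P_def)
  moreover have P: "P = cos (t - pi)" "Q = sin (t - pi)" using t by (auto simp: cos_diff sin_diff)
  moreover have "X = cos (a0 + (t - pi))" "Y = sin (a0 + (t - pi))"
    unfolding cos_add sin_add P[symmetric] using X Y by auto
  ultimately show thesis using that[of "a0 + (t - pi)"] t by auto
qed

text \<open>The change of basis is orthogonal with positive determinant, hence a rotation, and a
  plane rotation is determined by its first row.\<close>

lemma oriented_orthonormal_pair:
  fixes a1 a2 b1 b2 :: "real^2"
  assumes "metric_patch U G" "x \<in> U"
    and a: "G x a1 a1 = 1" "G x a2 a2 = 1" "G x a1 a2 = 0" "det2 a1 a2 > 0"
    and b: "G x b1 b1 = 1" "G x b2 b2 = 1" "G x b1 b2 = 0" "det2 b1 b2 > 0"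
  defines "X \<equiv> G x a1 b1" and "Y \<equiv> G x a1 b2"
  shows "X\<^sup>2 + Y\<^sup>2 = 1" "a1 = X *\<^sub>R b1 + Y *\<^sub>R b2" "a2 = - Y *\<^sub>R b1 + X *\<^sub>R b2"
proof -
  interpret metric_patch U G by fact
  note l = lin[OF assms(2)] and s = sym[OF assms(2)]
  have ex: "v = G x v b1 *\<^sub>R b1 + G x v b2 *\<^sub>R b2" for v
  proof -
    obtain r q where v: "v = r *\<^sub>R b1 + q *\<^sub>R b2" using vec2_combination b(4) by (metis less_irrefl)
    have "G x v b1 = r" "G x v b2 = q" unfolding v using b s[of b2 b1] by (simp_all add: l)
    then show ?thesis using v by simp
  qed
  define P Q where "P = G x a2 b1" and "Q = G x a2 b2"
  have a1: "a1 = X *\<^sub>R b1 + Y *\<^sub>R b2" and a2: "a2 = P *\<^sub>R b1 + Q *\<^sub>R b2"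
    unfolding X_def Y_def P_def Q_def by (rule ex)+
  have n1: "X * X + Y * Y = 1" using a(1) b s[of b2 b1] unfolding a1 by (simp add: l)
  have n2: "P * P + Q * Q = 1" using a(2) b s[of b2 b1] unfolding a2 by (simp add: l)
  have o: "X * P + Y * Q = 0" using a(3) b s[of b2 b1] unfolding a1 a2 by (simp add: l mult.commute)
  have "det2 a1 a2 = (X * Q - Y * P) * det2 b1 b2"
    unfolding det_vector_2 a1 a2 by (simp add: algebra_simps)
  then have d: "X * Q - Y * P > 0" using a(4) b(4) by (simp add: zero_less_mult_iff)
  have "(X * Q - Y * P)\<^sup>2 = 1" using n1 n2 o by algebra
  then have d: "X * Q - Y * P = 1" using d by (simp add: power2_eq_1_iff)
  \<comment> \<open>The sum of squares is the sum of the two squared row norms minus twice the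
    determinant, that is 1 + 1 - 2.\<close>
  have "(X - Q)\<^sup>2 + (Y + P)\<^sup>2 = 0" using n1 n2 d by algebra
  then have "Q = X" "P = - Y" by (simp_all add: sum_power2_eq_zero_iff)
  then show "a1 = X *\<^sub>R b1 + Y *\<^sub>R b2" "a2 = - Y *\<^sub>R b1 + X *\<^sub>R b2" using a1 a2 by auto
  show "X\<^sup>2 + Y\<^sup>2 = 1" using n1 by (simp add: power2_eq_square)
qed

lemma det_matrix_2:
  fixes L :: "real^2 \<Rightarrow> real^2"
  assumes "linear L"
  shows "det2 (L a) (L b) = det (matrix L) * det2 a b"
proof -
  have "L v $ i = matrix L $ i $ 1 * v $ 1 + matrix L $ i $ 2 * v $ 2" for v i
    using fun_cong[OF matrix_vector_mul(2)[OF assms], symmetric, of v]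
    unfolding matrix_vector_mult_def by (simp add: sum_2)
  then show ?thesis unfolding det_vector_2 by (simp add: det_2 algebra_simps)
qed

section \<open>Oriented orthonormal frames on a surface\<close>

locale surface =
  fixes A :: "('a, real^2) chart set" and g :: "('a, real^2) metric_field"
  assumes surface: "oriented_riemannian_surface A g"

sublocale surface \<subseteq> riemannian A "points A" g
  using surface by unfold_locales (simp_all add: oriented_riemannian_surface_def smooth_manifold_def)

context surface begin

abbreviation U where "U c \<equiv> snd c ` fst c"
abbreviation frames where "frames \<equiv> SO_bundle A g"
abbreviation gauge where "gauge c s \<equiv> smooth_frame A g (fst c) s"

lemma chart_Int_points: "c \<in> A \<Longrightarrow> fst c \<inter> points A = fst c"
  by (auto simp: points_def)

lemma patch: "c \<in> A \<Longrightarrow> metric_patch (U c) (mc c)"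
  using mc_patch[of c] by (simp add: chart_Int_points)

lemma det_dtrans:
  assumes "c \<in> A" "d \<in> A" "p \<in> fst c" "p \<in> fst d"
  shows "det (matrix (dtrans c d p)) > 0"
proof -
  have "oriented_atlas A" using surface by (simp add: oriented_riemannian_surface_def)
  then show ?thesis using assms unfolding oriented_atlas_def by blast
qed

text \<open>Transition maps have positive determinant, so orientation can be tested in one chart
  only, as can orthonormality.\<close>

lemma SO_I:
  assumes c: "c \<in> A" "x \<in> fst c"
    and "mc c (snd c x) a a = 1" "mc c (snd c x) b b = 1" "mc c (snd c x) a b = 0"
    and det: "det2 a b > 0"
  shows "(x, coord_vec A c x a, coord_vec A c x b) \<in> frames"
proof -
  have "det2 (coord_vec A c x a d) (coord_vec A c x b d) > 0" if "d \<in> charts_at A x" for d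
    using that det_matrix_2[OF linear_dtrans, of c d x a b] det_dtrans[OF c(1) _ c(2), of d] c det
    by (simp add: charts_at_iff coord_vec_chart)
  then show ?thesis
    using assms coord_vec_tangent[OF c] in_points[OF c] by (simp add: SO_bundle_def mc_eq[OF c])
qed

lemma SO_D:
  assumes "(x, e1, e2) \<in> frames"
  shows "x \<in> points A" "e1 \<in> tangent_space A x" "e2 \<in> tangent_space A x"
  using assms by (simp_all add: SO_bundle_def)

lemma SO_chart:
  assumes "(x, e1, e2) \<in> frames" and c: "c \<in> A" "x \<in> fst c"
  shows "mc c (snd c x) (e1 c) (e1 c) = 1" "mc c (snd c x) (e2 c) (e2 c) = 1"
    "mc c (snd c x) (e1 c) (e2 c) = 0" "det2 (e1 c) (e2 c) > 0"
  using assms SO_D[OF assms(1)] by (simp_all add: SO_bundle_def h_eq_mc[OF c, symmetric] charts_at_iff)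

lemma SO_relative:
  assumes q: "(x, e1, e2) \<in> frames" and r: "(x, f1, f2) \<in> frames"
  shows "(g x e1 f1)\<^sup>2 + (g x e1 f2)\<^sup>2 = 1" "e1 = lincomb (g x e1 f1) f1 (g x e1 f2) f2"
    "e2 = lincomb (- g x e1 f2) f1 (g x e1 f1) f2"
proof -
  obtain c where c: "c \<in> A" "x \<in> fst c" using points_chart[OF SO_D(1)[OF q]] .
  note d = SO_D[OF q] SO_D[OF r]
  note o = oriented_orthonormal_pair[OF patch[OF c(1)] _ SO_chart[OF q c] SO_chart[OF r c], OF imageI[OF c(2)]]
  show "(g x e1 f1)\<^sup>2 + (g x e1 f2)\<^sup>2 = 1"
    using o(1) d by (simp add: h_eq_mc[OF c])
  show "e1 = lincomb (g x e1 f1) f1 (g x e1 f2) f2"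
    by (rule tangent_eqI[OF d(2) lincomb_tangent[OF d(5,6,1)] c])
      (use o(2) d in \<open>simp add: h_eq_mc[OF c] lincomb_def\<close>)
  show "e2 = lincomb (- g x e1 f2) f1 (g x e1 f1) f2"
    by (rule tangent_eqI[OF d(3) lincomb_tangent[OF d(5,6,1)] c])
      (use o(3) d in \<open>simp add: h_eq_mc[OF c] lincomb_def\<close>)
qed

lemma SO_relative_rot:
  assumes q: "(x, e1, e2) \<in> frames" and r: "(x, f1, f2) \<in> frames"
    and "g x e1 f1 = cos \<theta>" "g x e1 f2 = sin \<theta>"
  shows "(x, e1, e2) = frame_rot \<theta> (x, f1, f2)"
  using SO_relative(2,3)[OF q r] assms(3,4) by (simp add: frame_rot_def)

lemma frame_rot_SO:
  assumes q: "(x, e1, e2) \<in> frames"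
  shows "frame_rot \<theta> (x, e1, e2) \<in> frames"
    and "g x (lincomb (cos \<theta>) e1 (sin \<theta>) e2) e1 = cos \<theta>"
    and "g x (lincomb (cos \<theta>) e1 (sin \<theta>) e2) e2 = sin \<theta>"
proof -
  obtain c where c: "c \<in> A" "x \<in> fst c" using points_chart[OF SO_D(1)[OF q]] .
  note d = SO_D[OF q] and o = SO_chart[OF q c]
  interpret metric_patch "U c" "mc c" by (rule patch[OF c(1)])
  have xU: "snd c x \<in> U c" using c(2) by blast
  note l = lin[OF xU] and s = sym[OF xU]
  have o': "mc c (snd c x) (e2 c) (e1 c) = 0" using o s by metis
  have "frame_rot \<theta> (x, e1, e2) = (x, coord_vec A c x (cos \<theta> *\<^sub>R e1 c + sin \<theta> *\<^sub>R e2 c),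
     coord_vec A c x (- sin \<theta> *\<^sub>R e1 c + cos \<theta> *\<^sub>R e2 c))"
    unfolding frame_rot_def
    using tangent_eq_coord_vec[OF d(2) c] tangent_eq_coord_vec[OF d(3) c] lincomb_coord_vec[OF c]
    by (metis (no_types, lifting) case_prod_conv)
  moreover have "\<dots> \<in> frames"
  proof (rule SO_I[OF c])
    have "det2 (cos \<theta> *\<^sub>R e1 c + sin \<theta> *\<^sub>R e2 c) (- sin \<theta> *\<^sub>R e1 c + cos \<theta> *\<^sub>R e2 c)
      = ((cos \<theta>)\<^sup>2 + (sin \<theta>)\<^sup>2) * det2 (e1 c) (e2 c)"
      unfolding det_vector_2 vector_add_component vector_scaleR_component real_scaleR_def by algebra
    then show "det2 (cos \<theta> *\<^sub>R e1 c + sin \<theta> *\<^sub>R e2 c) (- sin \<theta> *\<^sub>R e1 c + cos \<theta> *\<^sub>R e2 c) > 0"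
      using o(4) by simp
  qed (use sin_cos_squared_add3[of \<theta>] in \<open>simp_all add: l o o' power2_eq_square[symmetric] add.commute\<close>)
  ultimately show "frame_rot \<theta> (x, e1, e2) \<in> frames" by simp
  have "g x e1 e1 = 1" "g x e2 e2 = 1" "g x e1 e2 = 0" using q by (auto simp: SO_bundle_def)
  moreover from this have "g x e2 e1 = 0" using h_sym[OF d] by simp
  ultimately show "g x (lincomb (cos \<theta>) e1 (sin \<theta>) e2) e1 = cos \<theta>"
    "g x (lincomb (cos \<theta>) e1 (sin \<theta>) e2) e2 = sin \<theta>"
    using h_lincomb[OF d(1,2,3)] d by simp_all
qed

text \<open>The chart \<open>c\<close> in which the section is read may differ from the one over
  which \<open>s\<close> is a gauge; on overlaps a section is needed in foreign coordinates as
  well.\<close>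

definition S1 where "S1 c s y = fst (s (chart_inv c y)) c"
definition S2 where "S2 c s y = snd (s (chart_inv c y)) c"

lemma section_SO: "smooth_frame A g V s \<Longrightarrow> x \<in> V \<Longrightarrow> (x, fst (s x), snd (s x)) \<in> frames"
  by (simp add: smooth_frame_def)

lemma section_comps:
  "c \<in> A \<Longrightarrow> x \<in> fst c \<Longrightarrow> S1 c s (snd c x) = fst (s x) c"
  "c \<in> A \<Longrightarrow> x \<in> fst c \<Longrightarrow> S2 c s (snd c x) = snd (s x) c"
  by (simp_all add: S1_def S2_def chart_inv)

lemma smooth_section:
  assumes "smooth_frame A g V s" "d \<in> A"
  shows "smooth_on (snd d ` (fst d \<inter> V)) (S1 d s)" "smooth_on (snd d ` (fst d \<inter> V)) (S2 d s)"
  using assms unfolding smooth_frame_def S1_def[abs_def] S2_def[abs_def] by auto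

lemma frame_patch_section:
  assumes c: "c \<in> A" and s: "gauge c s"
  shows "frame_patch (U c) (mc c) (S1 c s) (S2 c s)"
proof -
  interpret metric_patch "U c" "mc c" by (rule patch[OF c])
  show ?thesis
  proof unfold_locales
    show "smooth_on (U c) (S1 c s)" "smooth_on (U c) (S2 c s)" using smooth_section[OF s c] by simp_all
    fix y assume "y \<in> U c"
    then obtain x where x: "x \<in> fst c" and y: "y = snd c x" by blast
    show "mc c y (S1 c s y) (S1 c s y) = 1" "mc c y (S2 c s y) (S2 c s y) = 1"
      "mc c y (S1 c s y) (S2 c s y) = 0" "det2 (S1 c s y) (S2 c s y) > 0"
      unfolding y section_comps[OF c x] using SO_chart[OF section_SO[OF s x] c x] by simp_all
  qed
qed

lemma section_exists:
  assumes c: "c \<in> A" obtains s where "gauge c s"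
proof -
  obtain T1 T2 where "frame_patch (U c) (mc c) T1 T2" using frame_patch_exists[OF patch[OF c]] .
  then interpret frame_patch "U c" "mc c" T1 T2 .
  define s where "s x = (coord_vec A c x (T1 (snd c x)), coord_vec A c x (T2 (snd c x)))" for x
  \<comment> \<open>Gram-Schmidt gives smoothness in the coordinates of \<open>c\<close>, whereas
    \<open>smooth_frame\<close> asks for it in every chart \<open>d\<close>; the derivative of the
    transition map carries the components over.\<close>
  have "smooth_on (snd d ` (fst d \<inter> fst c)) (\<lambda>y. coord_vec A c (chart_inv d y) (T (snd c (chart_inv d y))) d)"
    if d: "d \<in> A" and T: "smooth_on (U c) T" for d T
  proof (rule smooth_cong[OF open_overlap[OF d c]])
    have "smooth_on (snd c ` (fst c \<inter> fst d)) (\<lambda>z. FD (transition c d) z (T z))"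
      by (rule smooth_linear_family[OF open_overlap[OF c d] _ smooth_coord_vec[OF c d] smooth_subset[OF T]])
        (use linear_dtrans[OF c d] in auto)
    then show "smooth_on (snd d ` (fst d \<inter> fst c))
       (\<lambda>y. FD (transition c d) (transition d c y) (T (transition d c y)))"
      by (rule smooth_compose[OF open_overlap[OF d c] open_overlap[OF c d] smooth_transition[OF d c]])
        (use transition[OF d, of _ c] in auto)
    fix y assume "y \<in> snd d ` (fst d \<inter> fst c)"
    then obtain x where x: "x \<in> fst d" "x \<in> fst c" "y = snd d x" by blast
    then show "FD (transition c d) (transition d c y) (T (transition d c y))
        = coord_vec A c (chart_inv d y) (T (snd c (chart_inv d y))) d"
      using transition[OF d x(1), of c] by (simp add: chart_inv[OF d] coord_vec_chart[OF c d])
  qed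
  moreover have "(x, s x) \<in> frames" if "x \<in> fst c" for x
    unfolding s_def using that unit1 unit2 ortho det_pos by (intro SO_I[OF c]) auto
  ultimately have "gauge c s"
    unfolding smooth_frame_def using smooth_S1 smooth_S2 by (simp add: s_def)
  then show thesis by (rule that)
qed

text \<open>Together with \<open>relY\<close> the cosine and sine of the angle from the section to
  the frame. Unlike the angle they are defined without a choice of branch.\<close>

definition relX where "relX s q = (case q of (x, e1, e2) \<Rightarrow> g x e1 (fst (s x)))"
definition relY where "relY s q = (case q of (x, e1, e2) \<Rightarrow> g x e1 (snd (s x)))"

text \<open>The definite description in \<open>frame_chart\<close> has a unique solution because
  \<open>wrapped_angle\<close> recovers an angle in the given interval from its cosine and
  sine.\<close>

lemma frame_chart_rot:
  assumes c: "c \<in> A" and s: "gauge c s" and x: "x \<in> fst c"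
    and \<theta>: "\<theta> \<in> {a0 - pi <..< a0 + pi}"
  defines "q \<equiv> frame_rot \<theta> (x, s x)"
  shows "q \<in> fst (frame_chart c s a0)" "snd (frame_chart c s a0) q = (snd c x, \<theta>)"
    "fst q = x" "relX s q = cos \<theta>" "relY s q = sin \<theta>"
proof -
  obtain s1 s2 where sx: "s x = (s1, s2)" by fastforce
  have so: "(x, s1, s2) \<in> frames" using section_SO[OF s x] by (simp add: sx)
  show 1: "q \<in> fst (frame_chart c s a0)" using assms by (auto simp: frame_chart_def)
  show f: "fst q = x" by (simp add: q_def frame_rot_def sx)
  have r: "relX s (frame_rot \<theta> (x, s x)) = cos \<theta>" "relY s (frame_rot \<theta> (x, s x)) = sin \<theta>" for \<theta>
    using frame_rot_SO(2,3)[OF so] by (simp_all add: relX_def relY_def frame_rot_def sx)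
  then show "relX s q = cos \<theta>" "relY s q = sin \<theta>" by (simp_all add: q_def)
  have "\<phi> = \<theta>" if "\<phi> \<in> {a0 - pi <..< a0 + pi}" "q = frame_rot \<phi> (x, s x)" for \<phi>
    using wrapped_angle_cos_sin(2)[OF that(1)] wrapped_angle_cos_sin(2)[OF \<theta>] r that(2) unfolding q_def by metis
  then have "(THE \<phi>. \<phi> \<in> {a0 - pi <..< a0 + pi} \<and> q = frame_rot \<phi> (x, s x)) = \<theta>"
    using \<theta> q_def by blast
  then show "snd (frame_chart c s a0) q = (snd c x, \<theta>)" by (simp add: frame_chart_def f)
qed

lemma frame_chart_memD:
  assumes c: "c \<in> A" and s: "gauge c s" and q: "q \<in> fst (frame_chart c s a0)"
  obtains x \<theta> where "x \<in> fst c" "\<theta> \<in> {a0 - pi <..< a0 + pi}" "q = frame_rot \<theta> (x, s x)"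
  using q by (auto simp: frame_chart_def)

text \<open>The frames left out are those on the cut opposite to \<open>a0\<close>, where the cosine
  of the angle difference is -1. Membership becomes the nonvanishing of a continuous function in
  coordinates, from which openness of overlaps follows.\<close>

lemma frame_chart_mem:
  assumes c: "c \<in> A" and s: "gauge c s"
  shows "q \<in> fst (frame_chart c s a0) \<longleftrightarrow> q \<in> frames \<and> fst q \<in> fst c \<and>
     1 + (cos a0 * relX s q + sin a0 * relY s q) \<noteq> 0" (is "_ \<longleftrightarrow> ?R")
proof
  assume "q \<in> fst (frame_chart c s a0)"
  then obtain x \<theta> where x: "x \<in> fst c" "\<theta> \<in> {a0 - pi <..< a0 + pi}" "q = frame_rot \<theta> (x, s x)"
    using frame_chart_memD[OF c s] by metis
  show ?R using frame_chart_rot(3-5)[OF c s x(1,2), folded x(3)] wrapped_angle_cos_sin(1)[OF x(2)]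
      frame_rot_SO(1)[OF section_SO[OF s x(1)]] x by simp
next
  assume R: ?R
  obtain x e1 e2 where q: "q = (x, e1, e2)" by (cases q) auto
  have x: "x \<in> fst c" using R q by simp
  have so: "(x, e1, e2) \<in> frames" "(x, fst (s x), snd (s x)) \<in> frames"
    using R q section_SO[OF s x] by auto
  have "(relX s q)\<^sup>2 + (relY s q)\<^sup>2 = 1" using SO_relative(1)[OF so] by (simp add: relX_def relY_def q)
  then obtain \<theta> where \<theta>: "\<theta> \<in> {a0 - pi <..< a0 + pi}" "relX s q = cos \<theta>" "relY s q = sin \<theta>"
    using angle_exists_around R by metis
  then have "q = frame_rot \<theta> (x, s x)"
    using SO_relative_rot[OF so, of \<theta>] by (simp add: q relX_def relY_def)
  then show "q \<in> fst (frame_chart c s a0)" using frame_chart_rot(1)[OF c s x \<theta>(1)] by simp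
qed

lemma frame_chart_coord:
  assumes c: "c \<in> A" and s: "gauge c s" and q: "q \<in> fst (frame_chart c s a0)"
  shows "snd (frame_chart c s a0) q = (snd c (fst q), wrapped_angle a0 (relX s q) (relY s q))"
proof -
  obtain x \<theta> where x: "x \<in> fst c" "\<theta> \<in> {a0 - pi <..< a0 + pi}" "q = frame_rot \<theta> (x, s x)"
    using frame_chart_memD[OF c s q] by metis
  show ?thesis using frame_chart_rot(2-5)[OF c s x(1,2), folded x(3)] wrapped_angle_cos_sin(2)[OF x(2)] by simp
qed

lemma smooth_wrapped_angle:
  assumes "open S" "smooth_on S X" "smooth_on S Y"
    "\<And>z. z \<in> S \<Longrightarrow> 1 + (cos a0 * X z + sin a0 * Y z) \<noteq> 0"
  shows "smooth_on S (\<lambda>z. wrapped_angle a0 (X z) (Y z))"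
  unfolding wrapped_angle_def
  by (intro smooth_add smooth_mult smooth_arctan smooth_divide smooth_diff smooth_const assms)

section \<open>The atlas of the frame bundle\<close>

abbreviation SO where "SO \<equiv> SO_atlas A g"

lemma SO_atlasD:
  assumes "c' \<in> SO"
  obtains c s a0 where "c \<in> A" "gauge c s" "c' = frame_chart c s a0"
  using assms by (auto simp: SO_atlas_def)

lemma SO_atlasI: "c \<in> A \<Longrightarrow> gauge c s \<Longrightarrow> frame_chart c s a0 \<in> SO"
  unfolding SO_atlas_def by blast

lemma inj_frame_chart:
  assumes c: "c \<in> A" and s: "gauge c s"
  shows "inj_on (snd (frame_chart c s a0)) (fst (frame_chart c s a0))"
proof (rule inj_onI)
  fix q r assume q: "q \<in> fst (frame_chart c s a0)" and r: "r \<in> fst (frame_chart c s a0)"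
    and e: "snd (frame_chart c s a0) q = snd (frame_chart c s a0) r"
  obtain x \<theta> where x: "x \<in> fst c" "\<theta> \<in> {a0 - pi <..< a0 + pi}" "q = frame_rot \<theta> (x, s x)"
    using frame_chart_memD[OF c s q] by metis
  obtain y \<phi> where y: "y \<in> fst c" "\<phi> \<in> {a0 - pi <..< a0 + pi}" "r = frame_rot \<phi> (y, s y)"
    using frame_chart_memD[OF c s r] by metis
  have "snd c x = snd c y" "\<theta> = \<phi>"
    using e frame_chart_rot(2)[OF c s x(1,2)] frame_chart_rot(2)[OF c s y(1,2)] x(3) y(3) by simp_all
  then show "q = r" using inj_onD[OF inj[OF c]] x y by metis
qed

lemma smooth_frame_coeffs:
  assumes c: "c \<in> A" and d: "d \<in> A" and s: "gauge c s" and r: "gauge d r"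
  defines "V \<equiv> snd c ` (fst c \<inter> fst d)"
  assumes "P \<in> {S1, S2}" "Q \<in> {S1, S2}"
  shows "smooth_on V (\<lambda>y. mc c y (P c s y) (Q c r y))"
proof -
  interpret metric_patch "U c" "mc c" by (rule patch[OF c])
  have V: "open V" "V \<subseteq> U c" using open_overlap[OF c d] by (auto simp: V_def)
  note s = smooth_section[OF s c, simplified, THEN smooth_subset, OF V(2)]
    and r = smooth_section[OF r c, folded V_def]
  have "smooth_on V (P c s)" "smooth_on V (Q c r)" using s r assms(6,7) by auto
  then show ?thesis
    by (intro smooth_metric[OF V(1), where p = "\<lambda>y. y"] smooth_ident V(1)) (use V(2) in simp_all)
qed

text \<open>The cosine and sine relative to the second section are combinations of cos and sin of
  the old angle with inner products of the two sections. They are smooth, and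
  \<open>wrapped_angle\<close> turns them into the new angle coordinate.\<close>

lemma frame_chart_overlap:
  fixes s r :: "'a \<Rightarrow> ('a, real^2) tvec \<times> ('a, real^2) tvec" and a0 a1 :: real
  assumes c: "c \<in> A" and d: "d \<in> A" and s: "gauge c s" and r: "gauge d r"
  defines "c' \<equiv> frame_chart c s a0" and "d' \<equiv> frame_chart d r a1"
  shows "open (snd c' ` (fst c' \<inter> fst d'))" "smooth_on (snd c' ` (fst c' \<inter> fst d')) (transition c' d')"
proof -
  define V where "V = snd c ` (fst c \<inter> fst d)"
  define I where "I = {a0 - pi <..< a0 + pi}"
  define X where "X z = cos (snd z) * mc c (fst z) (S1 c s (fst z)) (S1 c r (fst z))
     + sin (snd z) * mc c (fst z) (S2 c s (fst z)) (S1 c r (fst z))" for z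
  define Y where "Y z = cos (snd z) * mc c (fst z) (S1 c s (fst z)) (S2 c r (fst z))
     + sin (snd z) * mc c (fst z) (S2 c s (fst z)) (S2 c r (fst z))" for z
  define N where "N z = 1 + (cos a1 * X z + sin a1 * Y z)" for z
  have VI: "open (V \<times> I)" "open V" using open_overlap[OF c d] by (auto simp: V_def I_def open_Times)
  have f: "smooth_on (V \<times> I) (\<lambda>z. F (fst z))" if "smooth_on V F" for F :: "real^2 \<Rightarrow> real"
    by (rule smooth_compose[OF VI smooth_fst[OF VI(1) smooth_ident[OF VI(1)]] that]) auto
  note m = smooth_frame_coeffs[OF c d s r, folded V_def, THEN f]
  note fc = m[of S1 S1, simplified] m[of S1 S2, simplified] m[of S2 S1, simplified] m[of S2 S2, simplified]
  note sc = smooth_sin_cos[OF VI(1) smooth_snd[OF VI(1) smooth_ident[OF VI(1)]]]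
  have sX: "smooth_on (V \<times> I) X" and sY: "smooth_on (V \<times> I) Y"
    unfolding X_def[abs_def] Y_def[abs_def] by (intro smooth_add smooth_mult fc sc VI)+
  have "continuous_on (V \<times> I) N" unfolding N_def
    by (intro continuous_intros smooth_continuous_on[OF sX] smooth_continuous_on[OF sY])
  then have oD: "open ((V \<times> I) \<inter> N -` (- {0}))"
    by (intro continuous_open_preimage VI) auto
  define D where "D = (V \<times> I) \<inter> N -` (- {0})"
  have inner: "relX r (frame_rot \<theta> (x, s x)) = X (snd c x, \<theta>)" "relY r (frame_rot \<theta> (x, s x)) = Y (snd c x, \<theta>)"
    if x: "x \<in> fst c" "x \<in> fst d" for x \<theta>
  proof -
    obtain s1 s2 where sx: "s x = (s1, s2)" by fastforce
    have t: "s1 \<in> tangent_space A x" "s2 \<in> tangent_space A x" "x \<in> points A"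
      using SO_D[OF section_SO[OF s x(1)]] sx by auto
    note u = SO_D(2,3)[OF section_SO[OF r x(2)]]
    show "relX r (frame_rot \<theta> (x, s x)) = X (snd c x, \<theta>)" "relY r (frame_rot \<theta> (x, s x)) = Y (snd c x, \<theta>)"
      unfolding X_def Y_def fst_conv snd_conv section_comps[OF c x(1)]
      using h_lincomb[OF t(3,1,2)] u t
      by (simp_all add: relX_def relY_def frame_rot_def sx h_eq_mc[OF c x(1)])
  qed
  have mem: "frame_rot \<theta> (x, s x) \<in> fst d' \<longleftrightarrow> x \<in> fst d \<and> N (snd c x, \<theta>) \<noteq> 0"
    and coord: "frame_rot \<theta> (x, s x) \<in> fst d' \<Longrightarrow>
      snd d' (frame_rot \<theta> (x, s x)) = (snd d x, wrapped_angle a1 (X (snd c x, \<theta>)) (Y (snd c x, \<theta>)))"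
    if x: "x \<in> fst c" for x \<theta>
  proof -
    have 1: "frame_rot \<theta> (x, s x) \<in> frames" "fst (frame_rot \<theta> (x, s x)) = x"
      using frame_rot_SO(1)[OF section_SO[OF s x]] by (simp_all add: frame_rot_def split: prod.splits)
    show m: "frame_rot \<theta> (x, s x) \<in> fst d' \<longleftrightarrow> x \<in> fst d \<and> N (snd c x, \<theta>) \<noteq> 0"
      unfolding d'_def frame_chart_mem[OF d r] N_def using 1 inner[OF x] by auto
    show "snd d' (frame_rot \<theta> (x, s x)) = (snd d x, wrapped_angle a1 (X (snd c x, \<theta>)) (Y (snd c x, \<theta>)))"
      if q: "frame_rot \<theta> (x, s x) \<in> fst d'"
    proof -
      have "x \<in> fst d" using q m by blast
      then show ?thesis using frame_chart_coord[OF d r q[unfolded d'_def]] inner[OF x] 1 by (simp add: d'_def)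
    qed
  qed
  have img: "snd c' ` (fst c' \<inter> fst d') = D"
  proof (intro equalityI subsetI)
    fix z assume "z \<in> snd c' ` (fst c' \<inter> fst d')"
    then obtain q where q: "q \<in> fst c'" "q \<in> fst d'" "z = snd c' q" by blast
    obtain x \<theta> where x: "x \<in> fst c" "\<theta> \<in> I" "q = frame_rot \<theta> (x, s x)"
      using frame_chart_memD[OF c s q(1)[unfolded c'_def]] unfolding I_def by metis
    have "z = (snd c x, \<theta>)" using frame_chart_rot(2)[OF c s x(1) x(2)[unfolded I_def]] q x by (simp add: c'_def)
    then show "z \<in> D" using mem[OF x(1), of \<theta>] q x by (auto simp: D_def V_def)
  next
    fix z assume z: "z \<in> D"
    then obtain x \<theta> where x: "z = (snd c x, \<theta>)" "x \<in> fst c" "x \<in> fst d" "\<theta> \<in> I" "N z \<noteq> 0"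
      by (auto simp: D_def V_def)
    note fr = frame_chart_rot[OF c s x(2) x(4)[unfolded I_def], folded c'_def]
    have "frame_rot \<theta> (x, s x) \<in> fst d'" using mem[OF x(2)] x by simp
    then show "z \<in> snd c' ` (fst c' \<inter> fst d')" using fr(1,2) x(1) by (intro image_eqI[of _ _ "frame_rot \<theta> (x, s x)"]) auto
  qed
  show oD': "open (snd c' ` (fst c' \<inter> fst d'))" unfolding img using oD D_def by simp
  show "smooth_on (snd c' ` (fst c' \<inter> fst d')) (transition c' d')"
    unfolding img
  proof (rule smooth_cong)
    show oD: "open D" using oD D_def by simp
    have DV: "D \<subseteq> V \<times> I" by (auto simp: D_def)
    show "smooth_on D (\<lambda>z. (transition c d (fst z), wrapped_angle a1 (X z) (Y z)))"
    proof (intro smooth_Pair oD smooth_wrapped_angle smooth_subset[OF sX DV] smooth_subset[OF sY DV])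
      show "smooth_on D (\<lambda>z. transition c d (fst z))"
        by (rule smooth_compose[OF oD VI(2) smooth_fst[OF oD smooth_ident[OF oD]] smooth_transition[OF c d, folded V_def]])
          (use DV in auto)
      show "1 + (cos a1 * X z + sin a1 * Y z) \<noteq> 0" if "z \<in> D" for z using that by (auto simp: D_def N_def)
    qed
    fix z assume "z \<in> D"
    then obtain q where q: "q \<in> fst c'" "q \<in> fst d'" "z = snd c' q" using img by blast
    obtain x \<theta> where x: "x \<in> fst c" "\<theta> \<in> I" "q = frame_rot \<theta> (x, s x)"
      using frame_chart_memD[OF c s q(1)[unfolded c'_def]] unfolding I_def by metis
    have z: "z = (snd c x, \<theta>)" using frame_chart_rot(2)[OF c s x(1) x(2)[unfolded I_def]] q x by (simp add: c'_def)
    have "chart_inv c' z = q"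
      using inj_frame_chart[OF c s, of a0, folded c'_def] q by (simp add: chart_inv_def)
    then have "transition c' d' z = snd d' q" by (simp add: transition_def)
    also have "\<dots> = (snd d x, wrapped_angle a1 (X z) (Y z))" using coord[OF x(1), of \<theta>] q x(3) z by simp
    finally show "(transition c d (fst z), wrapped_angle a1 (X z) (Y z)) = transition c' d' z"
      using transition[OF c x(1), of d] z by simp
  qed
qed

lemma smooth_atlas_SO: "smooth_atlas SO"
  unfolding smooth_atlas_def
proof (intro conjI ballI)
  show "inj_on (snd c) (fst c)" if "c \<in> SO" for c
    using that by (elim SO_atlasD) (simp add: inj_frame_chart)
  fix c d assume "c \<in> SO" "d \<in> SO"
  then show "open (snd c ` (fst c \<inter> fst d))" "smooth_on (snd c ` (fst c \<inter> fst d)) (transition c d)"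
    by (elim SO_atlasD, simp add: frame_chart_overlap)+
qed

end

sublocale surface \<subseteq> SO: atlas "SO_atlas A g"
  by unfold_locales (rule smooth_atlas_SO)

section \<open>Frames rotating along a curve\<close>

text \<open>Continuation along an interval: the points reached from \<open>t0\<close> form an open
  set with open complement. \<open>Q t\<close> collects the admissible values at \<open>t\<close>.
  Local solvability is required on one neighbourhood for all its points and all their values, so
  that a solution entering the neighbourhood anywhere extends across it.\<close>

lemma glue_local_solutions:
  fixes Sol :: "real set \<Rightarrow> (real \<Rightarrow> 'b) \<Rightarrow> bool" and Q :: "real \<Rightarrow> 'b set"
  assumes I: "open I" "connected I"
    and restrict: "\<And>J J' f. Sol J f \<Longrightarrow> open J' \<Longrightarrow> J' \<subseteq> J \<Longrightarrow> Sol J' f"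
    and local: "\<And>J f. open J \<Longrightarrow> (\<And>t. t \<in> J \<Longrightarrow> \<exists>N. open N \<and> t \<in> N \<and> N \<subseteq> J \<and> Sol N f) \<Longrightarrow> Sol J f"
    and cong: "\<And>J f \<tau>. open J \<Longrightarrow> Sol J f \<Longrightarrow> (\<And>t. t \<in> J \<Longrightarrow> f t = \<tau> t) \<Longrightarrow> Sol J \<tau>"
    and unique: "\<And>J f \<tau> t u. open J \<Longrightarrow> connected J \<Longrightarrow> Sol J f \<Longrightarrow> Sol J \<tau> \<Longrightarrow> t \<in> J \<Longrightarrow>
      f t = \<tau> t \<Longrightarrow> u \<in> J \<Longrightarrow> f u = \<tau> u"
    and range: "\<And>J f t. Sol J f \<Longrightarrow> t \<in> J \<Longrightarrow> f t \<in> Q t"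
    and ex: "\<And>t. t \<in> I \<Longrightarrow> \<exists>N. open N \<and> connected N \<and> t \<in> N \<and> N \<subseteq> I \<and>
      (\<forall>u\<in>N. \<forall>q\<in>Q u. \<exists>f. Sol N f \<and> f u = q)"
    and t0: "t0 \<in> I" "q \<in> Q t0"
  shows "\<exists>f. Sol I f \<and> f t0 = q"
proof -
  define P where "P J f \<longleftrightarrow> open J \<and> connected J \<and> J \<subseteq> I \<and> t0 \<in> J \<and> Sol J f \<and> f t0 = q" for J f
  define R where "R = {t. \<exists>J f. P J f \<and> t \<in> J}"
  have RI: "R \<subseteq> I" by (auto simp: R_def P_def)
  have int: "connected (J \<inter> J')" if "connected J" "connected J'" for J J' :: "real set"
    using that by (metis is_interval_Int is_interval_connected_1)
  have agree: "f t = \<tau> t" if "P J f" "P J' \<tau>" "t \<in> J" "t \<in> J'" for J J' f \<tau> t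
  proof (rule unique[of "J \<inter> J'" f \<tau> t0 t])
    show "open (J \<inter> J')" "connected (J \<inter> J')" "t0 \<in> J \<inter> J'" "f t0 = \<tau> t0" "t \<in> J \<inter> J'"
      using that int by (auto simp: P_def)
    show "Sol (J \<inter> J') f" "Sol (J \<inter> J') \<tau>"
      using that restrict[of J f "J \<inter> J'"] restrict[of J' \<tau> "J \<inter> J'"] by (auto simp: P_def)
  qed
  \<comment> \<open>A solution that reaches one point of \<open>N\<close> is continued over all of
    \<open>N\<close> by the local solution through its value there; uniqueness on the interval of
    overlap makes the two fit.\<close>
  have extend: "N \<subseteq> R" if N: "open N" "connected N" "N \<subseteq> I"
    "\<forall>u\<in>N. \<forall>q\<in>Q u. \<exists>f. Sol N f \<and> f u = q" "t \<in> N" "t \<in> R" for N t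
  proof -
    obtain J f where J: "P J f" "t \<in> J" using \<open>t \<in> R\<close> by (auto simp: R_def)
    have "f t \<in> Q t" using range J by (auto simp: P_def)
    then obtain \<tau> where \<tau>: "Sol N \<tau>" "\<tau> t = f t" using N by blast
    have eq: "f u = \<tau> u" if "u \<in> J" "u \<in> N" for u
    proof (rule unique[of "J \<inter> N" f \<tau> t u])
      show "open (J \<inter> N)" "connected (J \<inter> N)" "t \<in> J \<inter> N" "f t = \<tau> t" "u \<in> J \<inter> N"
        using J N \<tau> that int by (auto simp: P_def)
      show "Sol (J \<inter> N) f" "Sol (J \<inter> N) \<tau>"
        using J N \<tau> restrict[of J f "J \<inter> N"] restrict[of N \<tau> "J \<inter> N"] by (auto simp: P_def)
    qed
    define \<rho> where "\<rho> u = (if u \<in> J then f u else \<tau> u)" for u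
    have "Sol J \<rho>" by (rule cong[of J f]) (use J in \<open>auto simp: P_def \<rho>_def\<close>)
    moreover have "Sol N \<rho>" by (rule cong[OF N(1) \<tau>(1)]) (use eq in \<open>auto simp: \<rho>_def\<close>)
    ultimately have "Sol (J \<union> N) \<rho>"
      by (intro local) (use J N in \<open>auto simp: P_def\<close>)
    moreover have "connected (J \<union> N)" using J N by (intro connected_Un) (auto simp: P_def)
    ultimately have "P (J \<union> N) \<rho>" using J N by (auto simp: P_def \<rho>_def)
    then show "N \<subseteq> R" by (auto simp: R_def)
  qed
  have "open R"
  proof (subst open_subopen, intro ballI)
    fix t assume "t \<in> R"
    then show "\<exists>T. open T \<and> t \<in> T \<and> T \<subseteq> R" unfolding R_def P_def by blast
  qed
  moreover have "open (I - R)"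
  proof (subst open_subopen, intro ballI)
    fix t assume t: "t \<in> I - R"
    then obtain N where N: "open N" "connected N" "t \<in> N" "N \<subseteq> I"
      "\<forall>u\<in>N. \<forall>q\<in>Q u. \<exists>f. Sol N f \<and> f u = q"
      using ex[of t] by (elim DiffE) (metis (no_types))
    then have "N \<inter> R = {}" using extend[OF N(1,2,4,5)] t by blast
    then show "\<exists>T. open T \<and> t \<in> T \<and> T \<subseteq> I - R" using N by blast
  qed
  moreover have "t0 \<in> R"
  proof -
    obtain N where N: "open N" "connected N" "t0 \<in> N" "N \<subseteq> I"
      "\<forall>u\<in>N. \<forall>q\<in>Q u. \<exists>f. Sol N f \<and> f u = q" using ex[OF t0(1)] by blast
    then obtain f where "Sol N f" "f t0 = q" using t0 by blast
    then show ?thesis using N by (auto simp: R_def P_def)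
  qed
  ultimately have "R = I"
    using connectedD[OF I(2), of R "I - R"] RI t0 by blast
  then have "\<forall>t\<in>I. \<exists>J f. P J f \<and> t \<in> J" by (auto simp: R_def)
  then obtain J f where J: "\<And>t. t \<in> I \<Longrightarrow> P (J t) (f t) \<and> t \<in> J t" by metis
  \<comment> \<open>The diagonal of an arbitrary choice of solutions; it is consistent because any
    two agree where both are defined.\<close>
  define \<rho> where "\<rho> t = f t t" for t
  have \<rho>: "\<rho> u = f t u" if "t \<in> I" "u \<in> J t" for t u
  proof -
    have "u \<in> I" using J[OF that(1)] that(2) by (auto simp: P_def)
    then show ?thesis using agree[of "J u" "f u" "J t" "f t" u] J that by (simp add: \<rho>_def)
  qed
  have "Sol I \<rho>"
  proof (rule local[OF I(1)])
    fix t assume t: "t \<in> I"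
    have Jt: "open (J t)" "Sol (J t) (f t)" using J[OF t] unfolding P_def by blast+
    have "Sol (J t) \<rho>" by (rule cong[OF Jt]) (rule \<rho>[OF t, symmetric])
    then show "\<exists>N. open N \<and> t \<in> N \<and> N \<subseteq> I \<and> Sol N \<rho>" using J[OF t] by (auto simp: P_def)
  qed
  moreover have "\<rho> t0 = q" using J[OF t0(1)] by (simp add: \<rho>_def P_def)
  ultimately show ?thesis by blast
qed

section \<open>Lifting curves by rotating frames\<close>

context surface begin

definition E1 :: "'a frame \<Rightarrow> ('a, real^2) tvec" where "E1 q = fst (snd q)"
definition E2 :: "'a frame \<Rightarrow> ('a, real^2) tvec" where "E2 q = snd (snd q)"

lemma frame_eta: "q = (fst q, E1 q, E2 q)"
  by (simp add: E1_def E2_def)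

lemma E_tangent:
  assumes "q \<in> frames"
  shows "E1 q \<in> tangent_space A (fst q)" "E2 q \<in> tangent_space A (fst q)"
  using SO_D[of "fst q" "E1 q" "E2 q"] assms frame_eta by simp_all

lemma rel_comps:
  assumes "q \<in> frames" "c \<in> A" "gauge c s" "fst q \<in> fst c"
  shows "relX s q = mc c (snd c (fst q)) (E1 q c) (S1 c s (snd c (fst q)))"
    "relY s q = mc c (snd c (fst q)) (E1 q c) (S2 c s (snd c (fst q)))"
proof -
  have "relX s q = g (fst q) (E1 q) (fst (s (fst q)))" "relY s q = g (fst q) (E1 q) (snd (s (fst q)))"
    by (cases q; simp add: relX_def relY_def E1_def)+
  then show "relX s q = mc c (snd c (fst q)) (E1 q c) (S1 c s (snd c (fst q)))"
    "relY s q = mc c (snd c (fst q)) (E1 q c) (S2 c s (snd c (fst q)))"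
    using E_tangent[OF assms(1)] SO_D[OF section_SO[OF assms(3,4)]] assms(2,4)
    by (simp_all add: section_comps h_eq_mc)
qed

lemma smooth_curve_chart_at:
  assumes "smooth_curve A J \<gamma>" "t \<in> J" obtains c where "c \<in> A" "\<gamma> t \<in> fst c"
proof (rule points_chart)
  show "\<gamma> t \<in> points A" using assms unfolding smooth_curve_def by blast
qed

text \<open>Bundle coordinates depend on an oriented frame only through its base point and its first
  vector, so smoothness of these two suffices.\<close>

lemma smooth_curve_SO:
  assumes \<gamma>: "smooth_curve A J \<gamma>" and f: "\<And>t. t \<in> J \<Longrightarrow> f t \<in> frames" "\<And>t. t \<in> J \<Longrightarrow> fst (f t) = \<gamma> t"
    and E: "\<And>c. c \<in> A \<Longrightarrow> smooth_on {t\<in>J. \<gamma> t \<in> fst c} (\<lambda>t. E1 (f t) c)"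
  shows "smooth_curve SO J f"
  unfolding smooth_curve_def
proof (intro conjI ballI)
  show "open J" using \<gamma> by (simp add: smooth_curve_def)
  show "f ` J \<subseteq> points SO"
  proof (intro image_subsetI)
    fix t assume t: "t \<in> J"
    obtain c where c: "c \<in> A" "\<gamma> t \<in> fst c"
      using smooth_curve_chart_at[OF \<gamma> t] .
    obtain s where s: "gauge c s" using section_exists[OF c(1)] .
    \<comment> \<open>Every frame avoids the cut of at least one of the two charts centred at 0 and
      at pi.\<close>
    obtain a0 where "1 + (cos a0 * relX s (f t) + sin a0 * relY s (f t)) \<noteq> 0"
    proof (cases "1 + relX s (f t) = 0")
      case True then show ?thesis using that[of pi] by simp
    next
      case False then show ?thesis using that[of 0] by simp
    qed
    then have "f t \<in> fst (frame_chart c s a0)" using frame_chart_mem[OF c(1) s] f[OF t] c by simp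
    then show "f t \<in> points SO" using in_points[OF SO_atlasI[OF c(1) s]] by blast
  qed
  fix c' assume "c' \<in> SO"
  then obtain c s a0 where c: "c \<in> A" and s: "gauge c s" and c': "c' = frame_chart c s a0"
    by (rule SO_atlasD)
  interpret metric_patch "U c" "mc c" by (rule patch[OF c])
  define N where "N = {t\<in>J. \<gamma> t \<in> fst c}"
  have N: "open N" and x: "smooth_on N (\<lambda>t. snd c (\<gamma> t))"
    using smooth_curve_chart[OF \<gamma> c] by (auto simp: N_def)
  define X Y where "X t = mc c (snd c (\<gamma> t)) (E1 (f t) c) (S1 c s (snd c (\<gamma> t)))"
    and "Y t = mc c (snd c (\<gamma> t)) (E1 (f t) c) (S2 c s (snd c (\<gamma> t)))" for t
  have XY: "relX s (f t) = X t" "relY s (f t) = Y t" if "t \<in> N" for t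
    using rel_comps[OF f(1) c s, of t] f(2)[of t] that by (auto simp: N_def X_def Y_def)
  have xN: "(\<lambda>t. snd c (\<gamma> t)) ` N \<subseteq> U c" by (auto simp: N_def)
  have S: "smooth_on N (\<lambda>t. S1 c s (snd c (\<gamma> t)))" "smooth_on N (\<lambda>t. S2 c s (snd c (\<gamma> t)))"
    using smooth_section[OF s c] by (auto intro!: smooth_compose[OF N open_U x _ xN])
  have sX: "smooth_on N X" and sY: "smooth_on N Y"
    unfolding X_def[abs_def] Y_def[abs_def]
    by (intro smooth_metric[OF N xN x] E[OF c, folded N_def] S)+
  define F where "F t = 1 + (cos a0 * X t + sin a0 * Y t)" for t
  have "continuous_on N F" unfolding F_def
    by (intro continuous_intros smooth_continuous_on[OF sX] smooth_continuous_on[OF sY])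
  then have oD: "open (N \<inter> F -` (- {0}))"
    by (intro continuous_open_preimage N) auto
  have D: "{t \<in> J. f t \<in> fst c'} = N \<inter> F -` (- {0})"
  proof (intro set_eqI)
    fix t
    show "t \<in> {t \<in> J. f t \<in> fst c'} \<longleftrightarrow> t \<in> N \<inter> F -` (- {0})"
    proof (cases "t \<in> N")
      case True
      then show ?thesis using f[of t] XY[OF True] unfolding c' frame_chart_mem[OF c s] by (auto simp: N_def F_def)
    next
      case False
      then show ?thesis using f[of t] unfolding c' frame_chart_mem[OF c s] by (auto simp: N_def)
    qed
  qed
  show "open {t \<in> J. f t \<in> fst c'}" using oD D by simp
  show "smooth_on {t \<in> J. f t \<in> fst c'} (\<lambda>t. snd c' (f t))"
    unfolding D
  proof (rule smooth_cong[OF oD])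
    have DN: "N \<inter> F -` (- {0}) \<subseteq> N" by auto
    show "smooth_on (N \<inter> F -` (- {0})) (\<lambda>t. (snd c (\<gamma> t), wrapped_angle a0 (X t) (Y t)))"
      by (intro smooth_Pair smooth_wrapped_angle oD smooth_subset[OF x DN] smooth_subset[OF sX DN] smooth_subset[OF sY DN])
        (auto simp: F_def)
    fix t assume t: "t \<in> N \<inter> F -` (- {0})"
    then have "f t \<in> fst c'" "t \<in> J" using D by auto
    then show "(snd c (\<gamma> t), wrapped_angle a0 (X t) (Y t)) = snd c' (f t)"
      using frame_chart_coord[OF c s] XY[of t] t f(2)[of t] c' by simp
  qed
qed

text \<open>Stronger than an equation for \<open>cov_deriv_along\<close>, whose
  \<open>vector_derivative\<close> does not assert differentiability. Here \<open>F\<close> is a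
  component in \<open>c\<close>, not a tangent vector.\<close>

abbreviation has_cov_deriv where
  "has_cov_deriv c \<gamma> E F t \<equiv> ((\<lambda>s. E s c) has_vector_derivative
     F - christoffel (mc c) (snd c (\<gamma> t)) (velocity A \<gamma> t c) (E t c)) (at t)"

text \<open>The case \<open>\<beta> = 0\<close> gives parallel frames, constant \<open>\<gamma>\<close> with \<open>\<beta> = 1\<close> the rotation of a frame in its
  fibre, and \<open>\<beta> = C K\<^sup>2\<close> the lift of the theorem.\<close>

definition rotating_frame_along :: "(real \<Rightarrow> real) \<Rightarrow> (real \<Rightarrow> 'a) \<Rightarrow> real set \<Rightarrow> (real \<Rightarrow> 'a frame) \<Rightarrow> bool" where
  "rotating_frame_along \<beta> \<gamma> J f \<longleftrightarrow>
     (\<forall>t\<in>J. f t \<in> frames \<and> fst (f t) = \<gamma> t) \<and>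
     (\<forall>c\<in>A. smooth_on {t\<in>J. \<gamma> t \<in> fst c} (\<lambda>t. E1 (f t) c) \<and>
       smooth_on {t\<in>J. \<gamma> t \<in> fst c} (\<lambda>t. E2 (f t) c)) \<and>
     (\<forall>t\<in>J. \<forall>c\<in>A. \<gamma> t \<in> fst c \<longrightarrow>
       has_cov_deriv c \<gamma> (\<lambda>s. E1 (f s)) (\<beta> t *\<^sub>R E2 (f t) c) t \<and>
       has_cov_deriv c \<gamma> (\<lambda>s. E2 (f s)) (- \<beta> t *\<^sub>R E1 (f t) c) t)"

lemma rotating_frame_smooth_curve:
  "rotating_frame_along \<beta> \<gamma> J f \<Longrightarrow> smooth_curve A J \<gamma> \<Longrightarrow> smooth_curve SO J f"
  unfolding rotating_frame_along_def by (rule smooth_curve_SO) auto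

abbreviation conn where "conn c s \<equiv> frame_patch.om (mc c) (S1 c s) (S2 c s)"

lemma frame_rot_comps:
  assumes "q = frame_rot \<theta> (x, s x)" "c \<in> A" "x \<in> fst c"
  shows "E1 q c = cos \<theta> *\<^sub>R S1 c s (snd c x) + sin \<theta> *\<^sub>R S2 c s (snd c x)"
    "E2 q c = - sin \<theta> *\<^sub>R S1 c s (snd c x) + cos \<theta> *\<^sub>R S2 c s (snd c x)"
  using assms by (simp_all add: frame_rot_def E1_def E2_def lincomb_def section_comps split: prod.splits)

text \<open>The covariant condition and the angle coordinate give two expressions for the derivative
  of \<open>E1\<close>; comparing the coefficients of \<open>E2\<close>, which is nonzero, yields
  the speed of the angle. One computation thus covers horizontal vectors, the fibre direction and
  the lifted curve.\<close>

lemma rotating_frame_velocity: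
  assumes F: "rotating_frame_along \<beta> \<gamma> J f" and \<gamma>: "smooth_curve A J \<gamma>" and t: "t \<in> J"
    and c: "c \<in> A" and s: "gauge c s" and q: "f t \<in> fst (frame_chart c s a0)"
  shows "velocity SO f t (frame_chart c s a0)
    = (velocity A \<gamma> t c, \<beta> t - conn c s (snd c (\<gamma> t)) (velocity A \<gamma> t c))"
proof -
  let ?c = "frame_chart c s a0"
  have c': "?c \<in> SO" by (rule SO_atlasI[OF c s])
  interpret frame_patch "U c" "mc c" "S1 c s" "S2 c s" by (rule frame_patch_section[OF c s])
  note f = rotating_frame_smooth_curve[OF F \<gamma>]
  note hv = SO.has_velocity[OF f t c' q]
  define D where "D = {t \<in> J. f t \<in> fst ?c}"
  have D: "open D" "t \<in> D" using SO.smooth_curve_chart(1)[OF f c'] t q by (auto simp: D_def)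
  have base: "fst (f u) = \<gamma> u" "\<gamma> u \<in> fst c" "f u = frame_rot (snd (snd ?c (f u))) (\<gamma> u, s (\<gamma> u))" "fst (snd ?c (f u)) = snd c (\<gamma> u)"
    if u: "u \<in> D" for u
  proof -
    show pf: "fst (f u) = \<gamma> u" using F u by (auto simp: rotating_frame_along_def D_def)
    obtain x \<theta> where x: "x \<in> fst c" "\<theta> \<in> {a0 - pi <..< a0 + pi}" "f u = frame_rot \<theta> (x, s x)"
      using frame_chart_memD[OF c s, of "f u" a0] u unfolding D_def by blast
    note r = frame_chart_rot[OF c s x(1,2), folded x(3)]
    show "\<gamma> u \<in> fst c" "f u = frame_rot (snd (snd ?c (f u))) (\<gamma> u, s (\<gamma> u))" "fst (snd ?c (f u)) = snd c (\<gamma> u)"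
      using r pf x by auto
  qed
  define v where "v = velocity A \<gamma> t c"
  have "((\<lambda>u. fst (snd ?c (f u))) has_vector_derivative fst (velocity SO f t ?c)) (at t)"
    by (rule bounded_linear.has_vector_derivative[OF bounded_linear_fst hv])
  then have "((\<lambda>u. snd c (\<gamma> u)) has_vector_derivative fst (velocity SO f t ?c)) (at t)"
    by (rule has_vector_derivative_transform_within_open[OF _ D]) (use base in auto)
  then have 1: "fst (velocity SO f t ?c) = v"
    unfolding v_def by (rule velocity_eqI[where \<sigma> = \<gamma>, OF _ c base(2)[OF D(2)], symmetric])
  define th where "th u = snd (snd ?c (f u))" for u
  define d where "d = snd (velocity SO f t ?c)"
  have th: "(th has_vector_derivative d) (at t)"
    unfolding th_def[abs_def] d_def by (rule bounded_linear.has_vector_derivative[OF bounded_linear_snd hv])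
  have comps: "E1 (f u) c = cos (th u) *\<^sub>R S1 c s (snd c (\<gamma> u)) + sin (th u) *\<^sub>R S2 c s (snd c (\<gamma> u))"
    "E2 (f u) c = - sin (th u) *\<^sub>R S1 c s (snd c (\<gamma> u)) + cos (th u) *\<^sub>R S2 c s (snd c (\<gamma> u))" if "u \<in> D" for u
    using frame_rot_comps[where s = s and x = "\<gamma> u" and q = "f u", OF base(3)[OF that] c base(2)[OF that]] by (simp_all add: th_def)
  have xt: "snd c (\<gamma> t) \<in> U c" using base(2)[OF D(2)] by blast
  have "((\<lambda>u. snd c (\<gamma> u)) has_vector_derivative v) (at t)"
    using has_velocity[OF \<gamma> t c base(2)[OF D(2)]] by (simp add: v_def)
  from rotating_frame(1)[OF xt this th]
  have "((\<lambda>u. E1 (f u) c) has_vector_derivative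
    (d + om (snd c (\<gamma> t)) v) *\<^sub>R E2 (f t) c - christoffel (mc c) (snd c (\<gamma> t)) v (E1 (f t) c)) (at t)"
    unfolding comps[OF D(2), symmetric]
    by (rule has_vector_derivative_transform_within_open[OF _ D]) (use comps in auto)
  moreover have "((\<lambda>u. E1 (f u) c) has_vector_derivative
    \<beta> t *\<^sub>R E2 (f t) c - christoffel (mc c) (snd c (\<gamma> t)) v (E1 (f t) c)) (at t)"
    using F t c base(2)[OF D(2)] by (simp add: rotating_frame_along_def v_def)
  ultimately have "(d + om (snd c (\<gamma> t)) v) *\<^sub>R E2 (f t) c = \<beta> t *\<^sub>R E2 (f t) c"
    using vector_derivative_unique_at by fastforce
  moreover have "E2 (f t) c \<noteq> 0"
  proof
    assume "E2 (f t) c = 0"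
    moreover have "(fst (f t), E1 (f t), E2 (f t)) \<in> frames"
      using F t frame_eta[of "f t"] by (simp add: rotating_frame_along_def)
    ultimately show False
      using SO_chart(2)[of "fst (f t)" "E1 (f t)" "E2 (f t)" c] c base(1,2)[OF D(2)] lin(9)[OF xt] by simp
  qed
  ultimately have "d = \<beta> t - om (snd c (\<gamma> t)) v" by simp
  then show ?thesis using 1 by (simp add: prod_eq_iff v_def d_def)
qed

lemma smooth_antiderivative:
  fixes f :: "real \<Rightarrow> real"
  assumes "smooth_on {l<..<r} f" "t0 \<in> {l<..<r}"
  obtains F where "\<And>t. t \<in> {l<..<r} \<Longrightarrow> (F has_vector_derivative f t) (at t)" "smooth_on {l<..<r} F" "F t0 = \<phi>"
proof -
  have "isCont f t" if "l < t" "t < r" for t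
    using smooth_continuous_on[OF assms(1)] that continuous_on_eq_continuous_at[of "{l<..<r}" f] by auto
  then obtain F where F: "\<And>t. l < t \<Longrightarrow> t < r \<Longrightarrow> (F has_vector_derivative f t) (at t)"
    using einterval_antiderivative[of "ereal l" "ereal r" f] assms(2) by auto
  let ?F = "\<lambda>t. F t - F t0 + \<phi>"
  have d: "(?F has_vector_derivative f t) (at t)" if "t \<in> {l<..<r}" for t
    using F[of t] that by (auto intro!: derivative_eq_intros)
  show thesis by (rule that[of ?F]) (use d smooth_on_realI[OF _ d assms(1)] in auto)
qed

text \<open>The right-hand side of the angle equation does not contain the angle, so an
  antiderivative solves it on the whole interval; its initial value is any angle that represents
  \<open>q\<close> in the section.\<close>

lemma rotating_frame_local:
  fixes l r :: real and \<gamma> :: "real \<Rightarrow> 'a"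
  defines "J \<equiv> {l<..<r}"
  assumes \<gamma>: "smooth_curve A J \<gamma>" and c: "c \<in> A" and J: "\<gamma> ` J \<subseteq> fst c" and \<beta>: "smooth_on J \<beta>"
    and t0: "t0 \<in> J" and q: "q \<in> frames" "fst q = \<gamma> t0"
  obtains f where "rotating_frame_along \<beta> \<gamma> J f" "f t0 = q" "\<And>t. fst (f t) = \<gamma> t"
proof -
  obtain s where s: "gauge c s" using section_exists[OF c] .
  interpret frame_patch "U c" "mc c" "S1 c s" "S2 c s" by (rule frame_patch_section[OF c s])
  have JN: "{t \<in> J. \<gamma> t \<in> fst c} = J" using J by blast
  have oJ: "open J" by (simp add: J_def)
  note x = smooth_curve_chart[OF \<gamma> c, unfolded JN]
  have xU: "snd c (\<gamma> t) \<in> U c" if "t \<in> J" for t using J that by blast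
  have so0: "(\<gamma> t0, fst (s (\<gamma> t0)), snd (s (\<gamma> t0))) \<in> frames" using section_SO[OF s] J t0 by blast
  have q': "q = (\<gamma> t0, E1 q, E2 q)" using frame_eta[of q] q(2) by simp
  obtain \<phi> where \<phi>: "q = frame_rot \<phi> (\<gamma> t0, s (\<gamma> t0))"
  proof -
    have so: "(\<gamma> t0, E1 q, E2 q) \<in> frames" using q q' by simp
    obtain \<phi> where "g (\<gamma> t0) (E1 q) (fst (s (\<gamma> t0))) = cos \<phi>" "g (\<gamma> t0) (E1 q) (snd (s (\<gamma> t0))) = sin \<phi>"
      using sincos_total_2pi[OF SO_relative(1)[OF so so0]] by metis
    from SO_relative_rot[OF so so0 this] show thesis using that q' by simp
  qed
  have "smooth_on J (\<lambda>t. om (snd c (\<gamma> t)) (velocity A \<gamma> t c))"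
    by (rule smooth_linear_family[OF oJ linear_om[OF xU] _ x(3)], assumption,
        rule smooth_compose[OF oJ open_U x(2) smooth_om]) (use xU in blast)
  then have "smooth_on J (\<lambda>t. \<beta> t - om (snd c (\<gamma> t)) (velocity A \<gamma> t c))"
    by (intro smooth_diff oJ \<beta>)
  then obtain \<theta> where \<theta>: "\<And>t. t \<in> J \<Longrightarrow> (\<theta> has_vector_derivative \<beta> t - om (snd c (\<gamma> t)) (velocity A \<gamma> t c)) (at t)"
    "smooth_on J \<theta>" "\<theta> t0 = \<phi>"
    using smooth_antiderivative[of l r "\<lambda>t. \<beta> t - om (snd c (\<gamma> t)) (velocity A \<gamma> t c)" t0 \<phi>, folded J_def] t0
    by blast
  define f where "f t = frame_rot (\<theta> t) (\<gamma> t, s (\<gamma> t))" for t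
  \<comment> \<open>Valid for every real \<open>t\<close>, not only in \<open>J\<close>: for
    horizontal vectors the projected curve is identified with \<gamma> as a function.\<close>
  have fs: "fst (f t) = \<gamma> t" for t by (simp add: f_def frame_rot_def split: prod.splits)
  have SO: "f t \<in> frames" if "t \<in> J" for t
    using frame_rot_SO(1)[OF section_SO[OF s, of "\<gamma> t"]] J that by (auto simp: f_def)
  have E: "E1 (f t) d = cos (\<theta> t) *\<^sub>R S1 d s (snd d (\<gamma> t)) + sin (\<theta> t) *\<^sub>R S2 d s (snd d (\<gamma> t))"
    "E2 (f t) d = - sin (\<theta> t) *\<^sub>R S1 d s (snd d (\<gamma> t)) + cos (\<theta> t) *\<^sub>R S2 d s (snd d (\<gamma> t))"
    if "d \<in> A" "\<gamma> t \<in> fst d" for t d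
    using frame_rot_comps[where s = s and x = "\<gamma> t" and q = "f t", OF f_def that] by simp_all
  have sm: "smooth_on {t\<in>J. \<gamma> t \<in> fst d} (\<lambda>t. E1 (f t) d) \<and> smooth_on {t\<in>J. \<gamma> t \<in> fst d} (\<lambda>t. E2 (f t) d)"
    if d: "d \<in> A" for d
  proof -
    define N where "N = {t\<in>J. \<gamma> t \<in> fst d}"
    note N = smooth_curve_chart(1,2)[OF \<gamma> d, folded N_def]
    have img: "(\<lambda>t. snd d (\<gamma> t)) ` N \<subseteq> snd d ` (fst d \<inter> fst c)" using J by (auto simp: N_def)
    note S = smooth_section[OF s d, THEN smooth_compose[OF N(1) open_overlap[OF d c] N(2)], OF img]
    have th: "smooth_on N \<theta>" by (rule smooth_subset[OF \<theta>(2)]) (auto simp: N_def)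
    note sc = smooth_sin_cos[OF N(1) th]
    have "smooth_on N (\<lambda>t. cos (\<theta> t) *\<^sub>R S1 d s (snd d (\<gamma> t)) + sin (\<theta> t) *\<^sub>R S2 d s (snd d (\<gamma> t)))"
      "smooth_on N (\<lambda>t. - sin (\<theta> t) *\<^sub>R S1 d s (snd d (\<gamma> t)) + cos (\<theta> t) *\<^sub>R S2 d s (snd d (\<gamma> t)))"
      by (intro smooth_add smooth_scaleR smooth_minus N(1) S sc)+
    note sm = this
    have "smooth_on N (\<lambda>t. E1 (f t) d)"
      by (rule smooth_cong[OF N(1) _ sm(1)]) (simp add: E[OF d] N_def)
    moreover have "smooth_on N (\<lambda>t. E2 (f t) d)"
      by (rule smooth_cong[OF N(1) _ sm(2)]) (simp add: E[OF d] N_def)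
    ultimately show ?thesis by (simp add: N_def)
  qed
  have ode_c: "has_cov_deriv c \<gamma> (\<lambda>s. E1 (f s)) (\<beta> t *\<^sub>R E2 (f t) c) t"
      "has_cov_deriv c \<gamma> (\<lambda>s. E2 (f s)) (- \<beta> t *\<^sub>R E1 (f t) c) t"
    if t: "t \<in> J" for t
  proof -
    have v: "((\<lambda>t. snd c (\<gamma> t)) has_vector_derivative velocity A \<gamma> t c) (at t)"
      using has_velocity[OF \<gamma> t c] J t by blast
    have Et: "E1 (f u) c = cos (\<theta> u) *\<^sub>R S1 c s (snd c (\<gamma> u)) + sin (\<theta> u) *\<^sub>R S2 c s (snd c (\<gamma> u))"
      "E2 (f u) c = - sin (\<theta> u) *\<^sub>R S1 c s (snd c (\<gamma> u)) + cos (\<theta> u) *\<^sub>R S2 c s (snd c (\<gamma> u))" if "u \<in> J" for u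
      using E[OF c] J that by blast+
    note r = rotating_frame[OF xU[OF t] v \<theta>(1)[OF t], folded Et[OF t], simplified]
    show "has_cov_deriv c \<gamma> (\<lambda>s. E1 (f s)) (\<beta> t *\<^sub>R E2 (f t) c) t"
      by (rule has_vector_derivative_transform_within_open[OF r(1) oJ t]) (simp add: Et)
    show "has_cov_deriv c \<gamma> (\<lambda>s. E2 (f s)) (- \<beta> t *\<^sub>R E1 (f t) c) t"
      unfolding scaleR_minus_left
      by (rule has_vector_derivative_transform_within_open[OF r(2) oJ t]) (simp add: Et)
  qed
  have T: "E1 (f t) \<in> tangent_space A (\<gamma> t)" "E2 (f t) \<in> tangent_space A (\<gamma> t)" if "t \<in> J" for t
    using E_tangent[OF SO[OF that]] fs by simp_all
  have "rotating_frame_along \<beta> \<gamma> J f"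
    unfolding rotating_frame_along_def
  proof (intro conjI ballI impI)
    fix t d assume t: "t \<in> J" and d: "d \<in> A" "\<gamma> t \<in> fst d"
    have cx: "\<gamma> t \<in> fst c" and pts: "\<gamma> ` J \<subseteq> points A" "\<gamma> t \<in> points A" using J t in_points[OF c] by blast+
    \<comment> \<open>The prescribed derivatives as tangent vectors; the coefficient 0 merely writes
      a scalar multiple in the form of \<open>lincomb\<close>.\<close>
    note l1 = lincomb_tangent[OF T(2)[OF t] T(2)[OF t] pts(2), of "\<beta> t" 0]
      and l2 = lincomb_tangent[OF T(1)[OF t] T(1)[OF t] pts(2), of "- \<beta> t" 0]
    show "has_cov_deriv d \<gamma> (\<lambda>s. E1 (f s)) (\<beta> t *\<^sub>R E2 (f t) d) t"
      using cov_deriv_change_chart[OF \<gamma> t pts(1) T(1) c cx d _ l1] ode_c(1)[OF t] by (simp add: lincomb_def)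
    show "has_cov_deriv d \<gamma> (\<lambda>s. E2 (f s)) (- \<beta> t *\<^sub>R E1 (f t) d) t"
      using cov_deriv_change_chart[OF \<gamma> t pts(1) T(2) c cx d _ l2] ode_c(2)[OF t] by (simp add: lincomb_def)
  qed (use SO fs sm in auto)
  then show thesis using that[of f] fs \<phi> \<theta>(3) by (simp add: f_def)
qed

text \<open>The inner product \<open>X\<close> of the two first vectors is the cosine of the angle
  between the frames. Both turn at the same rate \<beta>, so its derivative vanishes; it is 1 at
  \<open>t\<close>, hence everywhere, and then the relative rotation is trivial.\<close>

lemma rotating_frame_unique:
  assumes \<gamma>: "smooth_curve A I \<gamma>" and J: "open J" "connected J" "J \<subseteq> I"
    and F: "rotating_frame_along \<beta> \<gamma> J f" and F': "rotating_frame_along \<beta> \<gamma> J \<tau>"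
    and t: "t \<in> J" "f t = \<tau> t" and u: "u \<in> J"
  shows "f u = \<tau> u"
proof -
  have SO: "(\<gamma> v, E1 (f v), E2 (f v)) \<in> frames" "(\<gamma> v, E1 (\<tau> v), E2 (\<tau> v)) \<in> frames"
    and eta: "f v = (\<gamma> v, E1 (f v), E2 (f v))" "\<tau> v = (\<gamma> v, E1 (\<tau> v), E2 (\<tau> v))" if "v \<in> J" for v
    using F F' that frame_eta[of "f v"] frame_eta[of "\<tau> v"] by (simp_all add: rotating_frame_along_def)
  note \<gamma>J = smooth_curve_restrict[OF \<gamma> J(1,3)]
  define X where "X v = g (\<gamma> v) (E1 (f v)) (E1 (\<tau> v))" for v
  have "(X has_derivative (\<lambda>_. 0)) (at v)" if v: "v \<in> J" for v
  proof -
    obtain c where c: "c \<in> A" "\<gamma> v \<in> fst c" using points_chart[OF SO_D(1)[OF SO(1)[OF v]]] .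
    interpret metric_patch "U c" "mc c" by (rule patch[OF c(1)])
    define N where "N = {t\<in>J. \<gamma> t \<in> fst c}"
    have N: "open N" "v \<in> N" "(\<lambda>t. snd c (\<gamma> t)) ` N \<subseteq> U c"
      using smooth_curve_chart(1)[OF \<gamma>J c(1)] v c by (auto simp: N_def)
    have x: "snd c (\<gamma> v) \<in> U c" using c by blast
    note T = SO_D(2,3)[OF SO(1)[OF v]] SO_D(2,3)[OF SO(2)[OF v]]
    have d: "has_cov_deriv c \<gamma> (\<lambda>s. E1 (f s)) (\<beta> v *\<^sub>R E2 (f v) c) v"
      "has_cov_deriv c \<gamma> (\<lambda>s. E1 (\<tau> s)) (\<beta> v *\<^sub>R E2 (\<tau> v) c) v"
      using F F' v c by (auto simp: rotating_frame_along_def)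
    let ?\<Gamma> = "christoffel (mc c) (snd c (\<gamma> v))"
    have s: "h *\<^sub>R (\<beta> v *\<^sub>R a - ?\<Gamma> w b) + ?\<Gamma> (h *\<^sub>R w) b = (h * \<beta> v) *\<^sub>R a" for h a b w
      by (simp add: clin[OF x] scaleR_diff_right)
    have "((\<lambda>t. mc c (snd c (\<gamma> t)) (E1 (f t) c) (E1 (\<tau> t) c)) has_derivative
       (\<lambda>h. mc c (snd c (\<gamma> v)) (h *\<^sub>R (\<beta> v *\<^sub>R E2 (f v) c - ?\<Gamma> (velocity A \<gamma> v c) (E1 (f v) c)) + ?\<Gamma> (h *\<^sub>R velocity A \<gamma> v c) (E1 (f v) c)) (E1 (\<tau> v) c)
        + mc c (snd c (\<gamma> v)) (E1 (f v) c) (h *\<^sub>R (\<beta> v *\<^sub>R E2 (\<tau> v) c - ?\<Gamma> (velocity A \<gamma> v c) (E1 (\<tau> v) c)) + ?\<Gamma> (h *\<^sub>R velocity A \<gamma> v c) (E1 (\<tau> v) c)))) (at v)"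
      using d has_velocity[OF \<gamma>J v c] unfolding has_vector_derivative_def
      by (intro metric_product_rule[OF N]) auto
    \<comment> \<open>The two products are minus the sine and the sine of the relative
      angle.\<close>
    moreover have "mc c (snd c (\<gamma> v)) (E2 (f v) c) (E1 (\<tau> v) c) + mc c (snd c (\<gamma> v)) (E1 (f v) c) (E2 (\<tau> v) c) = 0"
    proof -
      have \<tau>: "g (\<gamma> v) (E1 (\<tau> v)) (E1 (\<tau> v)) = 1" "g (\<gamma> v) (E1 (\<tau> v)) (E2 (\<tau> v)) = 0"
        using SO(2)[OF v] by (simp_all add: SO_bundle_def)
      have "g (\<gamma> v) (E2 (f v)) (E1 (\<tau> v)) = - g (\<gamma> v) (E1 (f v)) (E2 (\<tau> v))"
        by (subst SO_relative(3)[OF SO(1,2)[OF v]])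
          (use h_lincomb[OF SO_D(1)[OF SO(1)[OF v]] T(3,4,3)] \<tau> h_sym[OF SO_D(1)[OF SO(1)[OF v]] T(4,3)] in simp)
      then show ?thesis using T by (simp add: h_eq_mc[OF c])
    qed
    ultimately have "((\<lambda>t. mc c (snd c (\<gamma> t)) (E1 (f t) c) (E1 (\<tau> t) c)) has_derivative (\<lambda>_. 0)) (at v)"
      unfolding s by (simp add: lin[OF x] distrib_left[symmetric])
    then show ?thesis
      by (rule has_derivative_transform_within_open[OF _ N(1,2)])
        (use SO_D(2)[OF SO(1)] SO_D(2)[OF SO(2)] c in \<open>simp add: N_def X_def h_eq_mc\<close>)
  qed
  then have k: "X u = X t"
    using has_derivative_zero_unique_connected[OF J(1,2)] t(1) u by blast
  have "X t = 1" using SO(2)[OF t(1)] t(2) by (simp add: X_def SO_bundle_def)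
  then have Xu: "g (\<gamma> u) (E1 (f u)) (E1 (\<tau> u)) = 1" using k by (simp add: X_def)
  then have "g (\<gamma> u) (E1 (f u)) (E2 (\<tau> u)) = 0" using SO_relative(1)[OF SO(1,2)[OF u]] by simp
  then have "(\<gamma> u, E1 (f u), E2 (f u)) = frame_rot 0 (\<gamma> u, E1 (\<tau> u), E2 (\<tau> u))"
    using Xu by (intro SO_relative_rot[OF SO(1,2)[OF u]]) auto
  then show ?thesis using eta[OF u] by (simp add: frame_rot_def lincomb_def)
qed

lemma rotating_frame_exists:
  assumes \<gamma>: "smooth_curve A I \<gamma>" and I: "connected I" and \<beta>: "smooth_on I \<beta>"
    and t0: "t0 \<in> I" and q: "q \<in> frames" "fst q = \<gamma> t0"
  shows "\<exists>f. rotating_frame_along \<beta> \<gamma> I f \<and> f t0 = q"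
proof -
  \<comment> \<open>Containment in \<open>I\<close> is part of the notion because \<gamma> is known
    to be smooth only there.\<close>
  define Sol where "Sol J f \<longleftrightarrow> J \<subseteq> I \<and> rotating_frame_along \<beta> \<gamma> J f" for J f
  have oI: "open I" using \<gamma> by (simp add: smooth_curve_def)
  have cut: "open {t\<in>J. \<gamma> t \<in> fst c}" if "open J" "J \<subseteq> I" "c \<in> A" for J c
    using smooth_curve_chart(1)[OF smooth_curve_restrict[OF \<gamma> that(1,2)] that(3)] .
  have "\<exists>f. Sol I f \<and> f t0 = q"
  proof (rule glue_local_solutions[where Q = "\<lambda>t. {q \<in> frames. fst q = \<gamma> t}", OF oI I])
    fix J J' f assume "Sol J f" "open J'" "J' \<subseteq> J"
    then show "Sol J' f"
      unfolding Sol_def rotating_frame_along_def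
      by (intro conjI ballI) (auto intro: smooth_subset[of "{t \<in> J. \<gamma> t \<in> fst _}"])
  next
    fix J f assume oJ: "open J" and N: "\<And>t. t \<in> J \<Longrightarrow> \<exists>N. open N \<and> t \<in> N \<and> N \<subseteq> J \<and> Sol N f"
    have JI: "J \<subseteq> I" using N by (force simp: Sol_def)
    have "\<exists>T. open T \<and> t \<in> T \<and> smooth_on T (\<lambda>t. E1 (f t) c) \<and> smooth_on T (\<lambda>t. E2 (f t) c)"
      if c: "c \<in> A" and t: "t \<in> {t \<in> J. \<gamma> t \<in> fst c}" for c t
    proof -
      obtain N where N: "open N" "t \<in> N" "N \<subseteq> J" "Sol N f" using N t by blast
      have "N \<subseteq> I" using N(3) JI by blast
      then show ?thesis
        using cut[OF N(1) _ c] N t c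
        by (intro exI[of _ "{t \<in> N. \<gamma> t \<in> fst c}"]) (simp add: Sol_def rotating_frame_along_def)
    qed
    then have "smooth_on {t \<in> J. \<gamma> t \<in> fst c} (\<lambda>t. E1 (f t) c) \<and> smooth_on {t \<in> J. \<gamma> t \<in> fst c} (\<lambda>t. E2 (f t) c)"
      if "c \<in> A" for c using that by (intro conjI smooth_local) blast+
    moreover have "f t \<in> frames \<and> fst (f t) = \<gamma> t" if "t \<in> J" for t
      using N[OF that] by (auto simp: Sol_def rotating_frame_along_def)
    moreover have "\<forall>c\<in>A. \<gamma> t \<in> fst c \<longrightarrow>
       has_cov_deriv c \<gamma> (\<lambda>s. E1 (f s)) (\<beta> t *\<^sub>R E2 (f t) c) t \<and>
       has_cov_deriv c \<gamma> (\<lambda>s. E2 (f s)) (- \<beta> t *\<^sub>R E1 (f t) c) t"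
      if "t \<in> J" for t
      using N[OF that] unfolding Sol_def rotating_frame_along_def by blast
    ultimately show "Sol J f" unfolding Sol_def rotating_frame_along_def using JI by blast
  next
    fix J f \<tau> assume oJ: "open J" and S: "Sol J f" and eq: "\<And>t. t \<in> J \<Longrightarrow> f t = \<tau> t"
    have JI: "J \<subseteq> I" using S by (simp add: Sol_def)
    have "smooth_on {t \<in> J. \<gamma> t \<in> fst c} (\<lambda>t. E1 (\<tau> t) c) \<and> smooth_on {t \<in> J. \<gamma> t \<in> fst c} (\<lambda>t. E2 (\<tau> t) c)" if c: "c \<in> A" for c
    proof (intro conjI)
      have "smooth_on {t \<in> J. \<gamma> t \<in> fst c} (\<lambda>t. E1 (f t) c)" "smooth_on {t \<in> J. \<gamma> t \<in> fst c} (\<lambda>t. E2 (f t) c)"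
        using S c unfolding Sol_def rotating_frame_along_def by blast+
      note sm = this
      show "smooth_on {t \<in> J. \<gamma> t \<in> fst c} (\<lambda>t. E1 (\<tau> t) c)"
        by (rule smooth_cong[OF cut[OF oJ JI c] _ sm(1)]) (simp add: eq)
      show "smooth_on {t \<in> J. \<gamma> t \<in> fst c} (\<lambda>t. E2 (\<tau> t) c)"
        by (rule smooth_cong[OF cut[OF oJ JI c] _ sm(2)]) (simp add: eq)
    qed
    moreover have "((\<lambda>s. E (\<tau> s) c) has_vector_derivative D) (at t)"
      if "t \<in> J" "((\<lambda>s. E (f s) c) has_vector_derivative D) (at t)" for t D c and E :: "'a frame \<Rightarrow> ('a, real^2) tvec"
      by (rule has_vector_derivative_transform_within_open[OF that(2) oJ that(1)]) (simp add: eq)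
    ultimately show "Sol J \<tau>" using S eq unfolding Sol_def rotating_frame_along_def by simp
  next
    fix J f \<tau> t u
    assume "open J" "connected J" "Sol J f" "Sol J \<tau>" "t \<in> J" "f t = \<tau> t" "u \<in> J"
    then show "f u = \<tau> u" unfolding Sol_def using rotating_frame_unique[OF \<gamma>] by blast
  next
    fix J f t assume "Sol J f" "t \<in> J"
    then show "f t \<in> {q \<in> frames. fst q = \<gamma> t}" by (simp add: Sol_def rotating_frame_along_def)
  next
    fix t assume t: "t \<in> I"
    obtain c where c: "c \<in> A" "\<gamma> t \<in> fst c"
      using smooth_curve_chart_at[OF \<gamma> t] .
    obtain e where e: "e > 0" "ball t e \<subseteq> {t\<in>I. \<gamma> t \<in> fst c}"
      using cut[OF oI _ c(1)] t c by (auto elim!: openE)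
    define N where "N = {t - e <..< t + e}"
    have N: "N \<subseteq> {t\<in>I. \<gamma> t \<in> fst c}" "open N" "connected N" "t \<in> N"
      using e by (auto simp: N_def ball_eq_greaterThanLessThan)
    then have NI: "N \<subseteq> I" by blast
    have "\<exists>f. Sol N f \<and> f u = q" if "u \<in> N" "q \<in> frames" "fst q = \<gamma> u" for u q
    proof -
      have g: "\<gamma> ` N \<subseteq> fst c" using N(1) by blast
      show ?thesis
        using rotating_frame_local[of "t - e" "t + e", folded N_def, OF smooth_curve_restrict[OF \<gamma> N(2) NI] c(1) g
            smooth_subset[OF \<beta> NI] that] NI unfolding Sol_def by metis
    qed
    then show "\<exists>N. open N \<and> connected N \<and> t \<in> N \<and> N \<subseteq> I \<and>
      (\<forall>u\<in>N. \<forall>q\<in>{q \<in> frames. fst q = \<gamma> u}. \<exists>f. Sol N f \<and> f u = q)"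
      using N NI by (intro exI[of _ N]) auto
  qed (use t0 q in auto)
  then show ?thesis by (auto simp: Sol_def)
qed

end

section \<open>Geodesics of the Wagner lift\<close>

context surface begin

text \<open>\<open>tangent_map\<close> evaluates in a chart picked by \<open>SOME\<close>, of which
  only membership in the atlas is known. In every frame chart the projection is the first coordinate
  followed by a transition of the surface, which settles all choices at once.\<close>

lemma tangent_map_proj:
  assumes f: "smooth_curve SO J f" and \<gamma>: "smooth_curve A J \<gamma>"
    and proj: "\<And>u. u \<in> J \<Longrightarrow> fst (f u) = \<gamma> u" and t: "t \<in> J"
  shows "tangent_map SO A fst (f t) (velocity SO f t) = velocity A \<gamma> t"
proof
  fix d
  have vt: "velocity A \<gamma> t \<in> tangent_space A (\<gamma> t)" by (rule velocity_tangent[OF \<gamma> t])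
  show "tangent_map SO A fst (f t) (velocity SO f t) d = velocity A \<gamma> t d"
  proof (cases "d \<in> charts_at A (\<gamma> t)")
    case False
    then show ?thesis by (simp add: tangent_map_def proj[OF t] velocity_def)
  next
    case True
    then have d: "d \<in> A" "\<gamma> t \<in> fst d" by (simp_all add: charts_at_iff)
    define c' where "c' = (SOME c. c \<in> charts_at SO (f t))"
    have "f t \<in> points SO" using f t unfolding smooth_curve_def by blast
    then obtain c0 where "c0 \<in> SO" "f t \<in> fst c0" by (rule points_chart)
    then have "c0 \<in> charts_at SO (f t)" by (simp add: charts_at_iff)
    then have "c' \<in> charts_at SO (f t)" unfolding c'_def by (rule someI)
    then have c': "c' \<in> SO" "f t \<in> fst c'" by (simp_all add: charts_at_iff)
    obtain c s a0 where c: "c \<in> A" and s: "gauge c s" and c'_eq: "c' = frame_chart c s a0"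
      using SO_atlasD[OF c'(1)] .
    have base: "fst (snd c' q) = snd c (fst q) \<and> fst q \<in> fst c" if "q \<in> fst c'" for q
      using frame_chart_coord[OF c s, of q a0] that frame_chart_mem[OF c s, of q a0] unfolding c'_eq by simp
    have x: "\<gamma> t \<in> fst c" using base[OF c'(2)] proj[OF t] by simp
    have "((\<lambda>u. fst (snd c' (f u))) has_vector_derivative fst (velocity SO f t c')) (at t)"
      by (rule bounded_linear.has_vector_derivative[OF bounded_linear_fst SO.has_velocity[OF f t c']])
    then have "((\<lambda>u. snd c (\<gamma> u)) has_vector_derivative fst (velocity SO f t c')) (at t)"
      by (rule has_vector_derivative_transform_within_open[OF _ SO.smooth_curve_chart(1)[OF f c'(1)]])
        (use t c' base proj in auto)
    then have v: "velocity A \<gamma> t c = fst (velocity SO f t c')"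
      by (rule velocity_eqI[where \<sigma> = \<gamma>, OF _ c x])
    have "fst (snd c' (f t)) = snd c (\<gamma> t)" using base[OF c'(2)] proj[OF t] by simp
    then have "(transition c d has_derivative dtrans c d (\<gamma> t)) (at (fst (snd c' (f t))))"
      using has_dtrans[OF c d(1) x d(2)] by simp
    then have "((\<lambda>z. transition c d (fst z)) has_derivative (\<lambda>h. dtrans c d (\<gamma> t) (fst h))) (at (snd c' (f t)))"
      by (rule has_derivative_compose[OF has_derivative_fst[OF has_derivative_ident]])
    then have "((snd d \<circ> fst \<circ> chart_inv c') has_derivative (\<lambda>h. dtrans c d (\<gamma> t) (fst h))) (at (snd c' (f t)))"
    proof (rule has_derivative_transform_within_open[OF _ SO.open_chart[OF c'(1)]])
      show "snd c' (f t) \<in> snd c' ` fst c'" using c' by blast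
      fix z assume "z \<in> snd c' ` fst c'"
      then obtain q where q: "q \<in> fst c'" "z = snd c' q" by blast
      then show "transition c d (fst z) = (snd d \<circ> fst \<circ> chart_inv c') z"
        using base[OF q(1)] transition[OF c, of "fst q" d] SO.chart_inv[OF c'(1) q(1)] by simp
    qed
    from frechet_derivative_eqI[OF this]
    have "tangent_map SO A fst (f t) (velocity SO f t) d = dtrans c d (\<gamma> t) (fst (velocity SO f t c'))"
      using True by (simp add: tangent_map_def proj[OF t] c'_def[symmetric] Let_def)
    then show ?thesis using tangent_transform[OF vt c d(1) x d(2)] v by simp
  qed
qed

text \<open>Supplies a base curve with any prescribed initial velocity: a coordinate segment, cut
  short to stay in the chart domain.\<close>

lemma smooth_curve_straight:
  assumes c: "c \<in> A" and x: "x \<in> fst c"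
  obtains \<epsilon> where "\<epsilon> > 0" "smooth_curve A {-\<epsilon><..<\<epsilon>} (\<lambda>t. chart_inv c (snd c x + t *\<^sub>R u))"
    "\<And>t. t \<in> {-\<epsilon><..<\<epsilon>} \<Longrightarrow> chart_inv c (snd c x + t *\<^sub>R u) \<in> fst c"
    "velocity A (\<lambda>t. chart_inv c (snd c x + t *\<^sub>R u)) 0 c = u"
proof -
  define l where "l t = snd c x + t *\<^sub>R u" for t :: real
  have cl: "continuous_on UNIV l" unfolding l_def by (intro continuous_intros)
  have ol: "open (l -` V)" if "open V" for V
    using continuous_open_vimage[OF that, of l] cl by (simp add: continuous_on_eq_continuous_at)
  have l0: "l 0 = snd c x" by (simp add: l_def)
  then have "0 \<in> l -` U c" using x by simp
  then obtain \<epsilon> where \<epsilon>: "\<epsilon> > 0" "ball 0 \<epsilon> \<subseteq> l -` U c" using ol[OF open_chart[OF c]] openE by blast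
  define J where "J = {-\<epsilon><..<\<epsilon>}"
  have J: "l t \<in> U c" if "t \<in> J" for t using \<epsilon>(2) that by (force simp: J_def)
  have m: "chart_inv c (l t) \<in> fst c" "snd c (chart_inv c (l t)) = l t" if "t \<in> J" for t
    using J[OF that] chart_inv[OF c] by auto
  have sl: "smooth_on S l" if "open S" for S
    unfolding l_def using that by (intro smooth_add smooth_const smooth_scaleR smooth_ident)
  have "smooth_curve A J (\<lambda>t. chart_inv c (l t))"
    unfolding smooth_curve_def
  proof (intro conjI ballI)
    show "open J" by (simp add: J_def)
    show "(\<lambda>t. chart_inv c (l t)) ` J \<subseteq> points A" using m(1) in_points[OF c] by blast
    fix d assume d: "d \<in> A"
    let ?V = "snd c ` (fst c \<inter> fst d)"
    have e: "{t \<in> J. chart_inv c (l t) \<in> fst d} = J \<inter> l -` ?V"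
    proof (intro equalityI subsetI)
      fix t assume "t \<in> {t \<in> J. chart_inv c (l t) \<in> fst d}"
      then show "t \<in> J \<inter> l -` ?V" using m[of t] by (auto intro!: image_eqI[of _ _ "chart_inv c (l t)"])
    next
      fix t assume "t \<in> J \<inter> l -` ?V"
      then show "t \<in> {t \<in> J. chart_inv c (l t) \<in> fst d}" using chart_inv[OF c] by auto
    qed
    show o: "open {t \<in> J. chart_inv c (l t) \<in> fst d}"
      unfolding e using ol[OF open_overlap[OF c d]] by (intro open_Int) (simp_all add: J_def)
    have img: "l ` {t \<in> J. chart_inv c (l t) \<in> fst d} \<subseteq> ?V" unfolding e by blast
    show "smooth_on {t \<in> J. chart_inv c (l t) \<in> fst d} (\<lambda>t. snd d (chart_inv c (l t)))"
      by (rule smooth_cong[OF o _ smooth_compose[OF o open_overlap[OF c d] sl[OF o] smooth_transition[OF c d] img]])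
        (simp add: transition_def)
  qed
  moreover have "velocity A (\<lambda>t. chart_inv c (l t)) 0 c = u"
  proof (rule velocity_eqI[OF _ c])
    have "(l has_vector_derivative u) (at 0)"
      unfolding l_def by (auto intro!: derivative_eq_intros)
    then show "((\<lambda>t. snd c (chart_inv c (l t))) has_vector_derivative u) (at 0)"
      by (rule has_vector_derivative_transform_within_open[of _ _ _ J]) (use m \<epsilon>(1) in \<open>auto simp: J_def\<close>)
    show "chart_inv c (l 0) \<in> fst c" using m(1)[of 0] \<epsilon>(1) by (simp add: J_def)
  qed
  ultimately show thesis using that[of \<epsilon>] \<epsilon>(1) m(1) unfolding J_def l_def by blast
qed

text \<open>\<open>horizontal\<close> offers vectors only as velocities of parallel frames. A
  parallel frame along a coordinate segment, with rotation rate 0, realises a horizontal vector over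
  each \<open>u\<close> and displays its bundle components.\<close>

lemma horizontal_vector_exists:
  assumes c: "c \<in> A" and s: "gauge c s" and q: "q \<in> fst (frame_chart c s a0)"
  obtains X where "X \<in> horizontal A g q" "X \<in> tangent_space SO q"
    "X (frame_chart c s a0) = (u, - conn c s (snd c (fst q)) u)"
    "tangent_map SO A fst q X = coord_vec A c (fst q) u"
proof -
  have qSO: "q \<in> frames" and x: "fst q \<in> fst c" using q frame_chart_mem[OF c s] by auto
  define \<gamma> where "\<gamma> t = chart_inv c (snd c (fst q) + t *\<^sub>R u)" for t
  obtain \<epsilon> where \<epsilon>: "\<epsilon> > 0" and \<gamma>: "smooth_curve A {-\<epsilon><..<\<epsilon>} \<gamma>" and img: "\<And>t. t \<in> {-\<epsilon><..<\<epsilon>} \<Longrightarrow> \<gamma> t \<in> fst c"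
    and v: "velocity A \<gamma> 0 c = u"
    using smooth_curve_straight[OF c x] unfolding \<gamma>_def[abs_def] by metis
  have \<gamma>0: "fst q = \<gamma> 0" using chart_inv[OF c x] by (simp add: \<gamma>_def)
  have J0: "0 \<in> {-\<epsilon><..<\<epsilon>}" using \<epsilon> by simp
  have "\<gamma> ` {-\<epsilon><..<\<epsilon>} \<subseteq> fst c" using img by blast
  from rotating_frame_local[OF \<gamma> c this smooth_const[OF open_greaterThanLessThan, of _ _ 0] J0 qSO \<gamma>0]
  obtain f where f: "rotating_frame_along (\<lambda>_. 0) \<gamma> {-\<epsilon><..<\<epsilon>} f" "f 0 = q" "\<And>t. fst (f t) = \<gamma> t" by blast
  note sc = rotating_frame_smooth_curve[OF f(1) \<gamma>]
  have pf: "fst \<circ> f = \<gamma>" using f(3) by auto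
  have cov: "cov_deriv_along A g (fst \<circ> f) (\<lambda>s. fst (snd (f s))) t = (\<lambda>c. 0) \<and>
      cov_deriv_along A g (fst \<circ> f) (\<lambda>s. snd (snd (f s))) t = (\<lambda>c. 0)" if t: "t \<in> {-\<epsilon><..<\<epsilon>}" for t
    unfolding pf E1_def[symmetric] E2_def[symmetric]
  proof (intro conjI ext)
    fix d
    show "cov_deriv_along A g \<gamma> (\<lambda>s. E1 (f s)) t d = 0" "cov_deriv_along A g \<gamma> (\<lambda>s. E2 (f s)) t d = 0"
    proof (atomize (full), cases "d \<in> charts_at A (\<gamma> t)")
      case True
      then have "has_cov_deriv d \<gamma> (\<lambda>s. E1 (f s)) 0 t"
        "has_cov_deriv d \<gamma> (\<lambda>s. E2 (f s)) 0 t"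
        using f(1) t by (simp_all add: rotating_frame_along_def charts_at_iff)
      from this[THEN vector_derivative_at]
      show "cov_deriv_along A g \<gamma> (\<lambda>s. E1 (f s)) t d = 0 \<and> cov_deriv_along A g \<gamma> (\<lambda>s. E2 (f s)) t d = 0"
        by (simp add: cov_deriv_along_def levi_civita_eq_christoffel)
    qed (simp add: cov_deriv_along_def)
  qed
  define X where "X = velocity SO f 0"
  show thesis
  proof (rule that[of X])
    show "X \<in> horizontal A g q"
      unfolding horizontal_def mem_Collect_eq X_def using f(2) \<epsilon> sc cov by blast
    show "X \<in> tangent_space SO q" using SO.velocity_tangent[OF sc J0] f(2) by (simp add: X_def)
    show "X (frame_chart c s a0) = (u, - conn c s (snd c (fst q)) u)"
      using rotating_frame_velocity[OF f(1) \<gamma> J0 c s, of a0] q f(2) by (simp add: X_def v \<gamma>0)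
    have "tangent_map SO A fst q X = velocity A \<gamma> 0"
      using tangent_map_proj[OF sc \<gamma> _ J0] f(2,3) by (simp add: X_def)
    also have "\<dots> = coord_vec A c (fst q) u"
      using tangent_eq_coord_vec[OF velocity_tangent[OF \<gamma> J0] c] x v \<gamma>0 by simp
    finally show "tangent_map SO A fst q X = coord_vec A c (fst q) u" .
  qed
qed

text \<open>The orbit of \<open>q\<close> under rotation is a frame turning at rate 1 over a
  constant curve, so the general velocity formula applies; the base velocity is 0 and the connection
  term vanishes.\<close>

lemma d_phi_vertical:
  assumes q: "q \<in> frames"
  shows "d_phi A g q \<in> vertical A g q"
    and "c \<in> A \<Longrightarrow> gauge c s \<Longrightarrow> q \<in> fst (frame_chart c s a0) \<Longrightarrow>
      d_phi A g q (frame_chart c s a0) = (0, 1)"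
proof -
  define x where "x = fst q"
  have eta: "q = (x, E1 q, E2 q)" using frame_eta[of q] by (simp add: x_def)
  have so: "(x, E1 q, E2 q) \<in> frames" using q eta by simp
  define f where "f \<phi> = frame_rot \<phi> q" for \<phi>
  have f: "f \<phi> = (x, lincomb (cos \<phi>) (E1 q) (sin \<phi>) (E2 q), lincomb (- sin \<phi>) (E1 q) (cos \<phi>) (E2 q))" for \<phi>
    unfolding f_def by (subst eta) (simp add: frame_rot_def)
  have E: "E1 (f \<phi>) d = cos \<phi> *\<^sub>R E1 q d + sin \<phi> *\<^sub>R E2 q d" "E2 (f \<phi>) d = - sin \<phi> *\<^sub>R E1 q d + cos \<phi> *\<^sub>R E2 q d" for \<phi> d
    unfolding f by (simp_all add: E1_def E2_def lincomb_def)
  have const: "smooth_curve A UNIV (\<lambda>_. x)"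
    using SO_D(1)[OF so] by (auto simp: smooth_curve_def intro: smooth_const)
  have v0: "velocity A (\<lambda>_. x) \<phi> d = 0" for \<phi> d
    by (simp add: velocity_def vector_derivative_const_at)
  note sc = smooth_sin_cos[OF open_UNIV smooth_ident[OF open_UNIV]]
  have rot: "rotating_frame_along (\<lambda>_. 1) (\<lambda>_. x) UNIV f"
    unfolding rotating_frame_along_def
  proof (intro conjI ballI impI)
    show "f t \<in> frames" for t using frame_rot_SO(1)[OF so] eta by (simp add: f_def)
    show "fst (f t) = x" for t by (simp add: f)
    have "smooth_on UNIV (\<lambda>t. E1 (f t) d)" "smooth_on UNIV (\<lambda>t. E2 (f t) d)" for d
      unfolding E by (intro smooth_add smooth_scaleR smooth_minus smooth_const sc open_UNIV)+
    note sm = this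
    show "smooth_on {t \<in> UNIV. x \<in> fst d} (\<lambda>t. E1 (f t) d)" for d
      by (rule smooth_subset[OF sm(1) subset_UNIV])
    show "smooth_on {t \<in> UNIV. x \<in> fst d} (\<lambda>t. E2 (f t) d)" for d
      by (rule smooth_subset[OF sm(2) subset_UNIV])
    fix t d assume d: "d \<in> A" "x \<in> fst d"
    interpret metric_patch "U d" "mc d" by (rule patch[OF d(1)])
    have "christoffel (mc d) (snd d x) 0 w = 0" for w
      using bilinear_lzero[OF bilinear_christoffel] d by blast
    moreover have "((\<lambda>s. E1 (f s) d) has_vector_derivative E2 (f t) d) (at t)"
      "((\<lambda>s. E2 (f s) d) has_vector_derivative - E1 (f t) d) (at t)"
      unfolding E by (auto intro!: derivative_eq_intros)
    ultimately show "((\<lambda>s. E1 (f s) d) has_vector_derivative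
          1 *\<^sub>R E2 (f t) d - christoffel (mc d) (snd d x) (velocity A (\<lambda>_. x) t d) (E1 (f t) d)) (at t)"
      "((\<lambda>s. E2 (f s) d) has_vector_derivative
          - 1 *\<^sub>R E1 (f t) d - christoffel (mc d) (snd d x) (velocity A (\<lambda>_. x) t d) (E2 (f t) d)) (at t)"
      by (simp_all add: v0)
  qed
  have f0: "f 0 = q" unfolding f by (subst eta) (simp add: lincomb_def)
  have dphi: "d_phi A g q = velocity SO f 0" by (simp add: d_phi_def f_def[abs_def])
  note scurve = rotating_frame_smooth_curve[OF rot const]
  have "velocity SO f 0 \<in> tangent_space SO q" using SO.velocity_tangent[OF scurve UNIV_I, of 0] f0 by simp
  moreover have "tangent_map SO A fst q (velocity SO f 0) = (\<lambda>c. 0)"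
    using tangent_map_proj[OF scurve const _ UNIV_I, of 0] f0 v0 by (simp add: f fun_eq_iff)
  ultimately show "d_phi A g q \<in> vertical A g q" by (simp add: vertical_def dphi)
  show "d_phi A g q (frame_chart c s a0) = (0, 1)"
    if c: "c \<in> A" and s: "gauge c s" and q': "q \<in> fst (frame_chart c s a0)"
  proof -
    interpret frame_patch "U c" "mc c" "S1 c s" "S2 c s" by (rule frame_patch_section[OF c s])
    have "x \<in> fst c" using q' frame_chart_mem[OF c s] by (simp add: x_def)
    then have "om (snd c x) 0 = 0" using linear_0[OF linear_om] by blast
    then show ?thesis using rotating_frame_velocity[OF rot const UNIV_I c s, of 0 a0] q' f0 by (simp add: dphi v0)
  qed
qed

end

section \<open>The Wagner lift in bundle coordinates\<close>

locale wagner_surface = surface A g for A :: "('a, real^2) chart set" and g :: "('a, real^2) metric_field" +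
  fixes K :: "'a \<Rightarrow> real" and h :: "('a frame, (real^2) \<times> real) metric_field"
  assumes curvature: "has_curvature A g K" and wagner: "wagner_lift A g K h"
begin

definition W where "W = frames - SO_singular A g K"

lemma W_iff: "q \<in> W \<longleftrightarrow> q \<in> frames \<and> K (fst q) \<noteq> 0"
  using SO_D(1)[of "fst q" "E1 q" "E2 q"] frame_eta[of q]
  by (auto simp: W_def SO_singular_def zero_curvature_set_def)

lemma curved_patch:
  assumes c: "c \<in> A" and s: "gauge c s"
  shows "curved_frame_patch (U c) (mc c) (S1 c s) (S2 c s) (\<lambda>y. K (chart_inv c y))"
proof -
  interpret frame_patch "U c" "mc c" "S1 c s" "S2 c s" by (rule frame_patch_section[OF c s])
  show ?thesis
  proof unfold_locales
    fix y u v assume "y \<in> U c"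
    then obtain p where p: "p \<in> fst c" "y = snd c p" by blast
    then show "mc c y (riemann (mc c) y u v v) u = K (chart_inv c y) * (mc c y u u * mc c y v v - (mc c y u v)\<^sup>2)"
      using curvature in_points[OF c p(1)] c
      by (simp add: has_curvature_def charts_at_iff chart_inv Let_def curvature_tensor_eq_riemann)
  qed
qed

lemma smooth_K_chart: "c \<in> A \<Longrightarrow> smooth_on (U c) (\<lambda>y. K (chart_inv c y))"
  using section_exists[of c] curved_frame_patch.smooth_K[OF curved_patch, of c] by metis

lemma riemannian_h: "riemannian SO W h"
  using wagner SO.smooth_atlas by unfold_locales (auto simp: wagner_lift_def W_def)

text \<open>Comparing components, the coordinate vector (u, \<tau>) is the horizontal vector over
  \<open>u\<close> plus \<tau> + om(u) times the fibre direction. Bilinearity and the three defining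
  values of the lift then give the coefficients.\<close>

lemma wagner_coefficients:
  assumes c: "c \<in> A" and s: "gauge c s"
    and z: "(y, \<phi>) \<in> snd (frame_chart c s a0) ` (fst (frame_chart c s a0) \<inter> W)"
  shows "metric_coeff SO h (frame_chart c s a0) (y, \<phi>) (u, \<tau>) (v, \<rho>)
    = mc c y u v + (\<tau> + conn c s y u) * (\<rho> + conn c s y v) / (K (chart_inv c y))\<^sup>2"
    and "y \<in> U c" "K (chart_inv c y) \<noteq> 0"
proof -
  define c' where "c' = frame_chart c s a0"
  have c': "c' \<in> SO" unfolding c'_def by (rule SO_atlasI[OF c s])
  interpret h: riemannian SO W h by (rule riemannian_h)
  obtain q where q: "q \<in> fst c'" "q \<in> W" "(y, \<phi>) = snd c' q" using z unfolding c'_def by blast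
  have qSO: "q \<in> frames" and x: "fst q \<in> fst c" using q(1) frame_chart_mem[OF c s] unfolding c'_def by auto
  have y: "y = snd c (fst q)" using frame_chart_coord[OF c s q(1)[unfolded c'_def]] q(3) by (simp add: c'_def)
  have Kq: "chart_inv c y = fst q" using chart_inv[OF c x] y by simp
  show "y \<in> U c" "K (chart_inv c y) \<noteq> 0" using x q(2) y Kq by (auto simp: W_iff)
  obtain X where X: "X \<in> horizontal A g q" "X \<in> tangent_space SO q" "X c' = (u, - conn c s y u)"
    "tangent_map SO A fst q X = coord_vec A c (fst q) u"
    using horizontal_vector_exists[OF c s q(1)[unfolded c'_def], of u] y unfolding c'_def by metis
  obtain Y where Y: "Y \<in> horizontal A g q" "Y \<in> tangent_space SO q" "Y c' = (v, - conn c s y v)"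
    "tangent_map SO A fst q Y = coord_vec A c (fst q) v"
    using horizontal_vector_exists[OF c s q(1)[unfolded c'_def], of v] y unfolding c'_def by metis
  define V where "V = d_phi A g q"
  have V: "V \<in> vertical A g q" "V c' = (0, 1)"
    using d_phi_vertical(1)[OF qSO] d_phi_vertical(2)[OF qSO c s q(1)[unfolded c'_def]] by (simp_all add: V_def c'_def)
  then have Vt: "V \<in> tangent_space SO q" by (simp add: vertical_def)
  have dec: "coord_vec SO c' q (w, \<kappa>) = lincomb 1 Z (\<kappa> + conn c s y w) V"
    if "Z \<in> tangent_space SO q" "Z c' = (w, - conn c s y w)" for Z w \<kappa>
  proof (rule SO.tangent_eqI[OF SO.coord_vec_tangent[OF c' q(1)] SO.lincomb_tangent[OF that(1) Vt in_points[OF c' q(1)]] c' q(1)])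
    show "coord_vec SO c' q (w, \<kappa>) c' = lincomb 1 Z (\<kappa> + conn c s y w) V c'"
      using SO.coord_vec_self[OF c' q(1)] that(2) V(2) by (simp add: lincomb_def)
  qed
  have w: "\<And>X Y. X \<in> horizontal A g q \<Longrightarrow> Y \<in> horizontal A g q \<Longrightarrow> h q X Y = g (fst q) (tangent_map SO A fst q X) (tangent_map SO A fst q Y)"
    "\<And>X Y. X \<in> horizontal A g q \<Longrightarrow> Y \<in> vertical A g q \<Longrightarrow> h q X Y = 0"
    "h q V V = 1 / (K (fst q))\<^sup>2"
    using wagner q(2) unfolding wagner_lift_def W_def[symmetric] V_def by blast+
  have YV: "lincomb 1 Y (\<rho> + conn c s y v) V \<in> tangent_space SO q"
    by (rule SO.lincomb_tangent[OF Y(2) Vt in_points[OF c' q(1)]])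
  have "metric_coeff SO h c' (y, \<phi>) (u, \<tau>) (v, \<rho>)
    = h q (lincomb 1 X (\<tau> + conn c s y u) V) (lincomb 1 Y (\<rho> + conn c s y v) V)"
    unfolding q(3) h.mc_eq[OF c' q(1)] dec[OF X(2,3)] dec[OF Y(2,3)] ..
  also have "\<dots> = h q X Y + (\<rho> + conn c s y v) * h q X V
      + (\<tau> + conn c s y u) * (h q V Y + (\<rho> + conn c s y v) * h q V V)"
    by (simp add: h.h_lincomb[OF q(2) X(2) Vt YV] h.h_lincomb_right[OF q(2) Y(2) Vt X(2)] h.h_lincomb_right[OF q(2) Y(2) Vt Vt])
  also have "\<dots> = mc c y u v + (\<tau> + conn c s y u) * (\<rho> + conn c s y v) / (K (fst q))\<^sup>2"
    using w(1)[OF X(1) Y(1)] w(2)[OF X(1) V(1)] w(2)[OF Y(1) V(1)] w(3) h.h_sym[OF q(2) Vt Y(2)]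
    by (simp add: X(4) Y(4) mc_eq[OF c x, symmetric] y)
  finally show "metric_coeff SO h (frame_chart c s a0) (y, \<phi>) (u, \<tau>) (v, \<rho>)
    = mc c y u v + (\<tau> + conn c s y u) * (\<rho> + conn c s y v) / (K (chart_inv c y))\<^sup>2"
    by (simp add: c'_def Kq)
qed

text \<open>The chain rule between the chart picked by \<open>SOME\<close> and the given
  one.\<close>

lemma differential_K:
  assumes c: "c \<in> A" and p: "p \<in> fst c" and Y: "Y \<in> tangent_space A p"
  shows "differential A K p Y = FD (\<lambda>y. K (chart_inv c y)) (snd c p) (Y c)"
proof -
  define d where "d = (SOME c. c \<in> charts_at A p)"
  have "c \<in> charts_at A p" using c p by (simp add: charts_at_iff)
  then have "d \<in> charts_at A p" unfolding d_def by (rule someI)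
  then have d: "d \<in> A" "p \<in> fst d" by (simp_all add: charts_at_iff)
  have "((\<lambda>y. K (chart_inv d y)) has_derivative FD (\<lambda>y. K (chart_inv d y)) (snd d p)) (at (snd d p))"
    using smooth_has_derivative[OF smooth_K_chart[OF d(1)]] d by blast
  then have "((\<lambda>y. K (chart_inv d y)) has_derivative FD (\<lambda>y. K (chart_inv d y)) (snd d p)) (at (transition c d (snd c p)))"
    by (simp add: transition[OF c p])
  from has_derivative_compose[OF has_dtrans[OF c d(1) p d(2)] this]
  have "((\<lambda>y. K (chart_inv d (transition c d y))) has_derivative
    (\<lambda>u. FD (\<lambda>y. K (chart_inv d y)) (snd d p) (dtrans c d p u))) (at (snd c p))" .
  then have "((\<lambda>y. K (chart_inv c y)) has_derivative
    (\<lambda>u. FD (\<lambda>y. K (chart_inv d y)) (snd d p) (dtrans c d p u))) (at (snd c p))"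
    by (rule has_derivative_transform_within_open[OF _ open_overlap[OF c d(1)]])
      (use p d chart_inv[OF c] chart_inv[OF d(1)] transition[OF c, of _ d] in auto)
  from frechet_derivative_eqI[OF this, of "Y c"]
  show ?thesis
    using tangent_transform[OF Y c d(1) p d(2)]
    by (simp add: differential_def d_def[symmetric] Let_def comp_def)
qed

text \<open>Riesz representation in one chart provides the vector, nondegeneracy the uniqueness
  demanded by \<open>THE\<close>; smoothness of K makes its chart derivative linear.\<close>

lemma gradient_K:
  assumes c: "c \<in> A" and p: "p \<in> fst c"
  shows "gradient A g K p \<in> tangent_space A p"
    and "mc c (snd c p) (gradient A g K p c) w = FD (\<lambda>y. K (chart_inv c y)) (snd c p) w"
proof -
  interpret metric_patch "U c" "mc c" by (rule patch[OF c])
  have x: "snd c p \<in> U c" using p by blast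
  let ?D = "FD (\<lambda>y. K (chart_inv c y)) (snd c p)"
  have "linear ?D" using has_derivative_linear[OF smooth_has_derivative[OF smooth_K_chart[OF c] x]] .
  then obtain a where a: "\<And>w. mc c (snd c p) a w = ?D w" using riesz[OF x] by blast
  let ?P = "\<lambda>X. X \<in> tangent_space A p \<and> (\<forall>Y \<in> tangent_space A p. g p X Y = differential A K p Y)"
  have "?P (coord_vec A c p a)"
    using a differential_K[OF c p] coord_vec_tangent[OF c p] by (simp add: h_eq_mc[OF c p] coord_vec_self[OF c p])
  moreover have "X = coord_vec A c p a" if "?P X" for X
  proof (rule tangent_eqI[OF _ coord_vec_tangent[OF c p] c p])
    show "X \<in> tangent_space A p" using that by blast
    show "X c = coord_vec A c p a c"
    proof (rule nondegenerate[OF x])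
      fix w
      have "g p X (coord_vec A c p w) = differential A K p (coord_vec A c p w)"
        using that coord_vec_tangent[OF c p] by blast
      then show "mc c (snd c p) (X c) w = mc c (snd c p) (coord_vec A c p a c) w"
        using that differential_K[OF c p coord_vec_tangent[OF c p]] a
        by (simp add: h_eq_mc[OF c p _ coord_vec_tangent[OF c p]] coord_vec_self[OF c p])
    qed
  qed
  ultimately have "gradient A g K p = coord_vec A c p a" unfolding gradient_def by (rule the_equality)
  then show "gradient A g K p \<in> tangent_space A p" "mc c (snd c p) (gradient A g K p c) w = ?D w"
    using coord_vec_tangent[OF c p] coord_vec_self[OF c p] a by simp_all
qed

text \<open>Expanding \<open>X\<close> in the section, on which J is prescribed, turns J into the
  area form. In this shape the J-term of the curve equation matches the derivative of the connection
  form.\<close>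

lemma complex_structure_K:
  assumes J: "complex_structure A g J" and c: "c \<in> A" and s: "gauge c s"
    and p: "p \<in> fst c" and X: "X \<in> tangent_space A p"
  shows "mc c (snd c p) (J p X c) w = frame_patch.vol (mc c) (S1 c s) (S2 c s) (snd c p) (X c) w"
proof -
  interpret frame_patch "U c" "mc c" "S1 c s" "S2 c s" by (rule frame_patch_section[OF c s])
  have x: "snd c p \<in> U c" using p by blast
  note so = section_SO[OF s p]
  note T = SO_D[OF so]
  define a b where "a = mc c (snd c p) (X c) (S1 c s (snd c p))" and "b = mc c (snd c p) (X c) (S2 c s (snd c p))"
  have "X = lincomb a (fst (s p)) b (snd (s p))"
    by (rule tangent_eqI[OF X lincomb_tangent[OF T(2,3,1)] c p])
      (use frame_expansion[OF x, of "X c"] in \<open>simp add: lincomb_def a_def b_def section_comps[OF c p]\<close>)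
  moreover have "J p (lincomb a (fst (s p)) b (snd (s p))) = lincomb a (J p (fst (s p))) b (J p (snd (s p)))"
    using J T unfolding complex_structure_def by blast
  moreover have "J p (fst (s p)) = snd (s p) \<and> J p (snd (s p)) = (\<lambda>c. - fst (s p) c)"
    using bspec[OF conjunct2[OF J[unfolded complex_structure_def]] so] by (simp add: case_prod_beta)
  ultimately have "J p X c = a *\<^sub>R S2 c s (snd c p) - b *\<^sub>R S1 c s (snd c p)"
    by (simp add: lincomb_def section_comps[OF c p])
  then show ?thesis by (simp add: vol_def lin[OF x] a_def b_def sym[OF x, of _ w])
qed

lemma smooth_K_along:
  assumes \<gamma>: "smooth_curve A I \<gamma>" shows "smooth_on I (\<lambda>t. K (\<gamma> t))"
proof (rule smooth_local)
  fix t assume t: "t \<in> I"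
  obtain c where c: "c \<in> A" "\<gamma> t \<in> fst c" using smooth_curve_chart_at[OF \<gamma> t] .
  let ?N = "{t \<in> I. \<gamma> t \<in> fst c}"
  note N = smooth_curve_chart(1,2)[OF \<gamma> c(1)]
  have "smooth_on ?N (\<lambda>t. K (chart_inv c (snd c (\<gamma> t))))"
    by (rule smooth_compose[OF N(1) open_chart[OF c(1)] N(2) smooth_K_chart[OF c(1)]]) auto
  then have "smooth_on ?N (\<lambda>t. K (\<gamma> t))"
    by (rule smooth_cong[OF N(1), rotated]) (simp add: chart_inv[OF c(1)])
  then show "\<exists>T. open T \<and> t \<in> T \<and> smooth_on T (\<lambda>t. K (\<gamma> t))" using N t c by blast
qed

text \<open>In a frame chart around a given time the rotation rate C K^2 becomes the momentum
  condition of \<open>wagner_geodesic\<close>, and the curve equation, paired with an arbitrary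
  vector, becomes its base equation.\<close>

lemma lift_geodesic:
  assumes J: "complex_structure A g J" and \<gamma>: "smooth_curve A I \<gamma>"
    and eq: "\<And>t. t \<in> I \<Longrightarrow> cov_deriv_along A g \<gamma> (velocity A \<gamma>) t =
        lincomb (C * K (\<gamma> t)) (J (\<gamma> t) (velocity A \<gamma> t)) (- (C\<^sup>2 * K (\<gamma> t))) (gradient A g K (\<gamma> t))"
    and f: "rotating_frame_along (\<lambda>t. C * (K (\<gamma> t))\<^sup>2) \<gamma> I f"
  defines "S \<equiv> {t \<in> I. K (\<gamma> t) \<noteq> 0}"
  shows "geodesic_on SO W h S f"
proof -
  have oI: "open I" using \<gamma> by (simp add: smooth_curve_def)
  note sc = rotating_frame_smooth_curve[OF f \<gamma>]
  have "open (I \<inter> (\<lambda>t. K (\<gamma> t)) -` (- {0}))"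
    by (intro continuous_open_preimage smooth_continuous_on smooth_K_along[OF \<gamma>] oI) auto
  moreover have "S = I \<inter> (\<lambda>t. K (\<gamma> t)) -` (- {0})" by (auto simp: S_def)
  ultimately have oS: "open S" by simp
  have SI: "S \<subseteq> I" by (auto simp: S_def)
  have base: "f t \<in> frames" "fst (f t) = \<gamma> t" if "t \<in> I" for t
    using f that by (auto simp: rotating_frame_along_def)
  have "cov_deriv_along SO h f (velocity SO f) t c' = 0" if t: "t \<in> S" for t c'
  proof (cases "c' \<in> charts_at SO (f t)")
    case False
    then show ?thesis by (simp add: cov_deriv_along_def)
  next
    case True
    then have c': "c' \<in> SO" "f t \<in> fst c'" by (simp_all add: charts_at_iff)
    obtain c s a0 where c: "c \<in> A" and s: "gauge c s" and c'_eq: "c' = frame_chart c s a0"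
      using SO_atlasD[OF c'(1)] .
    interpret h: riemannian SO W h by (rule riemannian_h)
    interpret curved_frame_patch "U c" "mc c" "S1 c s" "S2 c s" "\<lambda>y. K (chart_inv c y)"
      by (rule curved_patch[OF c s])
    have tI: "t \<in> I" using t SI by blast
    have x: "\<gamma> t \<in> fst c" using c'(2) base(2)[OF tI] frame_chart_mem[OF c s] by (simp add: c'_eq)
    define N where "N = {t \<in> I. \<gamma> t \<in> fst c}"
    note N = smooth_curve_chart[OF \<gamma> c, folded N_def]
    have tN: "t \<in> N" using tI x by (simp add: N_def)
    define p p' where "p u = snd c (\<gamma> u)" and "p' u = velocity A \<gamma> u c" for u
    define p'' where "p'' = vector_derivative p' (at t)"
    have p'': "(p' has_vector_derivative p'') (at t)"
      using smooth_vector_derivative(2)[OF N(1,3) tN] by (simp add: p''_def p'_def[abs_def])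
    \<comment> \<open>Given by a formula that makes sense on all of \<open>N\<close>, where \<gamma>
      stays in the chart of the surface; it is the actual angular velocity as long as
      \<open>f\<close> stays in the frame chart, that is on \<open>D\<close>.\<close>
    define \<theta>' where "\<theta>' u = C * (K (chart_inv c (p u)))\<^sup>2 - om (p u) (p' u)" for u
    define T where "T = snd c' ` (fst c' \<inter> W)"
    have coord: "snd c' (f t) = (p t, snd (snd c' (f t)))"
      using frame_chart_coord[OF c s c'(2)[unfolded c'_eq]] base(2)[OF tI] by (simp add: c'_eq p_def)
    have fW: "f t \<in> W" using base[OF tI] t by (simp add: W_iff S_def)
    have pT: "(p t, snd (snd c' (f t))) \<in> T"
      unfolding coord[symmetric] T_def using c'(2) fW by blast
    have ode: "mc c (p t) (p'' + christoffel (mc c) (p t) (p' t) (p' t)) w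
      = C * K (chart_inv c (p t)) * vol (p t) (p' t) w - C\<^sup>2 * K (chart_inv c (p t)) * DK (p t) w" for w
    proof -
      have xU: "snd c (\<gamma> t) \<in> U c" using x by blast
      have "c \<in> charts_at A (\<gamma> t)" using c x by (simp add: charts_at_iff)
      then have "p'' + christoffel (mc c) (p t) (p' t) (p' t) = cov_deriv_along A g \<gamma> (velocity A \<gamma>) t c"
        by (simp add: cov_deriv_along_def levi_civita_eq_christoffel p''_def p'_def[abs_def] p_def)
      also have "\<dots> = (C * K (\<gamma> t)) *\<^sub>R J (\<gamma> t) (velocity A \<gamma> t) c + (- (C\<^sup>2 * K (\<gamma> t))) *\<^sub>R gradient A g K (\<gamma> t) c"
        unfolding eq[OF tI] lincomb_def ..
      finally show ?thesis
        using complex_structure_K[OF J c s x velocity_tangent[OF \<gamma> tI], of w] gradient_K(2)[OF c x, of w]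
        by (simp add: p_def p'_def lin[OF xU] chart_inv[OF c x])
    qed
    have mp: "metric_patch T (metric_coeff SO h c')" unfolding T_def by (rule h.mc_patch[OF c'(1)])
    have der: "((\<lambda>u. (p' u, \<theta>' u)) has_vector_derivative
       - christoffel (metric_coeff SO h c') (p t, snd (snd c' (f t))) (p' t, \<theta>' t) (p' t, \<theta>' t)) (at t)"
    proof (rule wagner_geodesic[where N = N and p = p and p' = p' and \<theta>' = \<theta>' and t = t and C = C and \<theta> = "\<lambda>u. snd (snd c' (f u))", OF mp _ _ N(1) tN pT _ _ p'' _ ode])
      show "y \<in> U c \<and> K (chart_inv c y) \<noteq> 0" if "(y, \<phi>) \<in> T" for y \<phi>
        using wagner_coefficients(2,3)[OF c s] that unfolding T_def c'_eq by blast
      show "metric_coeff SO h c' (y, \<phi>) (u, \<tau>) (v, \<rho>)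
         = mc c y u v + (\<tau> + om y u) * (\<rho> + om y v) / (K (chart_inv c y))\<^sup>2" if "(y, \<phi>) \<in> T" for y \<phi> u v \<tau> \<rho>
        using wagner_coefficients(1)[OF c s] that unfolding T_def c'_eq by blast
      show "p u \<in> U c" "(p has_vector_derivative p' u) (at u)" if "u \<in> N" for u
        using has_velocity[OF \<gamma> _ c, of u] that by (auto simp: N_def p_def[abs_def] p'_def)
    qed (simp add: \<theta>'_def)
    define D where "D = {u \<in> I. f u \<in> fst c'}"
    have vel: "velocity SO f u c' = (p' u, \<theta>' u)" if "u \<in> D" for u
    proof -
      have u: "u \<in> I" "f u \<in> fst (frame_chart c s a0)" using that by (simp_all add: D_def c'_eq)
      then have "\<gamma> u \<in> fst c" using base(2)[OF u(1)] frame_chart_mem[OF c s] by simp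
      then show ?thesis
        using rotating_frame_velocity[OF f \<gamma> u(1) c s u(2)] by (simp add: c'_eq p'_def p_def \<theta>'_def chart_inv[OF c])
    qed
    have D: "open D" "t \<in> D" using SO.smooth_curve_chart(1)[OF sc c'(1)] tI c' by (simp_all add: D_def)
    have "((\<lambda>u. velocity SO f u c') has_vector_derivative
       - christoffel (metric_coeff SO h c') (snd c' (f t)) (velocity SO f t c') (velocity SO f t c')) (at t)"
      unfolding vel[OF D(2)]
      by (subst coord, rule has_vector_derivative_transform_within_open[OF der D]) (simp add: vel)
    from vector_derivative_at[OF this] show ?thesis
      using True by (simp add: cov_deriv_along_def levi_civita_eq_christoffel)
  qed
  moreover have "f ` S \<subseteq> W" using base by (auto simp: S_def W_iff)
  ultimately show ?thesis
    unfolding geodesic_on_def using SO.smooth_curve_restrict[OF sc oS SI] by blast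
qed

end

theorem theorem4p3:
  fixes A :: "('a, real^2) chart set"
    and g :: "('a, real^2) metric_field"
    and K :: "'a \<Rightarrow> real"
    and J :: "'a \<Rightarrow> ('a, real^2) tvec \<Rightarrow> ('a, real^2) tvec"
    and h :: "('a frame, (real^2) \<times> real) metric_field"
    and C :: real and a b :: ereal
    and \<gamma> :: "real \<Rightarrow> 'a"
  assumes surface: "oriented_riemannian_surface A g"
    and curvature: "has_curvature A g K"
    and closed: "closedin (atlas_topology A) (zero_curvature_set A K)"
    and submanifold: "embedded_submanifold A 1 (zero_curvature_set A K)"
    and J: "complex_structure A g J"
    and wagner: "wagner_lift A g K h"
    and smooth: "smooth_curve A (einterval a b) \<gamma>"
    and equation: "\<forall>t \<in> einterval a b.
      cov_deriv_along A g \<gamma> (velocity A \<gamma>) t =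
        lincomb (C * K (\<gamma> t)) (J (\<gamma> t) (velocity A \<gamma> t))
                (- (C\<^sup>2 * K (\<gamma> t))) (gradient A g K (\<gamma> t))"
  shows "\<forall>t0 \<in> einterval a b. \<forall>p \<in> SO_bundle A g. bundle_proj p = \<gamma> t0 \<longrightarrow>
    (\<exists>\<gamma>h. smooth_curve (SO_atlas A g) (einterval a b) \<gamma>h \<and>
       \<gamma>h t0 = p \<and>
       (\<forall>t \<in> einterval a b. \<gamma>h t \<in> SO_bundle A g \<and> bundle_proj (\<gamma>h t) = \<gamma> t) \<and>
       geodesic_on (SO_atlas A g) (SO_bundle A g - SO_singular A g K) h
         {t \<in> einterval a b. \<gamma> t \<in> points A - zero_curvature_set A K} \<gamma>h)"
proof (intro ballI impI)
  fix t0 p assume t0: "t0 \<in> einterval a b" and p: "p \<in> SO_bundle A g" "fst p = \<gamma> t0"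
  interpret wagner_surface A g K h by unfold_locales fact+
  let ?I = "einterval a b"
  \<comment> \<open>The end points are extended reals, so unbounded intervals are included and the
    argument passes through the order of \<open>ereal\<close>.\<close>
  have "is_interval ?I"
    unfolding is_interval_1 Ball_def einterval_iff
    by (meson ereal_less_eq(3) le_less_trans less_le_trans)
  then have I: "connected ?I" "open ?I" by (simp_all add: is_interval_connected)
  have "smooth_on ?I (\<lambda>t. C * (K (\<gamma> t))\<^sup>2)"
    unfolding power2_eq_square by (intro smooth_mult smooth_const I smooth_K_along[OF smooth])
  from rotating_frame_exists[OF smooth I(1) this t0 p]
  obtain f where f: "rotating_frame_along (\<lambda>t. C * (K (\<gamma> t))\<^sup>2) \<gamma> ?I f" "f t0 = p" by blast
  have "{t \<in> ?I. \<gamma> t \<in> points A - zero_curvature_set A K} = {t \<in> ?I. K (\<gamma> t) \<noteq> 0}"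
    using smooth by (auto simp: zero_curvature_set_def smooth_curve_def)
  then have "geodesic_on SO W h {t \<in> ?I. \<gamma> t \<in> points A - zero_curvature_set A K} f"
    using lift_geodesic[OF J smooth _ f(1)] equation by simp
  moreover have "\<forall>t \<in> ?I. f t \<in> SO_bundle A g \<and> fst (f t) = \<gamma> t"
    using f(1) by (simp add: rotating_frame_along_def)
  ultimately show "\<exists>\<gamma>h. smooth_curve SO ?I \<gamma>h \<and> \<gamma>h t0 = p \<and>
       (\<forall>t \<in> ?I. \<gamma>h t \<in> SO_bundle A g \<and> fst (\<gamma>h t) = \<gamma> t) \<and>
       geodesic_on SO (SO_bundle A g - SO_singular A g K) h {t \<in> ?I. \<gamma> t \<in> points A - zero_curvature_set A K} \<gamma>h"
    using rotating_frame_smooth_curve[OF f(1) smooth] f(2) unfolding W_def by blast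
qed

end
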